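(* Let $k$ be a field, let $G$ be a finite simple graph on $m$ vertices, let $s\ge 2$ be an integer, and let $\alpha\in(\mathbb Z^+)^m$. Then for all $i,j\ge 1$, $$\beta_{i,j}(I(G^\alpha)^{(s)})\ \ge\ \beta_{i,j}(I(G)^{(s)}).$$
   Context: The edge ideal $I(G)$ of a finite simple graph is the ideal generated by the products $xy$ over all edges $\{x,y\}$, in the polynomial ring over $k$ whose variables are the vertices. Parallelization: for $G$ with vertex set $\{x_1,\dots,x_m\}$ and $\alpha=(\alpha_1,\dots,\alpha_m)\in(\mathbb Z^+)^m$, $G^\alpha$ is the graph with vertex set $\{x_{i,t}: 1\le i\le m,\ 1\le t\le\alpha_i\}$ and edge set $\{\{x_{i,t},x_{j,\ell}\} : \{x_i,x_j\}\in E(G)\}$. Symbolic powers: for a monomial ideal $I$ with primary decomposition $I=I_1\cap\dots\cap I_n$, and $Q$ an associated prime of $I$ maximal under inclusion, put $I_{\subseteq Q}=\bigcap_{\sqrt{I_\ell}\subseteq Q}I_\ell$; then $I^{(s)}=\bigcap_{Q}I_{\subseteq Q}^s$, the intersection running over all associated primes $Q$ of $I$ that are maximal with respect to inclusion. Graded Betti numbers: for a homogeneous ideal $I$ of a polynomial ring $R$ over $k$, $\beta_{i,j}(I)=\dim_k\mathrm{Tor}^R_i(k,I)_j$. Each ideal's Betti numbers are computed over its own polynomial ring. *)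

theory Defs
  imports
    "HOL-Library.Poly_Mapping"
    "HOL-Library.Extended_Nat"
    "HOL-Algebra.Module"
    "HOL-Algebra.Ideal_Product"
    "HOL-Algebra.Free_Abelian_Groups"
begin

section \<open>Graphs and parallelizations\<close>

definition simple_graph :: "'a set \<Rightarrow> 'a set set \<Rightarrow> bool" where
  "simple_graph V E \<longleftrightarrow> finite V \<and> (\<forall>e\<in>E. e \<subseteq> V \<and> card e = 2)"

text \<open>The copy \<open>x\<^sub>i\<^sub>,\<^sub>t\<close> of the vertex \<open>x\<^sub>i\<close> is the pair \<open>(x\<^sub>i, t)\<close>; the vector of
  multiplicities is a function on vertices.\<close>

definition par_verts :: "'a set \<Rightarrow> ('a \<Rightarrow> nat) \<Rightarrow> ('a \<times> nat) set" where
  "par_verts V \<alpha> = {(x, t). x \<in> V \<and> 1 \<le> t \<and> t \<le> \<alpha> x}"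

definition par_edges :: "'a set \<Rightarrow> 'a set set \<Rightarrow> ('a \<Rightarrow> nat) \<Rightarrow> ('a \<times> nat) set set" where
  "par_edges V E \<alpha> =
     {{(x, t), (y, l)} | x t y l.
        (x, t) \<in> par_verts V \<alpha> \<and> (y, l) \<in> par_verts V \<alpha> \<and> {x, y} \<in> E}"


section \<open>Polynomial rings and edge ideals\<close>

text \<open>Monomials are finitely supported exponent vectors, and a polynomial maps monomials to
  coefficients. The ring \<open>poly_ring V\<close> is the polynomial ring over the field \<open>'k\<close> whose
  variables are the elements of \<open>V\<close>.\<close>

type_synonym ('x, 'k) mpoly = "('x \<Rightarrow>\<^sub>0 nat) \<Rightarrow>\<^sub>0 'k"

definition poly_ring :: "'x set \<Rightarrow> ('x, 'k::field) mpoly ring" where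
  "poly_ring V =
     \<lparr>carrier = {p. \<forall>t\<in>Poly_Mapping.keys p. Poly_Mapping.keys t \<subseteq> V},
      mult = (*), one = 1, ring.zero = 0, add = (+)\<rparr>"

definition var :: "'x \<Rightarrow> ('x, 'k::field) mpoly" where
  "var x = Poly_Mapping.single (Poly_Mapping.single x 1) 1"

definition const :: "'k \<Rightarrow> ('x, 'k::field) mpoly" where
  "const c = Poly_Mapping.single 0 c"

definition mon_deg :: "('x \<Rightarrow>\<^sub>0 nat) \<Rightarrow> nat" where
  "mon_deg t = (\<Sum>x\<in>Poly_Mapping.keys t. Poly_Mapping.lookup t x)"

definition edge_ideal :: "'x set \<Rightarrow> 'x set set \<Rightarrow> ('x, 'k::field) mpoly set" where
  "edge_ideal V E = Idl\<^bsub>poly_ring V\<^esub> {var x * var y | x y. {x, y} \<in> E}"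


section \<open>Symbolic powers\<close>

definition radical_of :: "('r, 'c) ring_scheme \<Rightarrow> 'r set \<Rightarrow> 'r set" where
  "radical_of R I = {r \<in> carrier R. \<exists>n::nat. r [^]\<^bsub>R\<^esub> n \<in> I}"

definition primary_ideal :: "('r, 'c) ring_scheme \<Rightarrow> 'r set \<Rightarrow> bool" where
  "primary_ideal R J \<longleftrightarrow> ideal J R \<and> J \<noteq> carrier R \<and>
     (\<forall>a\<in>carrier R. \<forall>b\<in>carrier R. a \<otimes>\<^bsub>R\<^esub> b \<in> J \<longrightarrow> a \<in> J \<or> b \<in> radical_of R J)"

text \<open>Intersections of families of ideals are cut down to the carrier, so that the intersection
  of the empty family is the unit ideal.\<close>

definition primary_decomposition :: "('r, 'c) ring_scheme \<Rightarrow> 'r set \<Rightarrow> 'r set set \<Rightarrow> bool" where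
  "primary_decomposition R I D \<longleftrightarrow>
     finite D \<and> (\<forall>J\<in>D. primary_ideal R J) \<and> I = carrier R \<inter> \<Inter>D"

text \<open>The associated primes of \<open>I\<close> are the prime ideals of the form \<open>(I : f)\<close>.\<close>

definition assoc_primes :: "('r, 'c) ring_scheme \<Rightarrow> 'r set \<Rightarrow> 'r set set" where
  "assoc_primes R I =
     {P. primeideal P R \<and> (\<exists>f\<in>carrier R. P = {r \<in> carrier R. r \<otimes>\<^bsub>R\<^esub> f \<in> I})}"

definition max_assoc_primes :: "('r, 'c) ring_scheme \<Rightarrow> 'r set \<Rightarrow> 'r set set" where
  "max_assoc_primes R I =
     {Q \<in> assoc_primes R I. \<forall>P\<in>assoc_primes R I. Q \<subseteq> P \<longrightarrow> P = Q}"

definition sub_part :: "('r, 'c) ring_scheme \<Rightarrow> 'r set set \<Rightarrow> 'r set \<Rightarrow> 'r set" where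
  "sub_part R D Q = carrier R \<inter> \<Inter>{J \<in> D. radical_of R J \<subseteq> Q}"

text \<open>For an associated prime \<open>Q\<close> the ideal \<open>I\<^bsub>\<subseteq>Q\<^esub>\<close> is the contraction of the localization
  of \<open>I\<close> at \<open>Q\<close>, so it does not depend on the primary decomposition that is chosen here.\<close>

definition symbolic_power :: "('r, 'c) ring_scheme \<Rightarrow> 'r set \<Rightarrow> nat \<Rightarrow> 'r set" where
  "symbolic_power R I s =
     (let D = (SOME D. primary_decomposition R I D)
      in carrier R \<inter> (\<Inter>Q\<in>max_assoc_primes R I. sub_part R D Q [^]\<^bsub>ideals_set R\<^esub> s))"


section \<open>Modules and tensor products\<close>

definition linear_map ::
  "('r, 'c) ring_scheme \<Rightarrow> ('r, 'm) module \<Rightarrow> ('r, 'n) module \<Rightarrow> ('m \<Rightarrow> 'n) \<Rightarrow> bool" where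
  "linear_map R M N f \<longleftrightarrow> f \<in> carrier M \<rightarrow> carrier N \<and>
     (\<forall>x\<in>carrier M. \<forall>y\<in>carrier M. f (x \<oplus>\<^bsub>M\<^esub> y) = f x \<oplus>\<^bsub>N\<^esub> f y) \<and>
     (\<forall>r\<in>carrier R. \<forall>x\<in>carrier M. f (r \<odot>\<^bsub>M\<^esub> x) = r \<odot>\<^bsub>N\<^esub> f x)"

text \<open>The tensor product of two modules over a commutative ring is the free abelian group on
  pairs modulo the subgroup generated by the usual relations.\<close>

definition tensor_free :: "('r, 'm) module \<Rightarrow> ('r, 'n) module \<Rightarrow> (('m \<times> 'n) \<Rightarrow>\<^sub>0 int) monoid" where
  "tensor_free M N = free_Abelian_group (carrier M \<times> carrier N)"

definition tensor_rels ::
  "('r, 'c) ring_scheme \<Rightarrow> ('r, 'm) module \<Rightarrow> ('r, 'n) module \<Rightarrow> (('m \<times> 'n) \<Rightarrow>\<^sub>0 int) set" where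
  "tensor_rels R M N = generate (tensor_free M N)
     ({frag_of (x \<oplus>\<^bsub>M\<^esub> x', y) - frag_of (x, y) - frag_of (x', y) | x x' y.
         x \<in> carrier M \<and> x' \<in> carrier M \<and> y \<in> carrier N}
    \<union> {frag_of (x, y \<oplus>\<^bsub>N\<^esub> y') - frag_of (x, y) - frag_of (x, y') | x y y'.
         x \<in> carrier M \<and> y \<in> carrier N \<and> y' \<in> carrier N}
    \<union> {frag_of (r \<odot>\<^bsub>M\<^esub> x, y) - frag_of (x, r \<odot>\<^bsub>N\<^esub> y) | r x y.
         r \<in> carrier R \<and> x \<in> carrier M \<and> y \<in> carrier N})"

definition tensor_class ::
  "('r, 'c) ring_scheme \<Rightarrow> ('r, 'm) module \<Rightarrow> ('r, 'n) module \<Rightarrow>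
   (('m \<times> 'n) \<Rightarrow>\<^sub>0 int) \<Rightarrow> (('m \<times> 'n) \<Rightarrow>\<^sub>0 int) set" where
  "tensor_class R M N z = tensor_rels R M N #>\<^bsub>tensor_free M N\<^esub> z"

text \<open>Maps out of the quotient are given on a coset \<open>X\<close> as the union, over the representatives
  \<open>z \<in> X\<close>, of the cosets of the images; these cosets all coincide. The ring fields
  \<open>mult\<close> and \<open>one\<close> of a module record carry no meaning and are left unspecified.\<close>

definition tensor ::
  "('r, 'c) ring_scheme \<Rightarrow> ('r, 'm) module \<Rightarrow> ('r, 'n) module \<Rightarrow>
   ('r, (('m \<times> 'n) \<Rightarrow>\<^sub>0 int) set) module" where
  "tensor R M N =
     (let T = tensor_free M N Mod tensor_rels R M N
      in \<lparr>carrier = carrier T, mult = undefined, one = undefined,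
          ring.zero = \<one>\<^bsub>T\<^esub>, add = mult T,
          smult = (\<lambda>r X. \<Union>z\<in>X. tensor_class R M N
                            (frag_extend (\<lambda>(x, y). frag_of (r \<odot>\<^bsub>M\<^esub> x, y)) z))\<rparr>)"

text \<open>The map \<open>id \<otimes> f : M \<otimes> N \<rightarrow> M \<otimes> N'\<close> induced by \<open>f : N \<rightarrow> N'\<close>.\<close>

definition tensor_map ::
  "('r, 'c) ring_scheme \<Rightarrow> ('r, 'm) module \<Rightarrow> ('r, 'n') module \<Rightarrow> ('n \<Rightarrow> 'n') \<Rightarrow>
   (('m \<times> 'n) \<Rightarrow>\<^sub>0 int) set \<Rightarrow> (('m \<times> 'n') \<Rightarrow>\<^sub>0 int) set" where
  "tensor_map R M N' f X =
     (\<Union>z\<in>X. tensor_class R M N' (frag_extend (\<lambda>(x, y). frag_of (x, f y)) z))"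


section \<open>Graded free resolutions\<close>

text \<open>The field as the module \<open>k = R/\<mm>\<close>: a polynomial acts through its constant term.\<close>

definition field_module :: "(('x, 'k::field) mpoly, 'k) module" where
  "field_module = \<lparr>carrier = UNIV, mult = (*), one = 1, ring.zero = 0, add = (+),
                   smult = (\<lambda>p a. Poly_Mapping.lookup p 0 * a)\<rparr>"

definition ideal_module ::
  "('x, 'k::field) mpoly set \<Rightarrow> (('x, 'k) mpoly, ('x, 'k) mpoly) module" where
  "ideal_module I = \<lparr>carrier = I, mult = (*), one = 1, ring.zero = 0, add = (+), smult = (*)\<rparr>"

definition homog_part :: "('x, 'k::field) mpoly set \<Rightarrow> int \<Rightarrow> ('x, 'k) mpoly set" where
  "homog_part I j = {p \<in> I. \<forall>t\<in>Poly_Mapping.keys p. int (mon_deg t) = j}"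

text \<open>The free module over \<open>poly_ring V\<close> with basis \<open>B\<close>, and its part of degree \<open>j\<close> when the
  basis element \<open>b\<close> is placed in degree \<open>d b\<close>. Bases are sets of natural numbers, possibly
  infinite; since all modules in question have countable dimension over the field, this is
  enough for every homogeneous ideal to have a resolution.\<close>

definition free_module ::
  "'x set \<Rightarrow> nat set \<Rightarrow> (('x, 'k::field) mpoly, nat \<Rightarrow>\<^sub>0 ('x, 'k) mpoly) module" where
  "free_module V B =
     \<lparr>carrier = {f. Poly_Mapping.keys f \<subseteq> B \<and>
                     (\<forall>b. Poly_Mapping.lookup f b \<in> carrier (poly_ring V))},
      mult = undefined, one = undefined, ring.zero = 0, add = (+),
      smult = (\<lambda>p. Poly_Mapping.map ((*) p))\<rparr>"

definition free_part ::
  "'x set \<Rightarrow> nat set \<Rightarrow> (nat \<Rightarrow> int) \<Rightarrow> int \<Rightarrow> (nat \<Rightarrow>\<^sub>0 ('x, 'k::field) mpoly) set" where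
  "free_part V B d j =
     {f \<in> carrier (free_module V B).
        \<forall>b\<in>Poly_Mapping.keys f. \<forall>t\<in>Poly_Mapping.keys (Poly_Mapping.lookup f b).
          int (mon_deg t) + d b = j}"

text \<open>In homological degree \<open>i\<close> the module \<open>F\<^sub>i\<close> has basis \<open>basis i\<close> with degrees \<open>shift i\<close>;
  the map \<open>bd i\<close> goes from \<open>F\<^sub>i\<^sub>+\<^sub>1\<close> to \<open>F\<^sub>i\<close>, and \<open>aug\<close> goes from \<open>F\<^sub>0\<close> to the ideal.\<close>

record (overloaded) ('x, 'k) free_complex =
  basis :: "nat \<Rightarrow> nat set"
  shift :: "nat \<Rightarrow> nat \<Rightarrow> int"
  bd :: "nat \<Rightarrow> (nat \<Rightarrow>\<^sub>0 ('x, 'k) mpoly) \<Rightarrow> (nat \<Rightarrow>\<^sub>0 ('x, 'k) mpoly)"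
  aug :: "(nat \<Rightarrow>\<^sub>0 ('x, 'k) mpoly) \<Rightarrow> ('x, 'k) mpoly"

abbreviation fc_mod ::
  "'x set \<Rightarrow> ('x, 'k::field) free_complex \<Rightarrow> nat \<Rightarrow>
   (('x, 'k) mpoly, nat \<Rightarrow>\<^sub>0 ('x, 'k) mpoly) module" where
  "fc_mod V F i \<equiv> free_module V (basis F i)"

abbreviation fc_part ::
  "'x set \<Rightarrow> ('x, 'k::field) free_complex \<Rightarrow> nat \<Rightarrow> int \<Rightarrow> (nat \<Rightarrow>\<^sub>0 ('x, 'k) mpoly) set" where
  "fc_part V F i j \<equiv> free_part V (basis F i) (shift F i) j"

definition graded_free_resolution ::
  "'x set \<Rightarrow> ('x, 'k::field) mpoly set \<Rightarrow> ('x, 'k) free_complex \<Rightarrow> bool" where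
  "graded_free_resolution V I F \<longleftrightarrow>
     linear_map (poly_ring V) (fc_mod V F 0) (ideal_module I) (aug F) \<and>
     (\<forall>j. aug F ` fc_part V F 0 j \<subseteq> homog_part I j) \<and>
     (\<forall>i. linear_map (poly_ring V) (fc_mod V F (Suc i)) (fc_mod V F i) (bd F i)) \<and>
     (\<forall>i j. bd F i ` fc_part V F (Suc i) j \<subseteq> fc_part V F i j) \<and>
     aug F ` carrier (fc_mod V F 0) = I \<and>
     bd F 0 ` carrier (fc_mod V F 1) = {f \<in> carrier (fc_mod V F 0). aug F f = 0} \<and>
     (\<forall>i. bd F (Suc i) ` carrier (fc_mod V F (Suc (Suc i))) =
          {f \<in> carrier (fc_mod V F (Suc i)). bd F i f = 0})"


section \<open>Graded Betti numbers\<close>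

abbreviation tor_mod ::
  "'x set \<Rightarrow> ('x, 'k::field) free_complex \<Rightarrow> nat \<Rightarrow>
   (('x, 'k) mpoly, (('k \<times> (nat \<Rightarrow>\<^sub>0 ('x, 'k) mpoly)) \<Rightarrow>\<^sub>0 int) set) module" where
  "tor_mod V F i \<equiv> tensor (poly_ring V) field_module (fc_mod V F i)"

abbreviation tor_bd ::
  "'x set \<Rightarrow> ('x, 'k::field) free_complex \<Rightarrow> nat \<Rightarrow>
   (('k \<times> (nat \<Rightarrow>\<^sub>0 ('x, 'k) mpoly)) \<Rightarrow>\<^sub>0 int) set \<Rightarrow>
   (('k \<times> (nat \<Rightarrow>\<^sub>0 ('x, 'k) mpoly)) \<Rightarrow>\<^sub>0 int) set" where
  "tor_bd V F i \<equiv> tensor_map (poly_ring V) field_module (fc_mod V F i) (bd F i)"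

text \<open>The field sits in degree 0, so the part of degree \<open>j\<close> of \<open>k \<otimes> F\<^sub>i\<close> is spanned by the
  \<open>a \<otimes> f\<close> with \<open>f\<close> homogeneous of degree \<open>j\<close>.\<close>

definition tor_part ::
  "'x set \<Rightarrow> ('x, 'k::field) free_complex \<Rightarrow> nat \<Rightarrow> int \<Rightarrow>
   (('k \<times> (nat \<Rightarrow>\<^sub>0 ('x, 'k) mpoly)) \<Rightarrow>\<^sub>0 int) set set" where
  "tor_part V F i j =
     tensor_class (poly_ring V) field_module (fc_mod V F i) `
       carrier (free_Abelian_group (UNIV \<times> fc_part V F i j))"

definition tor_cycles ::
  "'x set \<Rightarrow> ('x, 'k::field) free_complex \<Rightarrow> nat \<Rightarrow> int \<Rightarrow>
   (('k \<times> (nat \<Rightarrow>\<^sub>0 ('x, 'k) mpoly)) \<Rightarrow>\<^sub>0 int) set set" where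
  "tor_cycles V F i j =
     {X \<in> tor_part V F i j.
        case i of 0 \<Rightarrow> True | Suc h \<Rightarrow> tor_bd V F h X = \<zero>\<^bsub>tor_mod V F h\<^esub>}"

definition tor_boundaries ::
  "'x set \<Rightarrow> ('x, 'k::field) free_complex \<Rightarrow> nat \<Rightarrow> int \<Rightarrow>
   (('k \<times> (nat \<Rightarrow>\<^sub>0 ('x, 'k) mpoly)) \<Rightarrow>\<^sub>0 int) set set" where
  "tor_boundaries V F i j = tor_bd V F i ` tor_part V F (Suc i) j"

text \<open>The dimension over the field (acting through constant polynomials) of the quotient \<open>Z/U\<close>
  of two subspaces \<open>U \<subseteq> Z\<close> of a module \<open>M\<close>: the supremum of the sizes of finite subsets of
  \<open>Z\<close> that are linearly independent modulo \<open>U\<close>.\<close>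

definition quot_dim :: "(('x, 'k::field) mpoly, 'm) module \<Rightarrow> 'm set \<Rightarrow> 'm set \<Rightarrow> enat" where
  "quot_dim M Z U =
     Sup {enat (card X) | X. finite X \<and> X \<subseteq> Z \<and>
            (\<forall>c. (\<Oplus>\<^bsub>M\<^esub>x\<in>X. const (c x) \<odot>\<^bsub>M\<^esub> x) \<in> U \<longrightarrow> (\<forall>x\<in>X. c x = 0))}"

text \<open>\<open>betti V I i j\<close> is the dimension of \<open>Tor\<^sub>i(k, I)\<^sub>j\<close> over \<open>poly_ring V\<close>, where Tor is the
  homology of \<open>k \<otimes> F\<close> for a graded free resolution \<open>F\<close> of \<open>I\<close>; the choice of \<open>F\<close> does not
  matter. The values are finite for finite \<open>V\<close> and homogeneous \<open>I\<close>, but the codomain does not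
  presuppose this.\<close>

definition betti :: "'x set \<Rightarrow> ('x, 'k::field) mpoly set \<Rightarrow> nat \<Rightarrow> int \<Rightarrow> enat" where
  "betti V I i j =
     (let F = (SOME F. graded_free_resolution V I F)
      in quot_dim (tor_mod V F i) (tor_cycles V F i j) (tor_boundaries V F i j))"

end

theory Submission
  imports Defs
begin

text \<open>Send a vertex \<open>x\<close> to its first copy \<open>(x, 1)\<close>. This includes the polynomial ring \<open>R\<close> of \<open>G\<close>
  into the polynomial ring \<open>S\<close> of the parallelization, and the homomorphism that sends \<open>(x, 1)\<close> back
  to \<open>x\<close> and all other copies to zero is a retraction \<open>S \<rightarrow> R\<close>. Write \<open>I\<close> and \<open>J\<close> for the two symbolic
  powers. The symbolic power of an edge ideal is spanned by the monomials whose degree in every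
  vertex cover is at least \<open>s\<close> (\<open>symbolic_power_edge_ideal\<close>). Vertex covers of \<open>G\<close> and of the
  parallelization restrict and extend to each other along the copying of vertices, so the inclusion
  maps \<open>I\<close> into \<open>J\<close>, and the retraction maps \<open>J\<close> into \<open>I\<close>.

  Hence \<open>I\<close> is a retract of \<open>J\<close>, compatibly with the two rings, and functoriality of Tor turns
  this into maps \<open>Tor\<^sub>i(k, I)\<^sub>j \<rightarrow> Tor\<^sub>i(k, J)\<^sub>j \<rightarrow> Tor\<^sub>i(k, I)\<^sub>j\<close> whose composite is the identity; the
  first one is injective, which is the inequality (\<open>betti_le_if_retract\<close>). Concretely, the inclusion
  and the retraction lift to graded semilinear chain maps between any two graded free resolutions
  (\<open>chain_map_exists\<close>), and the composite of the lifts is homotopic to the identity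
  (\<open>chain_homotopy_exists\<close>). This applies to the resolutions that define the two Betti numbers,
  whichever these are, provided that graded free resolutions with countable bases exist
  (\<open>graded_free_resolution_exists\<close>).\<close>

section \<open>Polynomials and partial renamings of variables\<close>

abbreviation supp :: "('a \<Rightarrow>\<^sub>0 'b::zero) \<Rightarrow> 'a set" where
  "supp \<equiv> Poly_Mapping.keys"

abbreviation cf :: "('a \<Rightarrow>\<^sub>0 'b::zero) \<Rightarrow> 'a \<Rightarrow> 'b" where
  "cf \<equiv> Poly_Mapping.lookup"

lemma sum_singles:
  fixes p :: "'a \<Rightarrow>\<^sub>0 'b::comm_monoid_add"
  shows "(\<Sum>t\<in>supp p. Poly_Mapping.single t (cf p t)) = p"
proof (rule poly_mapping_eqI)
  fix k
  have "cf (\<Sum>t\<in>supp p. Poly_Mapping.single t (cf p t)) k = (\<Sum>t\<in>supp p. if k = t then cf p t else 0)"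
    by (auto simp: lookup_sum lookup_single when_def intro!: sum.cong)
  also have "\<dots> = cf p k"
    by (simp add: in_keys_iff)
  finally show "cf (\<Sum>t\<in>supp p. Poly_Mapping.single t (cf p t)) k = cf p k" .
qed

lemma singles_induct:
  fixes p :: "'a \<Rightarrow>\<^sub>0 'b::comm_monoid_add"
  assumes "P 0" "\<And>t. t \<in> supp p \<Longrightarrow> P (Poly_Mapping.single t (cf p t))"
    "\<And>q r. P q \<Longrightarrow> P r \<Longrightarrow> P (q + r)"
  shows "P p"
proof -
  have "P (\<Sum>t\<in>T. Poly_Mapping.single t (cf p t))" if "finite T" "T \<subseteq> supp p" for T
    using that by (induction T) (auto intro: assms)
  from this[of "supp p"] show ?thesis by (simp add: sum_singles)
qed

lemma supp_add_nat: "supp (s + t) = supp s \<union> supp (t :: 'a \<Rightarrow>\<^sub>0 nat)"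
  by (auto simp: in_keys_iff lookup_add)

lemma mon_deg_superset: "finite A \<Longrightarrow> supp t \<subseteq> A \<Longrightarrow> mon_deg t = (\<Sum>x\<in>A. cf t x)"
  unfolding mon_deg_def by (rule sum.mono_neutral_left) (auto simp: in_keys_iff)

lemma mon_deg_add: "mon_deg (s + t) = mon_deg s + mon_deg t"
proof -
  have "mon_deg (s + t) = (\<Sum>x\<in>supp s \<union> supp t. cf (s + t) x)"
    by (simp add: mon_deg_def supp_add_nat)
  also have "\<dots> = (\<Sum>x\<in>supp s \<union> supp t. cf s x) + (\<Sum>x\<in>supp s \<union> supp t. cf t x)"
    by (simp add: lookup_add sum.distrib)
  also have "\<dots> = mon_deg s + mon_deg t"
    by (metis Un_upper1 Un_upper2 finite_Un finite_keys mon_deg_superset)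
  finally show ?thesis .
qed

lemma mon_deg_0 [simp]: "mon_deg 0 = 0"
  by (simp add: mon_deg_def)

lemma mon_deg_single [simp]: "mon_deg (Poly_Mapping.single x n) = n"
  by (simp add: mon_deg_def)

lemma mon_deg_eq_0_iff: "mon_deg t = 0 \<longleftrightarrow> t = 0"
proof
  assume "mon_deg t = 0"
  then have "\<forall>x\<in>supp t. cf t x = 0"
    by (simp add: mon_deg_def)
  then show "t = 0" by (intro poly_mapping_eqI) (auto simp: in_keys_iff)
qed auto

definition push :: "('a \<Rightarrow> 'b) \<Rightarrow> ('a \<Rightarrow>\<^sub>0 nat) \<Rightarrow> ('b \<Rightarrow>\<^sub>0 nat)" where
  "push f t = (\<Sum>x\<in>supp t. Poly_Mapping.single (f x) (cf t x))"

lemma push_add: "push f (s + t) = push f s + push f t"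
  unfolding push_def
  by (rule setsum_keys_plus_distrib) (auto simp: single_add)

lemma push_0 [simp]: "push f 0 = 0"
  by (simp add: push_def)

lemma push_single [simp]: "push f (Poly_Mapping.single x n) = Poly_Mapping.single (f x) n"
  by (simp add: push_def)

lemma push_sum: "push f (\<Sum>i\<in>A. t i) = (\<Sum>i\<in>A. push f (t i))"
  by (induction A rule: infinite_finite_induct) (auto simp: push_add)

lemma mon_deg_push [simp]: "mon_deg (push f t) = mon_deg t"
  by (induction t rule: singles_induct) (auto simp: push_add mon_deg_add)

lemma supp_push: "supp (push f t) = f ` supp t"
proof -
  have "supp (push f t) = f ` supp t \<and> True"
  proof (induction t rule: singles_induct)
    case (2 x) then show ?case by (auto simp: in_keys_iff)
  qed (auto simp: push_add supp_add_nat)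
  then show ?thesis by simp
qed

lemma push_push: "(\<And>x. x \<in> supp t \<Longrightarrow> g (f x) = x) \<Longrightarrow> push g (push f t) = t"
  by (simp add: push_def[of f] push_sum sum_singles cong: sum.cong)

lemma poly_ring_carrier: "p \<in> carrier (poly_ring V) \<longleftrightarrow> (\<forall>t\<in>supp p. supp t \<subseteq> V)"
  by (simp add: poly_ring_def)

lemma poly_ring_simps [simp]:
  "p \<otimes>\<^bsub>poly_ring V\<^esub> q = p * q" "p \<oplus>\<^bsub>poly_ring V\<^esub> q = p + q"
  "\<one>\<^bsub>poly_ring V\<^esub> = 1" "\<zero>\<^bsub>poly_ring V\<^esub> = 0"
  by (simp_all add: poly_ring_def)

lemma poly_ring_closed:
  "0 \<in> carrier (poly_ring V)" "1 \<in> carrier (poly_ring V)"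
  "p \<in> carrier (poly_ring V) \<Longrightarrow> q \<in> carrier (poly_ring V) \<Longrightarrow> p + q \<in> carrier (poly_ring V)"
  "p \<in> carrier (poly_ring V) \<Longrightarrow> - p \<in> carrier (poly_ring V)"
  "p \<in> carrier (poly_ring V) \<Longrightarrow> q \<in> carrier (poly_ring V) \<Longrightarrow> p * q \<in> carrier (poly_ring V)"
  "const c \<in> carrier (poly_ring V)"
  "Poly_Mapping.single t c \<in> carrier (poly_ring V) \<longleftrightarrow> c = 0 \<or> supp t \<subseteq> V"
  using keys_add[of p q] keys_mult[of p q]
  by (auto simp: poly_ring_carrier const_def) (fastforce simp: supp_add_nat)+

lemma poly_ring_cring: "cring (poly_ring V :: ('x, 'k::field) mpoly ring)"
proof (rule cringI)
  show "abelian_group (poly_ring V :: ('x, 'k) mpoly ring)"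
  proof (rule abelian_groupI)
    fix p :: "('x, 'k) mpoly" assume "p \<in> carrier (poly_ring V)"
    then show "\<exists>q\<in>carrier (poly_ring V). q \<oplus>\<^bsub>poly_ring V\<^esub> p = \<zero>\<^bsub>poly_ring V\<^esub>"
      by (intro bexI[of _ "-p"]) (auto intro: poly_ring_closed)
  qed (auto intro: poly_ring_closed simp: algebra_simps)
  show "comm_monoid (poly_ring V :: ('x, 'k) mpoly ring)"
    by (rule comm_monoidI) (auto intro: poly_ring_closed simp: algebra_simps)
qed (auto simp: algebra_simps)

lemma poly_ring_ring: "ring (poly_ring V)"
  using poly_ring_cring by (rule cring.axioms)

definition rename_mon ::
  "('x \<Rightarrow> 'y option) \<Rightarrow> ('x \<Rightarrow>\<^sub>0 nat) \<Rightarrow> 'k \<Rightarrow> ('y, 'k::field) mpoly" where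
  "rename_mon \<sigma> t c = (if supp t \<subseteq> dom \<sigma> then Poly_Mapping.single (push (the \<circ> \<sigma>) t) c else 0)"

text \<open>The algebra homomorphism that sends a variable to another variable or to zero. The inclusion
  of a polynomial ring into a larger one, the retraction that kills the additional variables, and
  the quotient by an ideal generated by variables are all of this form.\<close>

definition rename :: "('x \<Rightarrow> 'y option) \<Rightarrow> ('x, 'k) mpoly \<Rightarrow> ('y, 'k::field) mpoly" where
  "rename \<sigma> p = (\<Sum>t\<in>supp p. rename_mon \<sigma> t (cf p t))"

lemma rename_add: "rename \<sigma> (p + q) = rename \<sigma> p + rename \<sigma> q"
  unfolding rename_def by (rule setsum_keys_plus_distrib) (auto simp: rename_mon_def single_add)

lemma rename_0 [simp]: "rename \<sigma> 0 = 0"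
  by (simp add: rename_def)

lemma rename_single: "rename \<sigma> (Poly_Mapping.single t c) = rename_mon \<sigma> t c"
  by (simp add: rename_def rename_mon_def)

lemma rename_mon_mult: "rename_mon \<sigma> (s + t) (c * d) = rename_mon \<sigma> s c * rename_mon \<sigma> t d"
  by (simp add: rename_mon_def supp_add_nat push_add mult_single)

lemma rename_mult: "rename \<sigma> (p * q) = rename \<sigma> p * rename \<sigma> q"
proof (induction p rule: singles_induct)
  case (2 s)
  show ?case
    by (induction q rule: singles_induct)
      (auto simp: rename_add rename_single mult_single rename_mon_mult distrib_left)
qed (auto simp: rename_add algebra_simps)

lemma rename_const [simp]: "rename \<sigma> (const c) = const c"
  by (simp add: const_def rename_single rename_mon_def)

lemma cf_rename_0: "cf (rename \<sigma> p) 0 = cf p 0"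
proof (induction p rule: singles_induct)
  case (2 t)
  have "push (the \<circ> \<sigma>) t = 0 \<longleftrightarrow> t = 0"
    by (metis mon_deg_push mon_deg_eq_0_iff)
  then show ?case
    by (auto simp: rename_single rename_mon_def lookup_single when_def)
qed (auto simp: rename_add lookup_add)

lemma supp_rename:
  assumes "t \<in> supp (rename \<sigma> p)"
  obtains u where "u \<in> supp p" "supp u \<subseteq> dom \<sigma>" "t = push (the \<circ> \<sigma>) u"
proof -
  have "supp (rename \<sigma> p) \<subseteq> (\<Union>u\<in>supp p. supp (rename_mon \<sigma> u (cf p u)))"
    unfolding rename_def using keys_sum by fastforce
  with assms obtain u where "u \<in> supp p" "t \<in> supp (rename_mon \<sigma> u (cf p u))"
    by blast
  then show ?thesis by (intro that) (auto simp: rename_mon_def split: if_splits)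
qed

lemma rename_in_poly_ring:
  assumes "p \<in> carrier (poly_ring V)" "\<And>x y. x \<in> V \<Longrightarrow> \<sigma> x = Some y \<Longrightarrow> y \<in> W"
  shows "rename \<sigma> p \<in> carrier (poly_ring W)"
  unfolding poly_ring_carrier
proof
  fix t assume "t \<in> supp (rename \<sigma> p)"
  then obtain u where u: "u \<in> supp p" "supp u \<subseteq> dom \<sigma>" "t = push (the \<circ> \<sigma>) u"
    by (rule supp_rename)
  then have "supp u \<subseteq> V" using assms(1) by (auto simp: poly_ring_carrier)
  then show "supp t \<subseteq> W" using u assms(2) by (fastforce simp: supp_push)
qed

text \<open>A map \<open>\<tau>\<close> that undoes \<open>\<sigma>\<close> where \<open>\<sigma>\<close> is defined recovers every coefficient except those of the
  monomials that \<open>\<sigma>\<close> kills. This identifies the kernel of a renaming that is injective on the variables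
  it keeps.\<close>

lemma cf_rename_rename:
  assumes "p \<in> carrier (poly_ring V)" "\<And>x y. x \<in> V \<Longrightarrow> \<sigma> x = Some y \<Longrightarrow> \<tau> y = Some x"
  shows "cf (rename \<tau> (rename \<sigma> p)) u = (if supp u \<subseteq> dom \<sigma> then cf p u else 0)"
proof (induction p rule: singles_induct)
  case (2 t)
  have V: "supp t \<subseteq> V" using 2 assms(1) by (auto simp: poly_ring_carrier)
  show ?case
  proof (cases "supp t \<subseteq> dom \<sigma>")
    case True
    have "supp (push (the \<circ> \<sigma>) t) \<subseteq> dom \<tau>" using True V assms(2) by (fastforce simp: supp_push)
    moreover have "push (the \<circ> \<tau>) (push (the \<circ> \<sigma>) t) = t"
      by (rule push_push) (use True V assms(2) in fastforce)
    ultimately show ?thesis using True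
      by (auto simp: rename_single rename_mon_def lookup_single when_def)
  qed (auto simp: rename_single rename_mon_def lookup_single when_def)
qed (auto simp: rename_add lookup_add)

lemma rename_inverse:
  assumes "p \<in> carrier (poly_ring V)" "\<And>x. x \<in> V \<Longrightarrow> \<exists>y. \<sigma> x = Some y \<and> \<tau> y = Some x"
  shows "rename \<tau> (rename \<sigma> p) = p"
proof (rule poly_mapping_eqI)
  fix u
  have *: "\<tau> y = Some x" if "x \<in> V" "\<sigma> x = Some y" for x y
    using assms(2) that by fastforce
  have "cf p u = 0" if "\<not> supp u \<subseteq> dom \<sigma>"
  proof (rule ccontr)
    assume "cf p u \<noteq> 0"
    then have "supp u \<subseteq> V" using assms(1) by (simp add: poly_ring_carrier in_keys_iff)
    then show False using that assms(2) by blast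
  qed
  then show "cf (rename \<tau> (rename \<sigma> p)) u = cf p u"
    by (simp add: cf_rename_rename[OF assms(1) *])
qed

section \<open>Symbolic powers of edge ideals\<close>

text \<open>The ideals attached to a graph are spanned by monomials, so they are given by a predicate on exponent
  vectors, and inclusions between them are checked one monomial at a time.\<close>

definition monomial_ideal :: "'x set \<Rightarrow> (('x \<Rightarrow>\<^sub>0 nat) \<Rightarrow> bool) \<Rightarrow> ('x, 'k::field) mpoly set" where
  "monomial_ideal V Q = {p \<in> carrier (poly_ring V). \<forall>t\<in>supp p. Q t}"

lemma poly_ring_a_inv:
  "p \<in> carrier (poly_ring V) \<Longrightarrow> \<ominus>\<^bsub>poly_ring V\<^esub> p = - (p :: ('x, 'k::field) mpoly)"
  using abelian_group.minus_equality[OF ring.is_abelian_group[OF poly_ring_ring[of V]], of "-p" p]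
  by (auto intro: poly_ring_closed)

lemma monomial_ideal_mult:
  assumes "\<And>s t. Q s \<Longrightarrow> Q (s + t)" "p \<in> monomial_ideal V Q" "q \<in> carrier (poly_ring V)"
  shows "p * q \<in> monomial_ideal V Q"
  using assms keys_mult[of p q] poly_ring_closed(5)[of p V q]
  unfolding monomial_ideal_def by blast

lemma monomial_ideal_add:
  "p \<in> monomial_ideal V Q \<Longrightarrow> q \<in> monomial_ideal V Q \<Longrightarrow> p + q \<in> monomial_ideal V Q"
  using keys_add[of p q] poly_ring_closed(3)[of p V q] unfolding monomial_ideal_def by blast

lemma ideal_monomial_ideal:
  assumes up: "\<And>s t. Q s \<Longrightarrow> Q (s + t)"
  shows "ideal (monomial_ideal V Q :: ('x, 'k::field) mpoly set) (poly_ring V)"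
proof (rule idealI)
  show "subgroup (monomial_ideal V Q :: ('x, 'k) mpoly set) (add_monoid (poly_ring V))"
  proof
    fix p :: "('x, 'k) mpoly" assume p: "p \<in> monomial_ideal V Q"
    then have "inv\<^bsub>add_monoid (poly_ring V)\<^esub> p = - p"
      using poly_ring_a_inv[of p V] by (auto simp: a_inv_def monomial_ideal_def)
    then show "inv\<^bsub>add_monoid (poly_ring V)\<^esub> p \<in> monomial_ideal V Q"
      using p by (auto simp: monomial_ideal_def poly_ring_closed)
  qed (auto intro: monomial_ideal_add, auto simp: monomial_ideal_def poly_ring_closed)
qed (auto intro: poly_ring_ring monomial_ideal_mult up, subst mult.commute,
     auto intro: monomial_ideal_mult up)

lemma in_ideal_if_monomials_in_ideal:
  assumes "ideal J (poly_ring V)" "\<And>t. t \<in> supp p \<Longrightarrow> Poly_Mapping.single t (cf p t) \<in> J"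
  shows "p \<in> J"
proof (induction p rule: singles_induct)
  case 1
  show ?case
    using additive_subgroup.zero_closed[OF ideal.axioms(1)[OF assms(1)]] by simp
next
  case (3 q r)
  then show ?case
    using additive_subgroup.a_closed[OF ideal.axioms(1)[OF assms(1)], of q r] by simp
qed (rule assms(2))

definition weight :: "'x set \<Rightarrow> ('x \<Rightarrow>\<^sub>0 nat) \<Rightarrow> nat" where
  "weight C t = (\<Sum>x\<in>C. cf t x)"

lemma weight_add: "weight C (s + t) = weight C s + weight C t"
  by (simp add: weight_def lookup_add sum.distrib)

lemma weight_pos_iff: "finite C \<Longrightarrow> 1 \<le> weight C t \<longleftrightarrow> C \<inter> supp t \<noteq> {}"
proof -
  assume "finite C"
  then have "weight C t = 0 \<longleftrightarrow> C \<inter> supp t = {}"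
    by (auto simp: weight_def in_keys_iff)
  then show ?thesis by linarith
qed

text \<open>The \<open>s\<close>-th power of the prime ideal generated by the variables in \<open>C\<close>: its monomials are those
  of degree at least \<open>s\<close> in these variables (\<open>pow_prime_power\<close>).\<close>

abbreviation prime_power :: "'x set \<Rightarrow> 'x set \<Rightarrow> nat \<Rightarrow> ('x, 'k::field) mpoly set" where
  "prime_power V C s \<equiv> monomial_ideal V (\<lambda>t. s \<le> weight C t)"

lemma ideal_prime_power: "ideal (prime_power V C s) (poly_ring V)"
  by (rule ideal_monomial_ideal) (simp add: weight_add)

text \<open>The ideal generated by a set of variables is prime because it is the kernel of the
  homomorphism that kills these variables. The remaining variables are numbered, since the order
  on the natural numbers is what provides a term order, hence the absence of zero divisors, in
  the target ring.\<close>

lemma prime_prime_power: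
  assumes "finite V" "C \<subseteq> V"
  shows "primeideal (prime_power V C 1 :: ('x, 'k::field) mpoly set) (poly_ring V)"
proof -
  obtain enc :: "'x \<Rightarrow> nat" where enc: "inj_on enc V"
    using finite_imp_inj_to_nat_seg[OF assms(1)] by auto
  define \<sigma> where "\<sigma> = (\<lambda>x. if x \<in> V - C then Some (enc x) else None)"
  define \<tau> where "\<tau> = (\<lambda>n. Some (the_inv_into V enc n))"
  have fin: "finite C" using assms finite_subset by blast
  have dom: "dom \<sigma> = V - C" by (auto simp: \<sigma>_def split: if_splits)
  have mem: "p \<in> prime_power V C 1 \<longleftrightarrow> rename \<sigma> p = 0"
    if p: "p \<in> carrier (poly_ring V)" for p :: "('x, 'k) mpoly"
  proof
    assume "p \<in> prime_power V C 1"
    then have "\<not> supp t \<subseteq> dom \<sigma>" if "t \<in> supp p" for t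
      using that fin weight_pos_iff[of C t] by (auto simp: monomial_ideal_def dom)
    then show "rename \<sigma> p = 0"
      unfolding rename_def by (intro sum.neutral) (auto simp: rename_mon_def)
  next
    assume 0: "rename \<sigma> p = 0"
    have "1 \<le> weight C t" if t: "t \<in> supp p" for t
    proof (rule ccontr)
      assume "\<not> 1 \<le> weight C t"
      then have "supp t \<subseteq> dom \<sigma>"
        using weight_pos_iff[OF fin, of t] p t by (auto simp: dom poly_ring_carrier)
      then have "cf (rename \<tau> (rename \<sigma> p)) t = cf p t"
        using enc by (subst cf_rename_rename[OF p])
          (auto simp: \<sigma>_def \<tau>_def the_inv_into_f_f split: if_splits)
      then show False using 0 t by (auto simp: in_keys_iff)
    qed
    then show "p \<in> prime_power V C 1" using p by (simp add: monomial_ideal_def)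
  qed
  show ?thesis
  proof (rule primeidealI)
    show "carrier (poly_ring V) \<noteq> (prime_power V C 1 :: ('x, 'k) mpoly set)"
    proof
      assume *: "carrier (poly_ring V) = (prime_power V C 1 :: ('x, 'k) mpoly set)"
      have "(1 :: ('x, 'k) mpoly) \<in> carrier (poly_ring V)" by (rule poly_ring_closed)
      then have "(1 :: ('x, 'k) mpoly) \<in> prime_power V C 1" by (simp only: *)
      then show False by (auto simp: monomial_ideal_def weight_def)
    qed
  next
    fix p q :: "('x, 'k) mpoly"
    assume pq: "p \<in> carrier (poly_ring V)" "q \<in> carrier (poly_ring V)"
      "p \<otimes>\<^bsub>poly_ring V\<^esub> q \<in> prime_power V C 1"
    then have "rename \<sigma> p * rename \<sigma> q = 0"
      using mem[of "p * q"] by (auto simp: rename_mult poly_ring_closed)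
    then show "p \<in> prime_power V C 1 \<or> q \<in> prime_power V C 1"
      using mem[OF pq(1)] mem[OF pq(2)] by auto
  qed (rule ideal_prime_power poly_ring_cring)+
qed

text \<open>A monomial of degree at least \<open>s + 1\<close> in the variables of \<open>C\<close> is a variable of \<open>C\<close> times a
  monomial of degree at least \<open>s\<close>.\<close>

lemma pow_prime_power:
  assumes "finite C" "C \<subseteq> V"
  shows "prime_power V C 1 [^]\<^bsub>ideals_set (poly_ring V)\<^esub> s
    = (prime_power V C s :: ('x, 'k::field) mpoly set)"
proof (induction s)
  case 0
  show ?case by (auto simp: nat_pow_def ideals_set_def monomial_ideal_def)
next
  case (Suc s)
  let ?R = "poly_ring V :: ('x, 'k) mpoly ring"
  have "p \<in> ideal_prod ?R (prime_power V C s) (prime_power V C 1)"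
    if p: "p \<in> prime_power V C (Suc s)" for p
  proof (rule in_ideal_if_monomials_in_ideal)
    show "ideal (ideal_prod ?R (prime_power V C s) (prime_power V C 1)) ?R"
      by (intro ring.ideal_prod_is_ideal poly_ring_ring ideal_prime_power)
    fix t assume t: "t \<in> supp p"
    then have wt: "Suc s \<le> weight C t" "supp t \<subseteq> V"
      using p by (auto simp: monomial_ideal_def poly_ring_carrier)
    then have "1 \<le> weight C t" by simp
    then obtain x where x: "x \<in> C" "x \<in> supp t" using weight_pos_iff[OF assms(1)] by blast
    define u where "u = t - Poly_Mapping.single x 1"
    have tu: "t = u + Poly_Mapping.single x 1"
      using x by (intro poly_mapping_eqI)
        (auto simp: u_def lookup_add lookup_minus lookup_single when_def in_keys_iff)
    have "weight C t = weight C u + 1"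
      using x assms by (simp add: tu weight_add) (simp add: weight_def lookup_single when_def)
    then have "Poly_Mapping.single u (cf p t) \<in> (prime_power V C s :: ('x, 'k) mpoly set)"
      using wt tu by (auto simp: monomial_ideal_def poly_ring_carrier supp_add_nat)
    moreover have "var x \<in> (prime_power V C 1 :: ('x, 'k) mpoly set)"
      using x assms by (auto simp: monomial_ideal_def poly_ring_carrier var_def weight_def
          lookup_single when_def)
    ultimately have "Poly_Mapping.single u (cf p t) \<otimes>\<^bsub>?R\<^esub> var x
      \<in> ideal_prod ?R (prime_power V C s) (prime_power V C 1)"
      by (rule ideal_prod.prod)
    then show "Poly_Mapping.single t (cf p t)
      \<in> ideal_prod ?R (prime_power V C s) (prime_power V C 1)"
      by (simp add: var_def mult_single tu[symmetric, unfolded One_nat_def])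
  qed
  moreover have "p \<in> prime_power V C (Suc s)"
    if "p \<in> ideal_prod ?R (prime_power V C s) (prime_power V C 1)" for p
    using that
  proof induction
    case (prod p q)
    show ?case
      using prod keys_mult[of p q] poly_ring_closed(5)[of p V q]
      by (fastforce simp: monomial_ideal_def weight_add)
  next
    case (sum p q)
    then show ?case using monomial_ideal_add[of p V _ q] by simp
  qed
  moreover have "prime_power V C 1 [^]\<^bsub>ideals_set ?R\<^esub> Suc s
     = ideal_prod ?R (prime_power V C 1 [^]\<^bsub>ideals_set ?R\<^esub> s) (prime_power V C 1)"
    by (simp add: nat_pow_def ideals_set_def)
  ultimately show ?case using Suc by auto
qed

definition vertex_cover :: "'x set \<Rightarrow> 'x set set \<Rightarrow> 'x set \<Rightarrow> bool" where
  "vertex_cover V E C \<longleftrightarrow> C \<subseteq> V \<and> (\<forall>e\<in>E. e \<inter> C \<noteq> {})"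

definition minimal_cover :: "'x set \<Rightarrow> 'x set set \<Rightarrow> 'x set \<Rightarrow> bool" where
  "minimal_cover V E C \<longleftrightarrow> vertex_cover V E C \<and> (\<forall>D. vertex_cover V E D \<longrightarrow> D \<subseteq> C \<longrightarrow> D = C)"

lemma minimal_cover_exists:
  assumes "finite V" "vertex_cover V E C"
  obtains M where "minimal_cover V E M" "M \<subseteq> C"
proof -
  have "finite {D. vertex_cover V E D}"
    by (rule finite_subset[of _ "Pow V"]) (auto simp: vertex_cover_def assms)
  from finite_has_minimal2[OF this, of C] assms obtain M where
    "M \<subseteq> C" "vertex_cover V E M" "\<forall>D. vertex_cover V E D \<longrightarrow> D \<subseteq> M \<longrightarrow> M = D"
    by auto
  then show ?thesis by (intro that[of M]) (auto simp: minimal_cover_def)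
qed

lemma minimal_covers_suffice:
  assumes "finite V"
  shows "(\<forall>C. minimal_cover V E C \<longrightarrow> s \<le> weight C t) \<longleftrightarrow> (\<forall>C. vertex_cover V E C \<longrightarrow> s \<le> weight C t)"
proof (intro iffI allI impI)
  fix C assume *: "\<forall>C. minimal_cover V E C \<longrightarrow> s \<le> weight C t" "vertex_cover V E C"
  from minimal_cover_exists[OF assms *(2)] obtain M where M: "minimal_cover V E M" "M \<subseteq> C" .
  have "finite C" using *(2) assms finite_subset by (auto simp: vertex_cover_def)
  then have "weight M t \<le> weight C t" using M by (auto simp: weight_def intro: sum_mono2)
  then show "s \<le> weight C t" using * M by (meson order_trans)
qed (auto simp: minimal_cover_def)

text \<open>If the support of a monomial contained no edge, then its complement would be a vertex cover
  that misses the monomial.\<close>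

lemma edge_ideal_monomial:
  assumes "simple_graph V E"
  shows "edge_ideal V E = (monomial_ideal V (\<lambda>t. \<forall>C. vertex_cover V E C \<longrightarrow> 1 \<le> weight C t)
    :: ('x, 'k::field) mpoly set)" (is "_ = ?M")
proof
  let ?R = "poly_ring V :: ('x, 'k) mpoly ring"
  let ?S = "{var x * var y | x y. {x, y} \<in> E} :: ('x, 'k) mpoly set"
  have fin: "finite C" if "vertex_cover V E C" for C
    using that assms finite_subset by (auto simp: vertex_cover_def simple_graph_def)
  have S: "?S \<subseteq> ?M"
  proof
    fix p assume "p \<in> ?S"
    then obtain x y where p: "p = var x * var y" and xy: "{x, y} \<in> E" by auto
    have "{x, y} \<subseteq> V" using assms xy by (auto simp: simple_graph_def)
    moreover have "1 \<le> weight C (Poly_Mapping.single x 1 + Poly_Mapping.single y 1)"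
      if "vertex_cover V E C" for C
      using that xy by (subst weight_pos_iff[OF fin[OF that]])
         (auto simp: vertex_cover_def supp_add_nat)
    ultimately show "p \<in> ?M"
      by (auto simp: p var_def mult_single monomial_ideal_def poly_ring_carrier supp_add_nat)
  qed
  have id: "ideal ?M ?R" by (rule ideal_monomial_ideal) (fastforce simp: weight_add)
  show "edge_ideal V E \<subseteq> ?M"
    unfolding edge_ideal_def by (rule ring.genideal_minimal[OF poly_ring_ring id S])
  have Sc: "?S \<subseteq> carrier ?R" using S by (auto simp: monomial_ideal_def)
  have id': "ideal (edge_ideal V E) ?R"
    unfolding edge_ideal_def by (rule ring.genideal_ideal[OF poly_ring_ring Sc])
  show "?M \<subseteq> edge_ideal V E"
  proof
    fix p assume p: "p \<in> ?M"
    show "p \<in> edge_ideal V E"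
    proof (rule in_ideal_if_monomials_in_ideal[OF id'])
      fix t assume "t \<in> supp p"
      then have t: "supp t \<subseteq> V" "\<forall>C. vertex_cover V E C \<longrightarrow> 1 \<le> weight C t"
        using p by (auto simp: monomial_ideal_def poly_ring_carrier)
      have "\<not> vertex_cover V E (V - supp t)"
      proof
        assume c: "vertex_cover V E (V - supp t)"
        with t have "1 \<le> weight (V - supp t) t" by blast
        then show False using weight_pos_iff[OF fin[OF c]] by blast
      qed
      then obtain e where e: "e \<in> E" "e \<inter> (V - supp t) = {}" by (auto simp: vertex_cover_def)
      have "card e = 2" "e \<subseteq> V" using assms e by (auto simp: simple_graph_def)
      then obtain x y where xy: "e = {x, y}" "x \<noteq> y" by (auto simp: card_2_iff)
      have xyt: "x \<in> supp t" "y \<in> supp t" using xy e \<open>e \<subseteq> V\<close> by auto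
      define u where "u = t - (Poly_Mapping.single x 1 + Poly_Mapping.single y 1)"
      have tu: "t = u + (Poly_Mapping.single x 1 + Poly_Mapping.single y 1)"
        using xyt xy by (intro poly_mapping_eqI)
          (auto simp: u_def lookup_add lookup_minus lookup_single when_def in_keys_iff)
      have "var x * var y \<in> ?S" using xy e by blast
      then have "(var x * var y :: ('x, 'k) mpoly) \<in> edge_ideal V E"
        unfolding edge_ideal_def by (rule subsetD[OF ring.genideal_self[OF poly_ring_ring Sc]])
      moreover have "Poly_Mapping.single u (cf p t) \<in> carrier ?R"
        using t(1) unfolding tu by (auto simp: poly_ring_carrier supp_add_nat)
      ultimately have "Poly_Mapping.single u (cf p t) * (var x * var y) \<in> edge_ideal V E"
        using ideal.I_l_closed[OF id', of "var x * var y" "Poly_Mapping.single u (cf p t)"] by simp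
      then show "Poly_Mapping.single t (cf p t) \<in> edge_ideal V E"
        by (simp add: var_def mult_single tu[symmetric, unfolded One_nat_def])
    qed
  qed
qed

text \<open>Each member of \<open>F\<close> has an element outside of the prime ideal; the product of these elements
  stays outside.\<close>

lemma (in primeideal) avoid_finitely_many_ideals:
  assumes "finite F" "\<And>J. J \<in> F \<Longrightarrow> ideal J R" "\<And>J. J \<in> F \<Longrightarrow> \<not> J \<subseteq> I"
  shows "\<exists>r\<in>carrier R - I. \<forall>J\<in>F. r \<in> J"
  using assms
proof (induction F)
  case empty
  have "\<one> \<notin> I" using I_notcarr one_imp_carrier by metis
  then show ?case by (intro bexI[of _ \<one>]) auto
next
  case (insert J F)
  then obtain r where r: "r \<in> carrier R" "r \<notin> I" "\<forall>J\<in>F. r \<in> J" by auto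
  have "\<not> J \<subseteq> I" using insert.prems by simp
  then obtain q where q: "q \<in> J" "q \<notin> I" by blast
  have J: "ideal J R" using insert by auto
  have qc: "q \<in> carrier R" using ideal.Icarr[OF J q(1)] .
  show ?case
  proof (intro bexI[of _ "r \<otimes> q"] ballI)
    show "r \<otimes> q \<in> carrier R - I" using r q qc I_prime by auto
    fix K assume "K \<in> insert J F"
    then show "r \<otimes> q \<in> K"
      using ideal.I_l_closed[OF J q(1) r(1)] ideal.I_r_closed[of K R r q] insert.prems(1) r qc
      by auto
  qed
qed

lemma (in primeideal) nat_pow_in_prime:
  assumes "r \<in> carrier R" "r [^] (n::nat) \<in> I"
  shows "r \<in> I"
  using assms(2)
proof (induction n)
  case 0
  then show ?case using I_notcarr one_imp_carrier by auto
next
  case (Suc n)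
  then show ?case using I_prime[of "r [^] n" r] assms(1) by auto
qed

text \<open>The hypothesis \<open>loc\<close> says that \<open>K\<close> and the prime ideal \<open>I\<close> agree after localization at \<open>I\<close>.
  The components of \<open>K\<close> whose radical is not contained in \<open>I\<close> have a common element outside of \<open>I\<close>,
  which can be divided out of membership in \<open>K\<close>; the other components are primary with radical in
  \<open>I\<close>, so that the factor \<open>u\<close> can be cancelled in them.\<close>

lemma (in primeideal) sub_part_eq_prime:
  assumes D: "primary_decomposition R K D" and "K \<subseteq> I"
    and loc: "\<And>f. f \<in> I \<Longrightarrow> \<exists>u\<in>carrier R - I. f \<otimes> u \<in> K"
  shows "sub_part R D I = I"
proof
  have id: "ideal J R" if "J \<in> D" for J
    using D that by (auto simp: primary_decomposition_def primary_ideal_def)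
  show "sub_part R D I \<subseteq> I"
  proof
    fix f assume f: "f \<in> sub_part R D I"
    then have fc: "f \<in> carrier R" by (auto simp: sub_part_def)
    let ?F = "{J \<in> D. \<not> radical_of R J \<subseteq> I}"
    have nsub: "\<not> J \<subseteq> I" if "J \<in> ?F" for J
      using that nat_pow_in_prime by (auto simp: radical_of_def)
    have "\<exists>r\<in>carrier R - I. \<forall>J\<in>?F. r \<in> J"
    proof (rule avoid_finitely_many_ideals)
      show "finite ?F" using D by (simp add: primary_decomposition_def)
      show "ideal J R" if "J \<in> ?F" for J using that id by simp
    qed (rule nsub)
    then obtain r where r: "r \<in> carrier R" "r \<notin> I" "\<forall>J\<in>?F. r \<in> J" by blast
    have "f \<otimes> r \<in> J" if "J \<in> D" for J
    proof (cases "radical_of R J \<subseteq> I")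
      case True
      then have "f \<in> J" using f that by (auto simp: sub_part_def)
      then show ?thesis using ideal.I_r_closed[OF id[OF that]] r by auto
    next
      case False
      then have "r \<in> J" using r that by auto
      then show ?thesis using ideal.I_l_closed[OF id[OF that]] fc by auto
    qed
    then have "f \<otimes> r \<in> K" using D fc r by (auto simp: primary_decomposition_def)
    then show "f \<in> I" using \<open>K \<subseteq> I\<close> I_prime[of f r] fc r by auto
  qed
  show "I \<subseteq> sub_part R D I"
  proof
    fix f assume f: "f \<in> I"
    then have fc: "f \<in> carrier R" by (rule Icarr)
    obtain u where u: "u \<in> carrier R" "u \<notin> I" "f \<otimes> u \<in> K" using loc f by auto
    have "f \<in> J" if J: "J \<in> D" "radical_of R J \<subseteq> I" for J
    proof -
      have "f \<otimes> u \<in> J" using u J D by (auto simp: primary_decomposition_def)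
      moreover have "primary_ideal R J" using J D by (auto simp: primary_decomposition_def)
      ultimately show ?thesis using fc u J unfolding primary_ideal_def by blast
    qed
    then show "f \<in> sub_part R D I" using fc by (auto simp: sub_part_def)
  qed
qed

lemma minimal_covers_Inter:
  assumes "finite V"
  shows "monomial_ideal V (\<lambda>t. \<forall>C. vertex_cover V E C \<longrightarrow> s \<le> weight C t)
    = carrier (poly_ring V) \<inter> (\<Inter>C\<in>{C. minimal_cover V E C}. prime_power V C s)"
  unfolding minimal_covers_suffice[OF assms, symmetric] monomial_ideal_def by auto

lemma edge_ideal_Inter:
  assumes "simple_graph V E"
  shows "edge_ideal V E = (carrier (poly_ring V) \<inter>
     (\<Inter>C\<in>{C. minimal_cover V E C}. prime_power V C 1) :: ('x, 'k::field) mpoly set)"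
  unfolding edge_ideal_monomial[OF assms]
  by (rule minimal_covers_Inter) (use assms in \<open>simp add: simple_graph_def\<close>)

text \<open>The element \<open>u\<close> is the product of the variables outside of \<open>C\<close>. A vertex cover that misses
  \<open>u\<close> and a further variable, from \<open>C\<close>, would be a proper subset of \<open>C\<close>, against minimality; so every
  variable of \<open>C\<close> multiplies \<open>u\<close> into the edge ideal.\<close>

lemma colon_minimal_cover:
  assumes "simple_graph V E" "minimal_cover V E C"
  shows "\<exists>u\<in>carrier (poly_ring V) - prime_power V C 1.
    prime_power V C 1 = {r \<in> carrier (poly_ring V). r * u \<in> (edge_ideal V E :: ('x, 'k::field) mpoly set)}"
proof -
  define v where "v = (\<Sum>x\<in>V - C. Poly_Mapping.single x (1::nat))"
  define u :: "('x, 'k) mpoly" where "u = Poly_Mapping.single v 1"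
  have V: "finite V" "C \<subseteq> V"
    using assms by (auto simp: simple_graph_def minimal_cover_def vertex_cover_def)
  have finC: "finite C" using V finite_subset by blast
  have "cf v x = (if x \<in> V - C then 1 else 0)" for x
    unfolding v_def lookup_sum lookup_single when_def using V by simp
  then have suppv: "supp v = V - C" by (auto simp: in_keys_iff split: if_splits)
  have uc: "u \<in> carrier (poly_ring V)" by (auto simp: u_def poly_ring_carrier suppv)
  have un: "u \<notin> prime_power V C 1"
    using weight_pos_iff[OF finC, of v] suppv by (auto simp: monomial_ideal_def u_def)
  have "r * u \<in> edge_ideal V E" if r: "r \<in> prime_power V C 1" for r
    unfolding edge_ideal_monomial[OF assms(1)] monomial_ideal_def
  proof (intro CollectI conjI ballI allI impI)
    show "r * u \<in> carrier (poly_ring V)" using r uc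
      by (auto simp: monomial_ideal_def intro: poly_ring_closed)
    fix t D assume t: "t \<in> supp (r * u)" and D: "vertex_cover V E D"
    from t keys_mult[of r u] obtain w where w: "w \<in> supp r" "t = w + v"
      by (auto simp: u_def)
    have finD: "finite D" using D V finite_subset by (auto simp: vertex_cover_def)
    have "C \<inter> supp w \<noteq> {}"
      using r w(1) weight_pos_iff[OF finC, of w] by (auto simp: monomial_ideal_def)
    moreover have "D = C" if "D \<inter> (V - C) = {}"
      using D assms(2) that unfolding minimal_cover_def vertex_cover_def by blast
    ultimately show "1 \<le> weight D t"
      unfolding weight_pos_iff[OF finD] w(2) supp_add_nat suppv by blast
  qed
  moreover have "r \<in> prime_power V C 1" if "r \<in> carrier (poly_ring V)" "r * u \<in> edge_ideal V E" for r
  proof -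
    have "r * u \<in> prime_power V C 1" using that(2) assms(2) edge_ideal_Inter[OF assms(1)] by auto
    then show ?thesis
      using primeideal.I_prime[OF prime_prime_power[OF V], of r u] that(1) uc un by auto
  qed
  moreover have "prime_power V C 1 \<subseteq> carrier (poly_ring V)" by (auto simp: monomial_ideal_def)
  ultimately show ?thesis using uc un by (intro bexI[of _ u]) auto
qed

lemma prime_power_subset_imp:
  assumes "prime_power V C 1 \<subseteq> (prime_power V D 1 :: ('x, 'k::field) mpoly set)"
    "finite V" "C \<subseteq> V" "D \<subseteq> V"
  shows "C \<subseteq> D"
proof
  fix x assume x: "x \<in> C"
  have fin: "finite C" "finite D" using assms finite_subset by auto
  have "var x \<in> (prime_power V C 1 :: ('x, 'k) mpoly set)"
    using x assms(3) weight_pos_iff[OF fin(1), of "Poly_Mapping.single x 1"]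
    by (auto simp: monomial_ideal_def poly_ring_carrier var_def)
  then have "var x \<in> (prime_power V D 1 :: ('x, 'k) mpoly set)" using assms(1) by blast
  then show "x \<in> D"
    using weight_pos_iff[OF fin(2), of "Poly_Mapping.single x 1"]
    by (auto simp: monomial_ideal_def var_def)
qed

text \<open>The colon ideal of an intersection of primes by \<open>f\<close> is the intersection of those primes that
  do not contain \<open>f\<close>; if it is prime itself, then it is one of them.\<close>

lemma assoc_primes_edge_ideal:
  assumes G: "simple_graph V E"
  shows "assoc_primes (poly_ring V) (edge_ideal V E)
    = {prime_power V C 1 :: ('x, 'k::field) mpoly set | C. minimal_cover V E C}"
proof (intro equalityI subsetI)
  let ?R = "poly_ring V :: ('x, 'k) mpoly ring"
  have V: "finite V" "\<And>C. minimal_cover V E C \<Longrightarrow> C \<subseteq> V"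
    using G by (auto simp: simple_graph_def minimal_cover_def vertex_cover_def)
  note prime = prime_prime_power[OF V]
  fix P assume "P \<in> assoc_primes ?R (edge_ideal V E)"
  then obtain f where P: "primeideal P ?R" and f: "f \<in> carrier ?R"
    and Pf: "P = {r \<in> carrier ?R. r * f \<in> edge_ideal V E}"
    by (auto simp: assoc_primes_def)
  let ?C = "{C. minimal_cover V E C \<and> f \<notin> prime_power V C 1}"
  let ?F = "(\<lambda>C. prime_power V C 1 :: ('x, 'k) mpoly set) ` ?C"
  have mem: "r \<in> P \<longleftrightarrow> (\<forall>C\<in>?C. r \<in> prime_power V C 1)" if r: "r \<in> carrier ?R" for r
  proof -
    have "r * f \<in> prime_power V C 1 \<longleftrightarrow> r \<in> prime_power V C 1 \<or> f \<in> prime_power V C 1"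
      if C: "minimal_cover V E C" for C
      using primeideal.I_prime[OF prime[OF C], of r f] f r
        ideal.I_l_closed[OF ideal_prime_power[where V = V and C = C and s = 1], of f r]
        ideal.I_r_closed[OF ideal_prime_power[where V = V and C = C and s = 1], of r f] by auto
    then show ?thesis
      using r f by (auto simp: Pf edge_ideal_Inter[OF G] poly_ring_closed)
  qed
  have "finite ?C"
    by (rule finite_subset[of _ "Pow V"]) (use V in auto)
  then have "finite ?F" by simp
  have "\<exists>C\<in>?C. prime_power V C 1 \<subseteq> P"
  proof (rule ccontr)
    assume "\<not> ?thesis"
    then obtain r where "r \<in> carrier ?R - P" "\<forall>J\<in>?F. r \<in> J"
      using primeideal.avoid_finitely_many_ideals[OF P \<open>finite ?F\<close>] ideal_prime_power by blast
    then show False using mem[of r] by auto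
  qed
  then obtain C where C: "C \<in> ?C" "prime_power V C 1 \<subseteq> P" by auto
  moreover have "P \<subseteq> prime_power V C 1"
    using mem C(1) Pf by blast
  ultimately show "P \<in> {prime_power V C 1 | C. minimal_cover V E C}" by blast
next
  fix P assume "P \<in> {prime_power V C 1 :: ('x, 'k) mpoly set | C. minimal_cover V E C}"
  then obtain C where C: "minimal_cover V E C" "P = prime_power V C 1" by auto
  have "primeideal P (poly_ring V)"
    unfolding C(2) using C(1) G
    by (intro prime_prime_power) (auto simp: minimal_cover_def vertex_cover_def simple_graph_def)
  then show "P \<in> assoc_primes (poly_ring V) (edge_ideal V E)"
    using colon_minimal_cover[OF G C(1)] unfolding assoc_primes_def C(2) by auto
qed

lemma max_assoc_primes_edge_ideal:
  assumes G: "simple_graph V E"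
  shows "max_assoc_primes (poly_ring V) (edge_ideal V E)
    = {prime_power V C 1 :: ('x, 'k::field) mpoly set | C. minimal_cover V E C}"
proof -
  have "D = C" if "minimal_cover V E C" "minimal_cover V E D"
    "prime_power V C 1 \<subseteq> (prime_power V D 1 :: ('x, 'k) mpoly set)" for C D
  proof -
    have "C \<subseteq> D"
      using prime_power_subset_imp[OF that(3)] that(1,2) G
      by (auto simp: minimal_cover_def vertex_cover_def simple_graph_def)
    then show ?thesis using that(1,2) by (auto simp: minimal_cover_def)
  qed
  then show ?thesis
    unfolding max_assoc_primes_def assoc_primes_edge_ideal[OF G] by blast
qed

text \<open>The maximal associated primes are those of the minimal covers, and each of them is its own
  component \<open>I\<^bsub>\<subseteq>Q\<^esub>\<close>, so the symbolic power is the intersection of their \<open>s\<close>-th powers.\<close>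

lemma symbolic_power_edge_ideal:
  assumes G: "simple_graph V E"
  shows "symbolic_power (poly_ring V) (edge_ideal V E) s =
    (monomial_ideal V (\<lambda>t. \<forall>C. vertex_cover V E C \<longrightarrow> s \<le> weight C t) :: ('x, 'k::field) mpoly set)"
proof -
  let ?R = "poly_ring V :: ('x, 'k) mpoly ring"
  let ?I = "edge_ideal V E :: ('x, 'k) mpoly set"
  let ?D0 = "(\<lambda>C. prime_power V C 1 :: ('x, 'k) mpoly set) ` {C. minimal_cover V E C}"
  have V: "finite V" "\<And>C. minimal_cover V E C \<Longrightarrow> C \<subseteq> V"
    using G by (auto simp: simple_graph_def minimal_cover_def vertex_cover_def)
  note prime = prime_prime_power[OF V]
  have "primary_decomposition ?R ?I ?D0"
    unfolding primary_decomposition_def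
  proof (intro conjI ballI)
    show "finite ?D0" by (rule finite_imageI, rule finite_subset[of _ "Pow V"]) (use V in auto)
    show "?I = carrier ?R \<inter> \<Inter>?D0" by (rule edge_ideal_Inter[OF G])
    fix J assume "J \<in> ?D0"
    then have J: "primeideal J ?R" using prime by auto
    have "b \<in> radical_of ?R J" if "b \<in> J" "b \<in> carrier ?R" for b
      using that unfolding radical_of_def
      by (auto intro!: exI[of _ 1] simp: nat_pow_def)
    then show "primary_ideal ?R J"
      using J primeideal.I_prime[OF J] primeideal.I_notcarr[OF J] primeideal.axioms(1)[OF J]
      unfolding primary_ideal_def by metis
  qed
  then have D: "primary_decomposition ?R ?I (SOME D. primary_decomposition ?R ?I D)"
    by (rule someI)
  have sub: "sub_part ?R (SOME D. primary_decomposition ?R ?I D) (prime_power V C 1) = prime_power V C 1"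
    if C: "minimal_cover V E C" for C
  proof (rule primeideal.sub_part_eq_prime[OF prime[OF C] D])
    show "?I \<subseteq> prime_power V C 1" using C by (auto simp: edge_ideal_Inter[OF G])
  next
    fix f :: "('x, 'k) mpoly" assume "f \<in> prime_power V C 1"
    then show "\<exists>u\<in>carrier ?R - prime_power V C 1. f \<otimes>\<^bsub>?R\<^esub> u \<in> ?I"
      using colon_minimal_cover[OF G C] by auto
  qed
  have pw: "sub_part ?R (SOME D. primary_decomposition ?R ?I D) (prime_power V C 1) [^]\<^bsub>ideals_set ?R\<^esub> s
      = prime_power V C s" if C: "minimal_cover V E C" for C
    unfolding sub[OF C] by (rule pow_prime_power[OF finite_subset[OF V(2)[OF C] V(1)] V(2)[OF C]])
  have "symbolic_power ?R ?I s = carrier ?R \<inter> (\<Inter>C\<in>{C. minimal_cover V E C}.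
      sub_part ?R (SOME D. primary_decomposition ?R ?I D) (prime_power V C 1) [^]\<^bsub>ideals_set ?R\<^esub> s)"
    unfolding symbolic_power_def Let_def max_assoc_primes_edge_ideal[OF G] by blast
  also have "\<dots> = carrier ?R \<inter> (\<Inter>C\<in>{C. minimal_cover V E C}. prime_power V C s)"
    using pw by simp
  also have "\<dots> = monomial_ideal V (\<lambda>t. \<forall>C. vertex_cover V E C \<longrightarrow> s \<le> weight C t)"
    by (rule minimal_covers_Inter[OF V(1), symmetric])
  finally show ?thesis .
qed

section \<open>Graded free modules\<close>

text \<open>The scalar action is multiplication by a constant in the ring of polynomials with
  coefficients in the polynomial ring, so that the module laws become ring laws.\<close>

abbreviation scale :: "('x, 'k::field) mpoly \<Rightarrow> (nat \<Rightarrow>\<^sub>0 ('x, 'k) mpoly) \<Rightarrow> (nat \<Rightarrow>\<^sub>0 ('x, 'k) mpoly)" where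
  "scale p f \<equiv> Poly_Mapping.single 0 p * f"

abbreviation free_carrier :: "'x set \<Rightarrow> nat set \<Rightarrow> (nat \<Rightarrow>\<^sub>0 ('x, 'k::field) mpoly) set" where
  "free_carrier V B \<equiv> carrier (free_module V B)"

lemma free_module_simps [simp]:
  "f \<oplus>\<^bsub>free_module V B\<^esub> g = f + g" "p \<odot>\<^bsub>free_module V B\<^esub> f = scale p f"
  "\<zero>\<^bsub>free_module V B\<^esub> = 0"
  by (simp_all add: free_module_def mult_map_scale_conv_mult)

lemma cf_scale: "cf (scale p f) b = p * cf f b"
proof (cases "p * cf f b = 0")
  case True
  then show ?thesis
    by (simp add: mult_map_scale_conv_mult[symmetric] Poly_Mapping.map.rep_eq when_def)
next
  case False
  then have "cf f b \<noteq> 0" by auto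
  then show ?thesis
    by (simp add: mult_map_scale_conv_mult[symmetric] Poly_Mapping.map.rep_eq when_def)
qed

lemma supp_scale: "supp (scale p f) \<subseteq> supp f"
  by (auto simp: in_keys_iff cf_scale)

lemma scale_single: "scale p (Poly_Mapping.single b q) = Poly_Mapping.single b (p * q)"
  by (simp add: mult_single)

lemma free_carrier_iff:
  "f \<in> free_carrier V B \<longleftrightarrow> (\<forall>b t. cf (cf f b) t \<noteq> 0 \<longrightarrow> b \<in> B \<and> supp t \<subseteq> V)"
proof
  assume "f \<in> free_carrier V B"
  then show "\<forall>b t. cf (cf f b) t \<noteq> 0 \<longrightarrow> b \<in> B \<and> supp t \<subseteq> V"
    by (auto simp: free_module_def poly_ring_carrier in_keys_iff subset_iff) (metis lookup_zero)
next
  assume *: "\<forall>b t. cf (cf f b) t \<noteq> 0 \<longrightarrow> b \<in> B \<and> supp t \<subseteq> V"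
  have "b \<in> B" if "cf f b \<noteq> 0" for b
  proof -
    have "\<exists>t. cf (cf f b) t \<noteq> 0"
      using that by (metis lookup_zero poly_mapping_eqI)
    then show ?thesis using * by blast
  qed
  then show "f \<in> free_carrier V B"
    using * by (auto simp: free_module_def poly_ring_carrier in_keys_iff)
qed

lemma free_part_iff:
  "f \<in> free_part V B d j \<longleftrightarrow>
    f \<in> free_carrier V B \<and> (\<forall>b t. cf (cf f b) t \<noteq> 0 \<longrightarrow> int (mon_deg t) + d b = j)"
proof -
  have "cf f b \<noteq> 0" if "cf (cf f b) t \<noteq> 0" for b t using that by auto
  then show ?thesis unfolding free_part_def mem_Collect_eq Ball_def in_keys_iff by blast
qed

lemma free_closed:
  "0 \<in> free_carrier V B"
  "f \<in> free_carrier V B \<Longrightarrow> g \<in> free_carrier V B \<Longrightarrow> f + g \<in> free_carrier V B"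
  "f \<in> free_carrier V B \<Longrightarrow> - f \<in> free_carrier V B"
  "f \<in> free_carrier V B \<Longrightarrow> g \<in> free_carrier V B \<Longrightarrow> f - g \<in> free_carrier V B"
  unfolding free_carrier_iff
     apply simp
    apply (simp add: lookup_add, metis add_0)
   apply simp
  apply (simp add: lookup_minus, metis diff_zero)
  done

lemma part_closed:
  "0 \<in> free_part V B d j"
  "f \<in> free_part V B d j \<Longrightarrow> g \<in> free_part V B d j \<Longrightarrow> f + g \<in> free_part V B d j"
  "f \<in> free_part V B d j \<Longrightarrow> g \<in> free_part V B d j \<Longrightarrow> f - g \<in> free_part V B d j"
  unfolding free_part_iff
    apply (simp add: free_closed)
   apply (simp add: free_closed lookup_add, metis add_0)
  apply (simp add: free_closed lookup_minus, metis diff_zero)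
  done

lemma scale_closed:
  assumes "p \<in> carrier (poly_ring V)" "f \<in> free_carrier V B"
  shows "scale p f \<in> free_carrier V B"
proof -
  have "cf f b \<in> carrier (poly_ring V)" for b using assms by (auto simp: free_module_def)
  then show ?thesis
    using supp_scale[of p f] assms by (auto simp: free_module_def cf_scale poly_ring_closed)
qed

lemma scale_part:
  assumes "p \<in> carrier (poly_ring V)" "f \<in> free_part V B d e"
    "\<And>t. t \<in> supp p \<Longrightarrow> int (mon_deg t) + e = j"
  shows "scale p f \<in> free_part V B d j"
  unfolding free_part_iff
proof (intro conjI allI impI)
  show "scale p f \<in> free_carrier V B"
    using assms by (intro scale_closed) (auto simp: free_part_def)
  fix b t assume "cf (cf (scale p f) b) t \<noteq> 0"
  then have "t \<in> supp (p * cf f b)" by (simp add: in_keys_iff cf_scale)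
  then obtain u v where uv: "u \<in> supp p" "v \<in> supp (cf f b)" "t = u + v"
    using keys_mult[of p "cf f b"] by blast
  then have "int (mon_deg v) + d b = e"
    using assms(2) by (auto simp: free_part_iff in_keys_iff)
  then show "int (mon_deg t) + d b = j"
    using assms(3)[OF uv(1)] uv(3) by (simp add: mon_deg_add)
qed

lemma part_subset: "f \<in> free_part V B d j \<Longrightarrow> f \<in> free_carrier V B"
  by (simp add: free_part_def)

lemma single_in_part:
  "b \<in> B \<Longrightarrow> supp t \<subseteq> V \<Longrightarrow> Poly_Mapping.single b (Poly_Mapping.single t c) \<in> free_part V B d (int (mon_deg t) + d b)"
  by (auto simp: free_part_iff free_carrier_iff lookup_single when_def split: if_splits)

lemma free_induct [consumes 1, case_names zero single add]:
  assumes x: "x \<in> free_carrier V B"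
    and "P 0" "\<And>b p. b \<in> B \<Longrightarrow> p \<in> carrier (poly_ring V) \<Longrightarrow> P (Poly_Mapping.single b p)"
    and add: "\<And>x y. x \<in> free_carrier V B \<Longrightarrow> y \<in> free_carrier V B \<Longrightarrow> P x \<Longrightarrow> P y \<Longrightarrow> P (x + y)"
  shows "P x"
proof -
  have "x \<in> free_carrier V B \<and> P x"
  proof (induction x rule: singles_induct)
    case (2 b)
    then have "b \<in> B" "cf x b \<in> carrier (poly_ring V)" using x by (auto simp: free_module_def)
    then show ?case using assms
      by (auto simp: free_carrier_iff lookup_single when_def poly_ring_carrier in_keys_iff split: if_splits)
  qed (use assms free_closed in auto)
  then show ?thesis ..
qed

lemma free_induct_homogeneous [consumes 1, case_names zero single add]:
  assumes x: "x \<in> free_carrier V B"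
    and "P 0" "\<And>b t c. b \<in> B \<Longrightarrow> supp t \<subseteq> V \<Longrightarrow> P (Poly_Mapping.single b (Poly_Mapping.single t c))"
    and add: "\<And>x y. x \<in> free_carrier V B \<Longrightarrow> y \<in> free_carrier V B \<Longrightarrow> P x \<Longrightarrow> P y \<Longrightarrow> P (x + y)"
  shows "P x"
  using x
proof (induction rule: free_induct)
  case (single b p)
  have "Poly_Mapping.single b p \<in> free_carrier V B \<and> P (Poly_Mapping.single b p)"
  proof (induction p rule: singles_induct)
    case (2 t)
    then have "supp t \<subseteq> V" using single by (auto simp: poly_ring_carrier)
    then show ?case using assms(3) single_in_part[of b B t V] part_subset single(1) by blast
  qed (use assms free_closed in \<open>auto simp: single_add\<close>)
  then show ?case ..
qed (use assms in auto)

definition homog_component :: "(nat \<Rightarrow> int) \<Rightarrow> int \<Rightarrow> (nat \<Rightarrow>\<^sub>0 ('x, 'k::field) mpoly) \<Rightarrow> (nat \<Rightarrow>\<^sub>0 ('x, 'k) mpoly)" where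
  "homog_component d j f = (\<Sum>b\<in>supp f. \<Sum>t\<in>supp (cf f b).
     if int (mon_deg t) + d b = j then Poly_Mapping.single b (Poly_Mapping.single t (cf (cf f b) t)) else 0)"

lemma homog_component_add: "homog_component d j (f + g) = homog_component d j f + homog_component d j g"
  unfolding homog_component_def
  by (rule setsum_keys_plus_distrib, simp, rule setsum_keys_plus_distrib) (auto simp: single_add)

lemma homog_component_0 [simp]: "homog_component d j 0 = 0"
  by (simp add: homog_component_def)

lemma homog_component_single:
  "homog_component d j (Poly_Mapping.single b (Poly_Mapping.single t c)) =
    (if int (mon_deg t) + d b = j then Poly_Mapping.single b (Poly_Mapping.single t c) else 0)"
proof (cases "c = 0")
  case False
  then have "Poly_Mapping.single t c \<noteq> 0" by (metis lookup_single_eq lookup_zero)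
  with False show ?thesis unfolding homog_component_def by simp
qed simp

lemma cf_homog_component:
  fixes f :: "nat \<Rightarrow>\<^sub>0 ('x, 'k::field) mpoly"
  shows "cf (cf (homog_component d j f) b) t = (if int (mon_deg t) + d b = j then cf (cf f b) t else 0)"
proof (induction f rule: singles_induct)
  case (2 c)
  have "cf (cf (homog_component d j (Poly_Mapping.single c p)) b) t
      = (if int (mon_deg t) + d b = j then cf (cf (Poly_Mapping.single c p) b) t else 0)"
    for p :: "('x, 'k) mpoly"
  proof (induction p rule: singles_induct)
    case (2 u)
    have "cf (cf (Poly_Mapping.single c (Poly_Mapping.single u (cf p u))) b) t = 0"
      if "c \<noteq> b \<or> u \<noteq> t"
      using that by (auto simp: lookup_single when_def)
    then show ?case
      unfolding homog_component_single by (cases "c = b \<and> u = t") auto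
  qed (auto simp: single_add homog_component_add lookup_add)
  then show ?case .
qed (auto simp: homog_component_add lookup_add)

lemma free_eqI: "(\<And>b t. cf (cf f b) t = cf (cf g b) t) \<Longrightarrow> f = g"
  by (intro poly_mapping_eqI) auto

lemma homog_component_in_part: "f \<in> free_carrier V B \<Longrightarrow> homog_component d j f \<in> free_part V B d j"
  by (auto simp: free_part_iff free_carrier_iff cf_homog_component split: if_splits)

lemma homog_component_of_part:
  "f \<in> free_part V B d n \<Longrightarrow> homog_component d j f = (if j = n then f else 0)"
  by (rule free_eqI) (auto simp: free_part_iff cf_homog_component)

lemma sum_homog_components:
  obtains J where "finite J" "f = (\<Sum>j\<in>J. homog_component d j f)"
proof
  let ?J = "\<Union>b\<in>supp f. (\<lambda>t. int (mon_deg t) + d b) ` supp (cf f b)"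
  show "finite ?J" by auto
  show "f = (\<Sum>j\<in>?J. homog_component d j f)"
  proof (rule free_eqI)
    fix b t
    have "int (mon_deg t) + d b \<in> ?J" if "cf (cf f b) t \<noteq> 0"
      using that by (force simp: in_keys_iff)
    then show "cf (cf f b) t = cf (cf (\<Sum>j\<in>?J. homog_component d j f) b) t"
      using \<open>finite ?J\<close> by (auto simp: lookup_sum cf_homog_component)
  qed
qed

section \<open>Graded semilinear maps\<close>

text \<open>A monomial may be sent to zero, hence the inclusion between the sets of degrees. The constant
  term has to be preserved because the rings act on the field through it.\<close>

definition graded_hom ::
  "'x set \<Rightarrow> 'y set \<Rightarrow> (('x, 'k) mpoly \<Rightarrow> ('y, 'k::field) mpoly) \<Rightarrow> bool" where
  "graded_hom V W \<rho> \<longleftrightarrow> (\<forall>p q. \<rho> (p + q) = \<rho> p + \<rho> q) \<and> (\<forall>p q. \<rho> (p * q) = \<rho> p * \<rho> q) \<and>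
     (\<forall>c. \<rho> (const c) = const c) \<and> (\<forall>p. cf (\<rho> p) 0 = cf p 0) \<and>
     \<rho> ` carrier (poly_ring V) \<subseteq> carrier (poly_ring W) \<and>
     (\<forall>p. mon_deg ` supp (\<rho> p) \<subseteq> mon_deg ` supp p)"

lemma graded_hom_rename:
  assumes "\<And>x y. x \<in> V \<Longrightarrow> \<sigma> x = Some y \<Longrightarrow> y \<in> W"
  shows "graded_hom V W (rename \<sigma>)"
  unfolding graded_hom_def
proof (intro conjI allI)
  show "rename \<sigma> ` carrier (poly_ring V) \<subseteq> carrier (poly_ring W)"
    using rename_in_poly_ring[of _ V \<sigma> W] assms by blast
  show "mon_deg ` supp (rename \<sigma> p) \<subseteq> mon_deg ` supp p" for p
  proof
    fix n assume "n \<in> mon_deg ` supp (rename \<sigma> p)"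
    then obtain t where "t \<in> supp (rename \<sigma> p)" "n = mon_deg t" by auto
    then show "n \<in> mon_deg ` supp p" by (elim supp_rename) auto
  qed
qed (auto simp: rename_add rename_mult cf_rename_0)

lemma graded_hom_id: "graded_hom V V (\<lambda>p. p)"
  by (simp add: graded_hom_def)

lemma graded_hom_simps:
  assumes "graded_hom V W \<rho>"
  shows "\<rho> (p + q) = \<rho> p + \<rho> q" "\<rho> (p * q) = \<rho> p * \<rho> q" "\<rho> (const c) = const c"
    "\<rho> 0 = 0" "\<rho> 1 = 1" "cf (\<rho> p) 0 = cf p 0"
    "p \<in> carrier (poly_ring V) \<Longrightarrow> \<rho> p \<in> carrier (poly_ring W)"
  using assms unfolding graded_hom_def const_def by auto (metis single_zero single_one)+

text \<open>The maps are semilinear along \<open>\<rho>\<close>, since the modules to be compared live over different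
  polynomial rings; linear maps are the case where \<open>\<rho>\<close> is the identity.\<close>

definition graded_map ::
  "(('x, 'k) mpoly \<Rightarrow> ('y, 'k::field) mpoly) \<Rightarrow> 'x set \<Rightarrow> nat set \<Rightarrow> (nat \<Rightarrow> int) \<Rightarrow>
   'y set \<Rightarrow> nat set \<Rightarrow> (nat \<Rightarrow> int) \<Rightarrow>
   ((nat \<Rightarrow>\<^sub>0 ('x, 'k) mpoly) \<Rightarrow> (nat \<Rightarrow>\<^sub>0 ('y, 'k) mpoly)) \<Rightarrow> bool" where
  "graded_map \<rho> V B d W B' d' f \<longleftrightarrow>
     (\<forall>x\<in>free_carrier V B. f x \<in> free_carrier W B') \<and>
     (\<forall>x\<in>free_carrier V B. \<forall>y\<in>free_carrier V B. f (x + y) = f x + f y) \<and>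
     (\<forall>p\<in>carrier (poly_ring V). \<forall>x\<in>free_carrier V B. f (scale p x) = scale (\<rho> p) (f x)) \<and>
     (\<forall>j. \<forall>x\<in>free_part V B d j. f x \<in> free_part W B' d' j)"

lemma graded_mapD:
  assumes "graded_map \<rho> V B d W B' d' f"
  shows "x \<in> free_carrier V B \<Longrightarrow> f x \<in> free_carrier W B'"
    "x \<in> free_carrier V B \<Longrightarrow> y \<in> free_carrier V B \<Longrightarrow> f (x + y) = f x + f y"
    "p \<in> carrier (poly_ring V) \<Longrightarrow> x \<in> free_carrier V B \<Longrightarrow> f (scale p x) = scale (\<rho> p) (f x)"
    "x \<in> free_part V B d j \<Longrightarrow> f x \<in> free_part W B' d' j"
  using assms unfolding graded_map_def by auto

lemma graded_map_0:
  assumes "graded_map \<rho> V B d W B' d' f"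
  shows "f 0 = 0"
  using graded_mapD(2)[OF assms, of 0 0] free_closed(1) by auto

lemma graded_map_diff:
  assumes "graded_map \<rho> V B d W B' d' f" "x \<in> free_carrier V B" "y \<in> free_carrier V B"
  shows "f (x - y) = f x - f y"
  using graded_mapD(2)[OF assms(1) free_closed(4)[OF assms(2,3)] assms(3)] by simp

lemma graded_map_compose:
  assumes f: "graded_map \<rho> V B d W B' d' f" and g: "graded_map \<rho>' W B' d' U B'' d'' g"
    and "graded_hom V W \<rho>"
  shows "graded_map (\<lambda>p. \<rho>' (\<rho> p)) V B d U B'' d'' (\<lambda>x. g (f x))"
  unfolding graded_map_def
  using graded_mapD[OF f] graded_mapD[OF g] graded_hom_simps(7)[OF assms(3)] by auto

lemma graded_map_cong:
  assumes "graded_map \<rho> V B d W B' d' f" "\<And>p. p \<in> carrier (poly_ring V) \<Longrightarrow> \<rho> p = \<rho>' p"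
  shows "graded_map \<rho>' V B d W B' d' f"
  using assms unfolding graded_map_def by auto

lemma graded_map_minus:
  assumes "graded_map \<rho> V B d W B' d' f" "graded_map \<rho> V B d W B' d' g"
  shows "graded_map \<rho> V B d W B' d' (\<lambda>x. f x - g x)"
  unfolding graded_map_def
  using graded_mapD[OF assms(1)] graded_mapD[OF assms(2)]
  by (auto simp: right_diff_distrib intro: part_closed free_closed)

lemma graded_map_id: "graded_map (\<lambda>p. p) V B d V B d (\<lambda>x. x)"
  by (simp add: graded_map_def)

lemma graded_map_homog_component:
  assumes f: "graded_map \<rho> V B d W B' d' f" and x: "x \<in> free_carrier V B"
  shows "f (homog_component d j x) = homog_component d' j (f x)"
  using x
proof (induction rule: free_induct_homogeneous)
  case zero
  show ?case using graded_map_0[OF f] by simp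
next
  case (single b t c)
  show ?case (is "f (homog_component d j ?x) = _")
    using homog_component_of_part[OF single_in_part[OF single, where c = c and d = d], where j = j]
      homog_component_of_part[OF graded_mapD(4)[OF f single_in_part[OF single, where c = c]], where j = j]
      graded_map_0[OF f] by auto
next
  case (add x y)
  then show ?case
    using graded_mapD(2)[OF f part_subset[OF homog_component_in_part[OF add(1)]]
        part_subset[OF homog_component_in_part[OF add(2)]], of d j d j] graded_mapD(2)[OF f]
    by (simp add: homog_component_add)
qed

lemma graded_map_eqI:
  assumes f: "graded_map \<rho> V B d W B' d' f" and g: "graded_map \<rho> V B d W B' d' g"
    and basis: "\<And>b. b \<in> B \<Longrightarrow> f (Poly_Mapping.single b 1) = g (Poly_Mapping.single b 1)"
    and x: "x \<in> free_carrier V B"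
  shows "f x = g x"
  using x
proof (induction rule: free_induct)
  case zero
  then show ?case using graded_map_0[OF f] graded_map_0[OF g] by simp
next
  case (single b p)
  have "Poly_Mapping.single b 1 \<in> free_carrier V B"
    using single(1) by (auto simp: free_carrier_iff lookup_single when_def lookup_one)
  then show ?case
    using graded_mapD(3)[OF f single(2)] graded_mapD(3)[OF g single(2)] basis[OF single(1)]
    by (metis scale_single mult.right_neutral)
next
  case (add x y)
  then show ?case using graded_mapD(2)[OF f] graded_mapD(2)[OF g] by simp
qed

definition lin_ext ::
  "(('x, 'k) mpoly \<Rightarrow> ('y, 'k::field) mpoly) \<Rightarrow> (nat \<Rightarrow> (nat \<Rightarrow>\<^sub>0 ('y, 'k) mpoly)) \<Rightarrow>
   (nat \<Rightarrow>\<^sub>0 ('x, 'k) mpoly) \<Rightarrow> (nat \<Rightarrow>\<^sub>0 ('y, 'k) mpoly)" where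
  "lin_ext \<rho> w f = (\<Sum>b\<in>supp f. scale (\<rho> (cf f b)) (w b))"

lemma lin_ext_basis: "graded_hom V W \<rho> \<Longrightarrow> lin_ext \<rho> w (Poly_Mapping.single b 1) = w b"
  by (simp add: lin_ext_def graded_hom_simps)

lemma graded_map_lin_ext:
  assumes \<rho>: "graded_hom V W \<rho>" and w: "\<And>b. b \<in> B \<Longrightarrow> w b \<in> free_part W B' d' (d b)"
  shows "graded_map \<rho> V B d W B' d' (lin_ext \<rho> w)"
  unfolding graded_map_def
proof (intro conjI ballI allI)
  have sum_closed: "(\<Sum>b\<in>A. F b) \<in> free_carrier W B'" if "\<And>b. b \<in> A \<Longrightarrow> F b \<in> free_carrier W B'"
    for A and F :: "nat \<Rightarrow> nat \<Rightarrow>\<^sub>0 ('b, 'c) mpoly"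
    using that by (induction A rule: infinite_finite_induct) (auto intro: free_closed)
  have sum_part: "(\<Sum>b\<in>A. F b) \<in> free_part W B' d' j" if "\<And>b. b \<in> A \<Longrightarrow> F b \<in> free_part W B' d' j"
    for A j and F :: "nat \<Rightarrow> nat \<Rightarrow>\<^sub>0 ('b, 'c) mpoly"
    using that by (induction A rule: infinite_finite_induct) (auto intro: part_closed)
  show "lin_ext \<rho> w x \<in> free_carrier W B'" if "x \<in> free_carrier V B" for x
    unfolding lin_ext_def
    using that part_subset[OF w]
    by (intro sum_closed scale_closed graded_hom_simps(7)[OF \<rho>]) (auto simp: free_module_def)
  show "lin_ext \<rho> w (x + y) = lin_ext \<rho> w x + lin_ext \<rho> w y" for x y
    unfolding lin_ext_def
    by (rule setsum_keys_plus_distrib) (auto simp: graded_hom_simps[OF \<rho>] single_add distrib_right)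
  show "lin_ext \<rho> w (scale p x) = scale (\<rho> p) (lin_ext \<rho> w x)" for p x
  proof -
    have "lin_ext \<rho> w (scale p x) = (\<Sum>b\<in>supp x. scale (\<rho> (cf (scale p x) b)) (w b))"
      unfolding lin_ext_def by (rule sum.mono_neutral_left)
        (use supp_scale[of p x] in \<open>auto simp: in_keys_iff graded_hom_simps[OF \<rho>]\<close>)
    also have "\<dots> = scale (\<rho> p) (lin_ext \<rho> w x)"
      unfolding lin_ext_def sum_distrib_left
      by (simp add: cf_scale graded_hom_simps[OF \<rho>] mult.assoc[symmetric] mult_single)
    finally show ?thesis .
  qed
  show "lin_ext \<rho> w x \<in> free_part W B' d' j" if x: "x \<in> free_part V B d j" for x j
    unfolding lin_ext_def
  proof (rule sum_part)
    fix b assume b: "b \<in> supp x"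
    show "scale (\<rho> (cf x b)) (w b) \<in> free_part W B' d' j"
    proof (rule scale_part)
      show "\<rho> (cf x b) \<in> carrier (poly_ring W)"
        using x by (intro graded_hom_simps(7)[OF \<rho>]) (auto simp: free_part_def free_module_def)
      show "w b \<in> free_part W B' d' (d b)"
        using x b by (intro w) (auto simp: free_part_def free_module_def)
      fix t assume "t \<in> supp (\<rho> (cf x b))"
      moreover have "mon_deg ` supp (\<rho> (cf x b)) \<subseteq> mon_deg ` supp (cf x b)"
        using \<rho> by (simp add: graded_hom_def)
      ultimately obtain u where "u \<in> supp (cf x b)" "mon_deg t = mon_deg u" by blast
      then show "int (mon_deg t) + d b = j"
        using x b by (auto simp: free_part_def)
    qed
  qed
qed

text \<open>Free modules are projective, with respect to maps that are semilinear along a homomorphism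
  of polynomial rings. The value of the lift on a basis element is the homogeneous component, in
  the right degree, of an arbitrary preimage.\<close>

lemma graded_lift:
  fixes \<rho> :: "('x, 'k::field) mpoly \<Rightarrow> ('y, 'k) mpoly"
  assumes \<rho>: "graded_hom V W \<rho>" and \<theta>: "graded_map \<rho> V B d W C e \<theta>"
    and D: "graded_map (\<lambda>p. p) W B' d' W C e D"
    and im: "\<And>x. x \<in> free_carrier V B \<Longrightarrow> \<theta> x \<in> D ` free_carrier W B'"
  obtains f where "graded_map \<rho> V B d W B' d' f"
    "\<And>x. x \<in> free_carrier V B \<Longrightarrow> D (f x) = \<theta> x"
proof -
  have "\<exists>w. w \<in> free_part W B' d' (d b) \<and> D w = \<theta> (Poly_Mapping.single b 1)" if b: "b \<in> B" for b
  proof -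
    have e: "Poly_Mapping.single b 1 \<in> free_part V B d (d b)"
      using single_in_part[OF b, of 0 V 1 d] by simp
    then obtain w where w: "w \<in> free_carrier W B'" "\<theta> (Poly_Mapping.single b 1) = D w"
      using im[OF part_subset] by blast
    have "D (homog_component d' (d b) w) = D w"
      using graded_map_homog_component[OF D w(1)] homog_component_of_part[OF graded_mapD(4)[OF \<theta> e]] w(2)
      by simp
    then show ?thesis using homog_component_in_part[OF w(1)] w(2) by metis
  qed
  then obtain w where w: "\<And>b. b \<in> B \<Longrightarrow> w b \<in> free_part W B' d' (d b)"
    "\<And>b. b \<in> B \<Longrightarrow> D (w b) = \<theta> (Poly_Mapping.single b 1)" by metis
  have f: "graded_map \<rho> V B d W B' d' (lin_ext \<rho> w)" by (rule graded_map_lin_ext[OF \<rho> w(1)])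
  show ?thesis
  proof
    fix x :: "nat \<Rightarrow>\<^sub>0 ('x, 'k) mpoly" assume x: "x \<in> free_carrier V B"
    show "D (lin_ext \<rho> w x) = \<theta> x"
      by (rule graded_map_eqI[OF graded_map_compose[OF f D \<rho>] \<theta> _ x])
        (use w lin_ext_basis[OF \<rho>] in auto)
  qed (rule f)
qed

section \<open>Existence of graded free resolutions\<close>

lemma cf_const_mult: "cf (const c * p) t = c * cf p t"
  by (cases "c = 0 \<or> cf p t = 0")
    (auto simp: const_def mult_map_scale_conv_mult[symmetric] Poly_Mapping.map.rep_eq when_def)

lemma countable_monomials:
  assumes "finite V"
  shows "countable {t :: 'x \<Rightarrow>\<^sub>0 nat. supp t \<subseteq> V}"
  using assms
proof (induction V)
  case empty
  have "{t :: 'x \<Rightarrow>\<^sub>0 nat. supp t \<subseteq> {}} \<subseteq> {0}"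
    by (auto simp: in_keys_iff intro!: poly_mapping_eqI)
  then show ?case by (meson countable_empty countable_insert countable_subset)
next
  case (insert x V)
  have "t \<in> (\<lambda>(u, n). u + Poly_Mapping.single x n) ` ({t. supp t \<subseteq> V} \<times> UNIV)"
    if "supp t \<subseteq> insert x V" for t :: "'x \<Rightarrow>\<^sub>0 nat"
  proof (rule image_eqI)
    let ?u = "t - Poly_Mapping.single x (cf t x)"
    show "t = (\<lambda>(u, n). u + Poly_Mapping.single x n) (?u, cf t x)"
      by (auto intro!: poly_mapping_eqI simp: lookup_add lookup_minus lookup_single when_def)
    show "(?u, cf t x) \<in> {t. supp t \<subseteq> V} \<times> UNIV"
      using that by (auto simp: subset_iff in_keys_iff lookup_minus lookup_single when_def split: if_splits)
  qed
  then have "{t :: 'x \<Rightarrow>\<^sub>0 nat. supp t \<subseteq> insert x V}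
      \<subseteq> (\<lambda>(u, n). u + Poly_Mapping.single x n) ` ({t. supp t \<subseteq> V} \<times> UNIV)"
    by (intro subsetI) simp
  then show ?case
    using insert.IH by (meson countable_SIGMA countable_image countable_subset countableI_type)
qed

definition homogeneous_submodule ::
  "'x set \<Rightarrow> nat set \<Rightarrow> (nat \<Rightarrow> int) \<Rightarrow> (nat \<Rightarrow>\<^sub>0 ('x, 'k::field) mpoly) set \<Rightarrow> bool" where
  "homogeneous_submodule V B d K \<longleftrightarrow> K \<subseteq> free_carrier V B \<and> 0 \<in> K \<and>
     (\<forall>x\<in>K. \<forall>y\<in>K. x + y \<in> K) \<and>
     (\<forall>p\<in>carrier (poly_ring V). \<forall>x\<in>K. scale p x \<in> K) \<and>
     (\<forall>x\<in>K. \<forall>j. homog_component d j x \<in> K)"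

text \<open>The generators need to be countable in number even when the field is not. The monomials
  times basis elements are therefore enumerated, and for each of them that occurs as the last term
  of a homogeneous element of \<open>K\<close>, one such element is chosen; subtracting multiples of the
  chosen elements reduces every homogeneous element of \<open>K\<close> to zero.\<close>

lemma homogeneous_submodule_generated:
  fixes K :: "(nat \<Rightarrow>\<^sub>0 ('x, 'k::field) mpoly) set"
  assumes V: "finite V" and K: "homogeneous_submodule V B d K"
  obtains B' d' D where "graded_map (\<lambda>p. p) V B' d' V B d D" "D ` free_carrier V B' = K"
proof -
  define T where "T = (UNIV :: nat set) \<times> {t :: 'x \<Rightarrow>\<^sub>0 nat. supp t \<subseteq> V}"
  have T: "countable T" unfolding T_def by (intro countable_SIGMA countable_monomials[OF V]) simp
  define pos where "pos = to_nat_on T"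
  have pos: "pos (b, t) = pos (b', t') \<longleftrightarrow> b = b' \<and> t = t'"
    if "supp t \<subseteq> V" "supp t' \<subseteq> V" for b t b' t'
    using inj_on_eq_iff[OF inj_on_to_nat_on[OF T], of "(b, t)" "(b', t')"] that
    by (auto simp: T_def pos_def)
  have Ksub: "K \<subseteq> free_carrier V B" and K0: "0 \<in> K"
    and Kadd: "\<And>x y. x \<in> K \<Longrightarrow> y \<in> K \<Longrightarrow> x + y \<in> K"
    and Kscale: "\<And>p x. p \<in> carrier (poly_ring V) \<Longrightarrow> x \<in> K \<Longrightarrow> scale p x \<in> K"
    and Kcomp: "\<And>x j. x \<in> K \<Longrightarrow> homog_component d j x \<in> K"
    using K by (auto simp: homogeneous_submodule_def)
  have suppV: "supp t \<subseteq> V" if "x \<in> K" "cf (cf x b) t \<noteq> 0" for x b t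
    using subsetD[OF Ksub that(1)] that(2) unfolding free_carrier_iff by blast
  \<comment> \<open>\<open>lead n w\<close>: the term at position \<open>n\<close> occurs in the homogeneous element \<open>w\<close> of \<open>K\<close> and is
    its last one.\<close>
  define lead where "lead = (\<lambda>n w. w \<in> K \<and> (\<exists>b t. pos (b, t) = n \<and> cf (cf w b) t \<noteq> 0 \<and>
      w \<in> free_part V B d (int (mon_deg t) + d b)) \<and>
      (\<forall>b t. cf (cf w b) t \<noteq> 0 \<longrightarrow> pos (b, t) \<le> n))"
  define B' where "B' = {n. \<exists>w. lead n w}"
  define w where "w = (\<lambda>n. SOME w. lead n w)"
  define d' where "d' = (\<lambda>n. SOME j. w n \<in> free_part V B d j)"
  have w: "lead n (w n)" if "n \<in> B'" for n
    using that someI_ex[of "lead n"] by (auto simp: B'_def w_def)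
  have w_part: "w n \<in> free_part V B d (d' n)" if "n \<in> B'" for n
    using w[OF that] someI_ex[of "\<lambda>j. w n \<in> free_part V B d j"] by (auto simp: lead_def d'_def)
  define D :: "(nat \<Rightarrow>\<^sub>0 ('x, 'k) mpoly) \<Rightarrow> _" where "D = lin_ext (\<lambda>p. p) w"
  have D: "graded_map (\<lambda>p. p) V B' d' V B d D"
    unfolding D_def by (rule graded_map_lin_ext[OF graded_hom_id w_part])
  have D_basis: "D (Poly_Mapping.single n 1) = w n" for n
    unfolding D_def by (rule lin_ext_basis[OF graded_hom_id])
  have basis: "Poly_Mapping.single n 1 \<in> free_carrier V B'" if "n \<in> B'" for n
    using that by (auto simp: free_carrier_iff lookup_single when_def lookup_one)
  have "D x \<in> K" if "x \<in> free_carrier V B'" for x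
    using that
  proof (induction rule: free_induct)
    case (single n p)
    have "D (Poly_Mapping.single n p) = scale p (w n)"
      using graded_mapD(3)[OF D single(2) basis[OF single(1)]] by (simp add: D_basis mult_single)
    then show ?case using Kscale[OF single(2)] w[OF single(1)] by (simp add: lead_def)
  qed (use K0 Kadd graded_mapD(2)[OF D] graded_map_0[OF D] in auto)
  moreover have homog: "x \<in> D ` free_carrier V B'"
    if "x \<in> K" "x \<in> free_part V B d j" "\<forall>b t. cf (cf x b) t \<noteq> 0 \<longrightarrow> pos (b, t) < N" for x j N
    using that
  proof (induction N arbitrary: x)
    case 0
    then have "x = 0" by (intro free_eqI) auto
    then show ?case using graded_map_0[OF D] free_closed(1) by (metis image_eqI)
  next
    case (Suc n)
    show ?case
    proof (cases "\<exists>b t. cf (cf x b) t \<noteq> 0 \<and> pos (b, t) = n")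
      case False
      then show ?thesis using Suc by (metis less_Suc_eq)
    next
      case True
      then obtain b t where bt: "cf (cf x b) t \<noteq> 0" "pos (b, t) = n" by blast
      have deg: "j = int (mon_deg t) + d b" using Suc.prems(2) bt by (auto simp: free_part_iff)
      have "lead n x" unfolding lead_def
        using Suc.prems bt deg by (auto simp: less_Suc_eq_le)
      then have n: "n \<in> B'" by (auto simp: B'_def)
      obtain b' t' where bt': "pos (b', t') = n" "cf (cf (w n) b') t' \<noteq> 0"
        "w n \<in> free_part V B d (int (mon_deg t') + d b')" and wK: "w n \<in> K"
        and wle: "\<forall>b t. cf (cf (w n) b) t \<noteq> 0 \<longrightarrow> pos (b, t) \<le> n"
        using w[OF n] unfolding lead_def by blast
      have "b' = b \<and> t' = t"
        using pos suppV[OF wK bt'(2)] suppV[OF Suc.prems(1) bt(1)] bt(2) bt'(1) by metis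
      then have wbt: "cf (cf (w n) b) t \<noteq> 0" "w n \<in> free_part V B d j"
        using bt' deg by auto
      define c where "c = cf (cf x b) t / cf (cf (w n) b) t"
      define y where "y = x + scale (const (- c)) (w n)"
      have cy: "cf (cf y b) t = cf (cf x b) t - c * cf (cf (w n) b) t" for b t
        by (simp add: y_def lookup_add cf_scale cf_const_mult)
      have "y \<in> K" unfolding y_def using Suc.prems wK by (intro Kadd Kscale poly_ring_closed)
      moreover have "y \<in> free_part V B d j"
        unfolding y_def using Suc.prems wbt
        by (intro part_closed scale_part[of _ _ _ _ _ j] poly_ring_closed)
          (auto simp: const_def split: if_splits)
      moreover have "pos (b', t') < n" if y: "cf (cf y b') t' \<noteq> 0" for b' t'
      proof -
        have "pos (b', t') \<le> n"
          using y Suc.prems(3) wle unfolding cy by (metis less_Suc_eq_le diff_zero mult_zero_right)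
        moreover have "pos (b', t') \<noteq> n"
        proof
          assume "pos (b', t') = n"
          then have "b' = b" "t' = t"
            using pos[OF suppV[OF \<open>y \<in> K\<close> y] suppV[OF Suc.prems(1) bt(1)], of b' b] bt(2)
            by simp_all
          then show False using y wbt(1) unfolding cy by (simp add: c_def)
        qed
        ultimately show ?thesis by simp
      qed
      ultimately have "y \<in> D ` free_carrier V B'" using Suc.IH by blast
      then obtain z where z: "z \<in> free_carrier V B'" "y = D z" by blast
      let ?e = "scale (const c) (Poly_Mapping.single n 1)"
      have e: "?e \<in> free_carrier V B'" using basis[OF n] by (intro scale_closed poly_ring_closed)
      have "D (z + ?e) = y + scale (const c) (w n)"
        using graded_mapD(2)[OF D z(1) e] graded_mapD(3)[OF D poly_ring_closed(6) basis[OF n], of c]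
        by (simp only: D_basis z(2))
      also have "\<dots> = x"
        unfolding y_def by (simp add: const_def single_uminus)
      finally show ?thesis using free_closed(2)[OF z(1) e] by (metis image_eqI)
    qed
  qed
  moreover have "x \<in> D ` free_carrier V B'" if x: "x \<in> K" for x
  proof -
    have comp: "homog_component d j x \<in> D ` free_carrier V B'" for j
    proof -
      have "finite (\<Union>b\<in>supp x. (\<lambda>t. pos (b, t)) ` supp (cf x b))" by auto
      then obtain N where N: "\<forall>m\<in>(\<Union>b\<in>supp x. (\<lambda>t. pos (b, t)) ` supp (cf x b)). m < N"
        using finite_nat_set_iff_bounded by blast
      have "pos (b, t) < N" if "cf (cf x b) t \<noteq> 0" for b t
      proof -
        have "b \<in> supp x" "t \<in> supp (cf x b)" using that by (auto simp: in_keys_iff)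
        then show ?thesis using N by blast
      qed
      then show ?thesis
        using homog[OF Kcomp[OF x] homog_component_in_part, of j N] Ksub x
        by (auto simp: cf_homog_component)
    qed
    obtain J where J: "finite J" "x = (\<Sum>j\<in>J. homog_component d j x)"
      using sum_homog_components by metis
    have "(\<Sum>j\<in>J'. homog_component d j x) \<in> D ` free_carrier V B'" if "finite J'" for J'
      using that
    proof induction
      case empty
      then show ?case using graded_map_0[OF D] free_closed(1) by (metis image_eqI sum.empty)
    next
      case (insert j J')
      then obtain y z where "y \<in> free_carrier V B'" "z \<in> free_carrier V B'"
        "homog_component d j x = D y" "(\<Sum>j\<in>J'. homog_component d j x) = D z"
        using comp by blast
      then show ?case
        using insert.hyps graded_mapD(2)[OF D] free_closed(2) by (metis image_eqI sum.insert)
    qed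
    then show ?thesis using J by metis
  qed
  ultimately have "D ` free_carrier V B' = K" by blast
  with D show ?thesis using that by blast
qed

lemma homogeneous_submodule_kernel:
  assumes D: "graded_map (\<lambda>p. p) V B d V B' d' D"
  shows "homogeneous_submodule V B d {x \<in> free_carrier V B. D x = 0}"
  unfolding homogeneous_submodule_def
proof (intro conjI ballI allI)
  fix x j assume x: "x \<in> {x \<in> free_carrier V B. D x = 0}"
  then have "D (homog_component d j x) = homog_component d' j 0"
    using graded_map_homog_component[OF D] by auto
  then show "homog_component d j x \<in> {x \<in> free_carrier V B. D x = 0}"
    using x part_subset[OF homog_component_in_part] by auto
qed (use graded_mapD[OF D] graded_map_0[OF D] free_closed scale_closed in auto)

text \<open>An ideal placed below its resolution as a submodule of the free module of rank one. The
  augmentation becomes a map between free modules like the others, which makes the constructions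
  by recursion along the complex uniform; level \<open>n + 1\<close> is the module in homological degree \<open>n\<close>.\<close>

definition augmented_resolution ::
  "'x set \<Rightarrow> ('x, 'k::field) mpoly set \<Rightarrow> (nat \<Rightarrow> nat set) \<Rightarrow> (nat \<Rightarrow> nat \<Rightarrow> int) \<Rightarrow>
   (nat \<Rightarrow> (nat \<Rightarrow>\<^sub>0 ('x, 'k) mpoly) \<Rightarrow> (nat \<Rightarrow>\<^sub>0 ('x, 'k) mpoly)) \<Rightarrow> bool" where
  "augmented_resolution V I B d D \<longleftrightarrow>
     B 0 = {0} \<and> d 0 0 = 0 \<and>
     (\<forall>n. graded_map (\<lambda>p. p) V (B (Suc n)) (d (Suc n)) V (B n) (d n) (D n)) \<and>
     D 0 ` free_carrier V (B 1) = Poly_Mapping.single 0 ` I \<and>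
     (\<forall>n. D (Suc n) ` free_carrier V (B (Suc (Suc n))) = {x \<in> free_carrier V (B (Suc n)). D n x = 0})"

definition homogeneous_ideal :: "'x set \<Rightarrow> ('x, 'k::field) mpoly set \<Rightarrow> bool" where
  "homogeneous_ideal V I \<longleftrightarrow> homogeneous_submodule V {0} (\<lambda>_. 0) (Poly_Mapping.single 0 ` I)"

text \<open>The free modules are chosen one after another: the next one covers the kernel of the last map,
  which is again a homogeneous submodule.\<close>

lemma augmented_resolution_exists:
  fixes I :: "('x, 'k::field) mpoly set"
  assumes V: "finite V" and I: "homogeneous_ideal V I"
  obtains B d D where "augmented_resolution V I B d D"
proof -
  define P :: "nat \<Rightarrow> nat set \<times> (nat \<Rightarrow> int) \<times> ((nat \<Rightarrow>\<^sub>0 ('x, 'k) mpoly) \<Rightarrow> (nat \<Rightarrow>\<^sub>0 ('x, 'k) mpoly)) \<Rightarrow> bool"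
    where "P = (\<lambda>n (B, d, D). \<exists>B' d'. graded_map (\<lambda>p. p) V B d V B' d' D \<and>
      (n = 0 \<longrightarrow> B' = {0} \<and> d' = (\<lambda>_. 0) \<and> D ` free_carrier V B = Poly_Mapping.single 0 ` I))"
  define Q :: "nat \<Rightarrow> nat set \<times> (nat \<Rightarrow> int) \<times> ((nat \<Rightarrow>\<^sub>0 ('x, 'k) mpoly) \<Rightarrow> (nat \<Rightarrow>\<^sub>0 ('x, 'k) mpoly)) \<Rightarrow>
      nat set \<times> (nat \<Rightarrow> int) \<times> ((nat \<Rightarrow>\<^sub>0 ('x, 'k) mpoly) \<Rightarrow> (nat \<Rightarrow>\<^sub>0 ('x, 'k) mpoly)) \<Rightarrow> bool"
    where "Q = (\<lambda>n (B, d, D) (B', d', D'). graded_map (\<lambda>p. p) V B' d' V B d D' \<and>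
      D' ` free_carrier V B' = {x \<in> free_carrier V B. D x = 0})"
  have "\<exists>x. P 0 x"
  proof -
    from homogeneous_submodule_generated[OF V I[unfolded homogeneous_ideal_def]]
    obtain B d D where "graded_map (\<lambda>p. p) V B d V {0} (\<lambda>_. 0) D"
      "D ` free_carrier V B = Poly_Mapping.single 0 ` I" .
    then show ?thesis by (intro exI[of _ "(B, d, D)"]) (auto simp: P_def)
  qed
  moreover have "\<exists>y. P (Suc n) y \<and> Q n x y" if Px: "P n x" for n x
  proof -
    obtain B d D where x: "x = (B, d, D)" by (cases x) auto
    obtain B' d' where "graded_map (\<lambda>p. p) V B d V B' d' D" using Px by (auto simp: P_def x)
    from homogeneous_submodule_generated[OF V homogeneous_submodule_kernel[OF this]]
    obtain B'' d'' D'' where "graded_map (\<lambda>p. p) V B'' d'' V B d D''"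
      "D'' ` free_carrier V B'' = {x \<in> free_carrier V B. D x = 0}" .
    then show ?thesis by (intro exI[of _ "(B'', d'', D'')"]) (auto simp: P_def Q_def x)
  qed
  ultimately obtain f where f: "\<And>n. P n (f n)" "\<And>n. Q n (f n) (f (Suc n))"
    using dependent_nat_choice[of P Q] by metis
  define D where "D = (\<lambda>n. snd (snd (f n)))"
  define B where "B = (\<lambda>n. case n of 0 \<Rightarrow> {0} | Suc m \<Rightarrow> fst (f m))"
  define d where "d = (\<lambda>n. case n of 0 \<Rightarrow> (\<lambda>_. 0) | Suc m \<Rightarrow> fst (snd (f m)))"
  have "augmented_resolution V I B d D"
    unfolding augmented_resolution_def
  proof (intro conjI allI)
    fix n
    show "graded_map (\<lambda>p. p) V (B (Suc n)) (d (Suc n)) V (B n) (d n) (D n)"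
      using f(1)[of 0] f(2)[of "n - 1"]
      by (cases n) (auto simp: P_def Q_def B_def d_def D_def split: prod.splits)
    show "D (Suc n) ` free_carrier V (B (Suc (Suc n))) = {x \<in> free_carrier V (B (Suc n)). D n x = 0}"
      using f(2)[of n] by (auto simp: Q_def B_def D_def split: prod.splits)
  next
    show "D 0 ` free_carrier V (B 1) = Poly_Mapping.single 0 ` I"
      using f(1)[of 0] by (auto simp: P_def B_def D_def split: prod.splits)
  qed (auto simp: B_def d_def)
  then show ?thesis using that by blast
qed

lemma linear_iff_graded_map:
  "linear_map (poly_ring V) (free_module V B) (free_module V B') f \<and>
    (\<forall>j. f ` free_part V B d j \<subseteq> free_part V B' d' j) \<longleftrightarrow> graded_map (\<lambda>p. p) V B d V B' d' f"
  unfolding linear_map_def graded_map_def by (auto simp: image_subset_iff)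

lemma graded_free_resolution_exists:
  fixes I :: "('x, 'k::field) mpoly set"
  assumes V: "finite V" and I: "homogeneous_ideal V I"
  shows "\<exists>F. graded_free_resolution V I F"
proof -
  obtain B d D where R: "augmented_resolution V I B d D"
    using augmented_resolution_exists[OF assms] .
  define F :: "('x, 'k) free_complex" where
    "F = \<lparr>basis = (\<lambda>n. B (Suc n)), shift = (\<lambda>n. d (Suc n)), bd = (\<lambda>n. D (Suc n)),
          aug = (\<lambda>x. cf (D 0 x) 0)\<rparr>"
  have B0: "B 0 = {0}" "d 0 0 = 0"
    and D: "\<And>n. graded_map (\<lambda>p. p) V (B (Suc n)) (d (Suc n)) V (B n) (d n) (D n)"
    and D0: "D 0 ` free_carrier V (B 1) = Poly_Mapping.single 0 ` I"
    and ex: "\<And>n. D (Suc n) ` free_carrier V (B (Suc (Suc n))) = {x \<in> free_carrier V (B (Suc n)). D n x = 0}"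
    using R by (auto simp: augmented_resolution_def)
  have aug: "D 0 x = Poly_Mapping.single 0 (cf (D 0 x) 0) \<and> cf (D 0 x) 0 \<in> I"
    if x: "x \<in> free_carrier V (B 1)" for x
  proof -
    have "D 0 x \<in> Poly_Mapping.single 0 ` I" using D0 x by blast
    then show ?thesis by auto
  qed
  note D0' = graded_mapD[OF D[of 0]]
  have "graded_free_resolution V I F"
    unfolding graded_free_resolution_def
  proof (intro conjI allI)
    show "linear_map (poly_ring V) (fc_mod V F 0) (ideal_module I) (aug F)"
      using aug D0' by (auto simp: linear_map_def F_def ideal_module_def lookup_add cf_scale)
    show "aug F ` fc_part V F 0 j \<subseteq> homog_part I j" for j
    proof
      fix p assume "p \<in> aug F ` fc_part V F 0 j"
      then obtain x where x: "x \<in> free_part V (B 1) (d 1) j" "p = cf (D 0 x) 0"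
        by (auto simp: F_def)
      have part: "D 0 x \<in> free_part V (B 0) (d 0) j" using D0'(4)[of x j] x(1) by simp
      have "int (mon_deg t) = j" if "t \<in> supp p" for t
      proof -
        have "cf (cf (D 0 x) 0) t \<noteq> 0" using that x(2) by (simp add: in_keys_iff)
        then have "int (mon_deg t) + d 0 0 = j" using part unfolding free_part_iff by blast
        then show ?thesis using B0(2) by simp
      qed
      then show "p \<in> homog_part I j"
        using aug[OF part_subset[OF x(1)]] x by (auto simp: homog_part_def)
    qed
    show "linear_map (poly_ring V) (fc_mod V F (Suc n)) (fc_mod V F n) (bd F n)" for n
      using D[of "Suc n"] by (auto simp: F_def linear_iff_graded_map[symmetric])
    show "bd F n ` fc_part V F (Suc n) j \<subseteq> fc_part V F n j" for n j
      using D[of "Suc n"] by (auto simp: F_def linear_iff_graded_map[symmetric])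
    show "aug F ` carrier (fc_mod V F 0) = I"
    proof (intro equalityI subsetI)
      show "p \<in> I" if "p \<in> aug F ` carrier (fc_mod V F 0)" for p
        using that aug by (auto simp: F_def)
      fix p assume "p \<in> I"
      then obtain x where "x \<in> free_carrier V (B 1)" "D 0 x = Poly_Mapping.single 0 p"
        using D0 by (metis (no_types, lifting) image_iff)
      then show "p \<in> aug F ` carrier (fc_mod V F 0)"
        by (intro image_eqI[of _ _ x]) (auto simp: F_def)
    qed
    have "D 0 x = 0 \<longleftrightarrow> cf (D 0 x) 0 = 0" if "x \<in> free_carrier V (B 1)" for x
      using aug[OF that] by (metis lookup_zero single_zero)
    then show "bd F 0 ` carrier (fc_mod V F 1) = {f \<in> carrier (fc_mod V F 0). aug F f = 0}"
      using ex[of 0] by (auto simp: F_def)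
    show "bd F (Suc n) ` carrier (fc_mod V F (Suc (Suc n))) =
          {f \<in> carrier (fc_mod V F (Suc n)). bd F n f = 0}" for n
      using ex[of "Suc n"] by (simp add: F_def)
  qed
  then show ?thesis ..
qed

lemma augmented_resolution_of_graded:
  fixes F :: "('x, 'k::field) free_complex"
  assumes F: "graded_free_resolution V I F" and I: "homogeneous_ideal V I"
  shows "augmented_resolution V I (\<lambda>n. case n of 0 \<Rightarrow> {0} | Suc m \<Rightarrow> basis F m)
    (\<lambda>n. case n of 0 \<Rightarrow> (\<lambda>_. 0) | Suc m \<Rightarrow> shift F m)
    (\<lambda>n. case n of 0 \<Rightarrow> (\<lambda>x. Poly_Mapping.single 0 (aug F x)) | Suc m \<Rightarrow> bd F m)"
proof -
  have F: "linear_map (poly_ring V) (fc_mod V F 0) (ideal_module I) (aug F)"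
     "\<And>j. aug F ` fc_part V F 0 j \<subseteq> homog_part I j"
     "\<And>i. linear_map (poly_ring V) (fc_mod V F (Suc i)) (fc_mod V F i) (bd F i)"
     "\<And>i j. bd F i ` fc_part V F (Suc i) j \<subseteq> fc_part V F i j"
     "aug F ` carrier (fc_mod V F 0) = I"
     "bd F 0 ` carrier (fc_mod V F 1) = {f \<in> carrier (fc_mod V F 0). aug F f = 0}"
     "\<And>i. bd F (Suc i) ` carrier (fc_mod V F (Suc (Suc i))) =
          {f \<in> carrier (fc_mod V F (Suc i)). bd F i f = 0}"
    using F unfolding graded_free_resolution_def by simp_all
  have bd: "graded_map (\<lambda>p. p) V (basis F (Suc i)) (shift F (Suc i)) V (basis F i) (shift F i) (bd F i)" for i
    using F(3,4)[of i] linear_iff_graded_map by blast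
  have Isub: "p \<in> carrier (poly_ring V)" if "p \<in> I" for p
  proof -
    have "Poly_Mapping.single 0 p \<in> free_carrier V {0}"
      using I that by (auto simp: homogeneous_ideal_def homogeneous_submodule_def)
    then have "\<forall>b. cf (Poly_Mapping.single (0 :: nat) p) b \<in> carrier (poly_ring V)"
      by (simp add: free_module_def)
    then show ?thesis by (metis lookup_single_eq)
  qed
  have aug: "graded_map (\<lambda>p. p) V (basis F 0) (shift F 0) V {0} (\<lambda>_. 0) (\<lambda>x. Poly_Mapping.single 0 (aug F x))"
    unfolding graded_map_def
  proof (intro conjI ballI allI)
    fix x :: "nat \<Rightarrow>\<^sub>0 ('x, 'k) mpoly" assume x: "x \<in> free_carrier V (basis F 0)"
    then have "aug F x \<in> carrier (poly_ring V)" using F(5) Isub by blast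
    then show "Poly_Mapping.single 0 (aug F x) \<in> free_carrier V {0}"
      by (auto simp: free_module_def lookup_single when_def poly_ring_closed)
    show "Poly_Mapping.single 0 (aug F (x + y)) = Poly_Mapping.single 0 (aug F x) + Poly_Mapping.single 0 (aug F y)"
      if "y \<in> free_carrier V (basis F 0)" for y
      using F(1) x that by (auto simp: linear_map_def ideal_module_def single_add)
    show "Poly_Mapping.single 0 (aug F (scale p x)) = scale p (Poly_Mapping.single 0 (aug F x))"
      if "p \<in> carrier (poly_ring V)" for p
      using F(1) x that by (auto simp: linear_map_def ideal_module_def mult_single)
  next
    fix j and x :: "nat \<Rightarrow>\<^sub>0 ('x, 'k) mpoly" assume x: "x \<in> fc_part V F 0 j"
    then have p: "aug F x \<in> homog_part I j" using F(2) by blast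
    then have "aug F x \<in> carrier (poly_ring V)" using Isub by (auto simp: homog_part_def)
    then show "Poly_Mapping.single 0 (aug F x) \<in> free_part V {0} (\<lambda>_. 0) j"
      using p by (auto simp: free_part_iff free_carrier_iff lookup_single when_def poly_ring_carrier
          homog_part_def in_keys_iff split: if_splits)
  qed
  have "{x \<in> free_carrier V (basis F 0). Poly_Mapping.single 0 (aug F x) = (0 :: nat \<Rightarrow>\<^sub>0 _)}
      = {f \<in> carrier (fc_mod V F 0). aug F f = 0}"
    by (auto) (metis lookup_single_eq lookup_zero)
  then show ?thesis
    unfolding augmented_resolution_def
    using bd aug F(5,6,7) by (auto split: nat.splits simp: image_image[symmetric])
qed

section \<open>Comparison of resolutions\<close>

lemma augmented_resolutionD:
  assumes "augmented_resolution V I B d D"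
  shows "B 0 = {0}" "d 0 0 = 0"
    "graded_map (\<lambda>p. p) V (B (Suc n)) (d (Suc n)) V (B n) (d n) (D n)"
    "D 0 ` free_carrier V (B (Suc 0)) = Poly_Mapping.single 0 ` I"
    "D (Suc n) ` free_carrier V (B (Suc (Suc n))) = {x \<in> free_carrier V (B (Suc n)). D n x = 0}"
  using assms by (auto simp: augmented_resolution_def)

lemma rank_one_free_carrier:
  assumes "x \<in> free_carrier V {0}"
  obtains p where "p \<in> carrier (poly_ring V)" "x = Poly_Mapping.single 0 p"
proof (rule that)
  show "x = Poly_Mapping.single 0 (cf x 0)"
  proof (rule free_eqI)
    fix b t
    show "cf (cf x b) t = cf (cf (Poly_Mapping.single 0 (cf x 0)) b) t"
      using assms unfolding free_carrier_iff by (cases "b = 0") (auto simp: lookup_single when_def)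
  qed
  show "cf x 0 \<in> carrier (poly_ring V)" using assms by (simp add: free_module_def)
qed

text \<open>The composite of the map found last with the differential takes values in the image of the next
  differential: at the bottom because \<open>\<rho>\<close> maps \<open>I\<close> into \<open>J\<close>, and above because of exactness. So it
  lifts to the next level.\<close>

lemma chain_map_exists:
  fixes \<rho> :: "('x, 'k::field) mpoly \<Rightarrow> ('y, 'k) mpoly"
  assumes \<rho>: "graded_hom V W \<rho>" and \<rho>I: "\<rho> ` I \<subseteq> J"
    and F: "augmented_resolution V I B d D" and G: "augmented_resolution W J B' d' D'"
  obtains \<Phi> where "\<And>n. graded_map \<rho> V (B n) (d n) W (B' n) (d' n) (\<Phi> n)"
    "\<And>n x. x \<in> free_carrier V (B (Suc n)) \<Longrightarrow> D' n (\<Phi> (Suc n) x) = \<Phi> n (D n x)"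
    "\<And>p. \<Phi> 0 (Poly_Mapping.single 0 p) = Poly_Mapping.single 0 (\<rho> p)"
proof -
  note F = augmented_resolutionD[OF F] and G = augmented_resolutionD[OF G]
  define \<Phi>0 :: "(nat \<Rightarrow>\<^sub>0 ('x, 'k) mpoly) \<Rightarrow> (nat \<Rightarrow>\<^sub>0 ('y, 'k) mpoly)"
    where "\<Phi>0 = lin_ext \<rho> (\<lambda>_. Poly_Mapping.single 0 1)"
  have \<Phi>0: "graded_map \<rho> V (B 0) (d 0) W (B' 0) (d' 0) \<Phi>0"
    unfolding \<Phi>0_def
  proof (rule graded_map_lin_ext[OF \<rho>])
    fix b assume "b \<in> B 0"
    then show "Poly_Mapping.single 0 1 \<in> free_part W (B' 0) (d' 0) (d 0 b)"
      using single_in_part[of 0 "B' 0" 0 W 1 "d' 0"] F(1,2) G(1,2) by simp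
  qed
  have \<Phi>0_single: "\<Phi>0 (Poly_Mapping.single 0 p) = Poly_Mapping.single 0 (\<rho> p)" for p
    by (cases "p = 0") (auto simp: \<Phi>0_def lin_ext_def graded_hom_simps[OF \<rho>] mult_single)
  define P where "P = (\<lambda>n f. graded_map \<rho> V (B n) (d n) W (B' n) (d' n) f \<and> (n = 0 \<longrightarrow> f = \<Phi>0) \<and>
    (\<forall>x\<in>free_carrier V (B (Suc n)). f (D n x) \<in> D' n ` free_carrier W (B' (Suc n))))"
  define Q where "Q = (\<lambda>n f g. \<forall>x\<in>free_carrier V (B (Suc n)). D' n (g x) = f (D n x))"
  have "P 0 \<Phi>0"
    unfolding P_def
  proof (intro conjI ballI impI \<Phi>0 refl)
    fix x :: "nat \<Rightarrow>\<^sub>0 ('x, 'k) mpoly" assume "x \<in> free_carrier V (B (Suc 0))"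
    then have "D 0 x \<in> Poly_Mapping.single 0 ` I" using F(4) by blast
    then show "\<Phi>0 (D 0 x) \<in> D' 0 ` free_carrier W (B' (Suc 0))"
      unfolding G(4) using \<Phi>0_single \<rho>I by auto
  qed
  moreover have "\<exists>g. P (Suc n) g \<and> Q n f g" if P: "P n f" for n f
  proof -
    have f: "graded_map \<rho> V (B n) (d n) W (B' n) (d' n) f"
      "\<And>x. x \<in> free_carrier V (B (Suc n)) \<Longrightarrow> f (D n x) \<in> D' n ` free_carrier W (B' (Suc n))"
      using P by (auto simp: P_def)
    have fD: "graded_map \<rho> V (B (Suc n)) (d (Suc n)) W (B' n) (d' n) (\<lambda>x. f (D n x))"
      using graded_map_compose[OF F(3)[of n] f(1) graded_hom_id] by simp
    obtain g where g: "graded_map \<rho> V (B (Suc n)) (d (Suc n)) W (B' (Suc n)) (d' (Suc n)) g"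
      "\<And>x. x \<in> free_carrier V (B (Suc n)) \<Longrightarrow> D' n (g x) = f (D n x)"
      using graded_lift[OF \<rho> fD G(3)[of n] f(2)] by blast
    have "g (D (Suc n) x) \<in> D' (Suc n) ` free_carrier W (B' (Suc (Suc n)))"
      if x: "x \<in> free_carrier V (B (Suc (Suc n)))" for x
    proof -
      have "D (Suc n) x \<in> free_carrier V (B (Suc n))" "D n (D (Suc n) x) = 0"
        using F(5)[of n] x by blast+
      then have "D' n (g (D (Suc n) x)) = 0" "g (D (Suc n) x) \<in> free_carrier W (B' (Suc n))"
        using g(2) graded_map_0[OF f(1)] graded_mapD(1)[OF g(1)] by simp_all
      then show ?thesis unfolding G(5) by blast
    qed
    then have "P (Suc n) g \<and> Q n f g" using g by (simp add: P_def Q_def)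
    then show ?thesis by blast
  qed
  ultimately obtain \<Phi> where \<Phi>: "\<And>n. P n (\<Phi> n)" "\<And>n. Q n (\<Phi> n) (\<Phi> (Suc n))"
    using dependent_nat_choice[of P Q] by metis
  have "\<Phi> 0 = \<Phi>0" using \<Phi>(1)[of 0] by (simp add: P_def)
  then show ?thesis
    using \<Phi> \<Phi>0_single by (intro that[of \<Phi>]) (auto simp: P_def Q_def)
qed

text \<open>The defect \<open>g (n + 1) - id - h n \<circ> D n\<close> is annihilated by the differential and therefore lifts
  through the next one. The recursion starts with \<open>h 0 = 0\<close>, as \<open>g\<close> is the identity at the bottom.\<close>

lemma chain_homotopy_exists:
  fixes D :: "nat \<Rightarrow> (nat \<Rightarrow>\<^sub>0 ('x, 'k::field) mpoly) \<Rightarrow> (nat \<Rightarrow>\<^sub>0 ('x, 'k) mpoly)"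
  assumes F: "augmented_resolution V I B d D"
    and g: "\<And>n. graded_map (\<lambda>p. p) V (B n) (d n) V (B n) (d n) (g n)"
    and comm: "\<And>n x. x \<in> free_carrier V (B (Suc n)) \<Longrightarrow> D n (g (Suc n) x) = g n (D n x)"
    and g0: "\<And>x. x \<in> free_carrier V (B 0) \<Longrightarrow> g 0 x = x"
  obtains h where "\<And>n. graded_map (\<lambda>p. p) V (B n) (d n) V (B (Suc n)) (d (Suc n)) (h n)"
    "\<And>n x. x \<in> free_carrier V (B (Suc n)) \<Longrightarrow> g (Suc n) x - x - h n (D n x) = D (Suc n) (h (Suc n) x)"
    "h 0 = (\<lambda>_. 0)"
proof -
  note F = augmented_resolutionD[OF F]
  define P where "P = (\<lambda>n h. graded_map (\<lambda>p. p) V (B n) (d n) V (B (Suc n)) (d (Suc n)) h \<and>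
    (n = 0 \<longrightarrow> h = (\<lambda>_. 0)) \<and>
    (\<forall>x\<in>free_carrier V (B (Suc n)). D n (g (Suc n) x - x - h (D n x)) = 0))"
  define Q where "Q = (\<lambda>n h h'. \<forall>x\<in>free_carrier V (B (Suc n)). D (Suc n) (h' x) = g (Suc n) x - x - h (D n x))"
  have "P 0 (\<lambda>_. 0)"
    unfolding P_def
  proof (intro conjI ballI impI refl)
    show "graded_map (\<lambda>p. p) V (B 0) (d 0) V (B (Suc 0)) (d (Suc 0)) (\<lambda>_. 0)"
      by (simp add: graded_map_def free_closed part_closed)
    fix x :: "nat \<Rightarrow>\<^sub>0 ('x, 'k) mpoly" assume x: "x \<in> free_carrier V (B (Suc 0))"
    then show "D 0 (g (Suc 0) x - x - 0) = 0"
      using graded_map_diff[OF F(3)[of 0] graded_mapD(1)[OF g x] x] comm[OF x]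
        g0[OF graded_mapD(1)[OF F(3)[of 0] x]] by simp
  qed
  moreover have "\<exists>h'. P (Suc n) h' \<and> Q n h h'" if P: "P n h" for n h
  proof -
    have h: "graded_map (\<lambda>p. p) V (B n) (d n) V (B (Suc n)) (d (Suc n)) h"
      "\<And>x. x \<in> free_carrier V (B (Suc n)) \<Longrightarrow> D n (g (Suc n) x - x - h (D n x)) = 0"
      using P by (auto simp: P_def)
    have \<theta>: "graded_map (\<lambda>p. p) V (B (Suc n)) (d (Suc n)) V (B (Suc n)) (d (Suc n))
        (\<lambda>x. g (Suc n) x - x - h (D n x))"
      by (intro graded_map_minus g graded_map_id)
        (use graded_map_compose[OF F(3)[of n] h(1) graded_hom_id] in simp)
    have "g (Suc n) x - x - h (D n x) \<in> D (Suc n) ` free_carrier V (B (Suc (Suc n)))"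
      if x: "x \<in> free_carrier V (B (Suc n))" for x
      unfolding F(5) using graded_mapD(1)[OF \<theta> x] h(2)[OF x] by simp
    then obtain h' where h': "graded_map (\<lambda>p. p) V (B (Suc n)) (d (Suc n)) V (B (Suc (Suc n))) (d (Suc (Suc n))) h'"
      "\<And>x. x \<in> free_carrier V (B (Suc n)) \<Longrightarrow> D (Suc n) (h' x) = g (Suc n) x - x - h (D n x)"
      using graded_lift[OF graded_hom_id \<theta> F(3)[of "Suc n"]] by blast
    have "D (Suc n) (g (Suc (Suc n)) x - x - h' (D (Suc n) x)) = 0"
      if x: "x \<in> free_carrier V (B (Suc (Suc n)))" for x
    proof -
      have Dx: "D (Suc n) x \<in> free_carrier V (B (Suc n))" "D n (D (Suc n) x) = 0"
        using F(5)[of n] x by blast+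
      have gx: "g (Suc (Suc n)) x \<in> free_carrier V (B (Suc (Suc n)))" by (rule graded_mapD(1)[OF g x])
      have hx: "h' (D (Suc n) x) \<in> free_carrier V (B (Suc (Suc n)))" by (rule graded_mapD(1)[OF h'(1) Dx(1)])
      have "D (Suc n) (g (Suc (Suc n)) x - x - h' (D (Suc n) x))
          = g (Suc n) (D (Suc n) x) - D (Suc n) x - D (Suc n) (h' (D (Suc n) x))"
        using graded_map_diff[OF F(3)[of "Suc n"] free_closed(4)[OF gx x] hx]
          graded_map_diff[OF F(3)[of "Suc n"] gx x] comm[OF x] by simp
      also have "\<dots> = 0"
        using h'(2)[OF Dx(1)] Dx(2) graded_map_0[OF h(1)] by simp
      finally show ?thesis .
    qed
    then have "P (Suc n) h' \<and> Q n h h'" using h' by (simp add: P_def Q_def)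
    then show ?thesis by blast
  qed
  ultimately obtain h where h: "\<And>n. P n (h n)" "\<And>n. Q n (h n) (h (Suc n))"
    using dependent_nat_choice[of P Q] by metis
  then show ?thesis by (intro that[of h]) (auto simp: P_def Q_def)
qed

section \<open>Tensoring with the field\<close>

text \<open>Elements of the tensor product are cosets \<open>cls V B z\<close> of formal sums of pairs modulo the subgroup
  \<open>rels V B\<close>. All computations take place on representatives \<open>z \<in> frags V B\<close>, as congruences modulo
  this subgroup.\<close>

abbreviation ten :: "'x set \<Rightarrow> nat set \<Rightarrow>
    (('x, 'k::field) mpoly, (('k \<times> (nat \<Rightarrow>\<^sub>0 ('x, 'k) mpoly)) \<Rightarrow>\<^sub>0 int) set) module" where
  "ten V B \<equiv> tensor (poly_ring V) field_module (free_module V B)"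

abbreviation cls :: "'x set \<Rightarrow> nat set \<Rightarrow> (('k::field \<times> (nat \<Rightarrow>\<^sub>0 ('x, 'k) mpoly)) \<Rightarrow>\<^sub>0 int) \<Rightarrow>
    (('k \<times> (nat \<Rightarrow>\<^sub>0 ('x, 'k) mpoly)) \<Rightarrow>\<^sub>0 int) set" where
  "cls V B \<equiv> tensor_class (poly_ring V) field_module (free_module V B)"

abbreviation rels :: "'x set \<Rightarrow> nat set \<Rightarrow> (('k::field \<times> (nat \<Rightarrow>\<^sub>0 ('x, 'k) mpoly)) \<Rightarrow>\<^sub>0 int) set" where
  "rels V B \<equiv> tensor_rels (poly_ring V) field_module (free_module V B)"

definition frags :: "'x set \<Rightarrow> nat set \<Rightarrow> (('k::field \<times> (nat \<Rightarrow>\<^sub>0 ('x, 'k) mpoly)) \<Rightarrow>\<^sub>0 int) set" where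
  "frags V B = {z. supp z \<subseteq> UNIV \<times> free_carrier V B}"

definition gens :: "'x set \<Rightarrow> nat set \<Rightarrow> (('k::field \<times> (nat \<Rightarrow>\<^sub>0 ('x, 'k) mpoly)) \<Rightarrow>\<^sub>0 int) set" where
  "gens V B =
      {frag_of (a + a', y) - frag_of (a, y) - frag_of (a', y) | a a' y. y \<in> free_carrier V B}
    \<union> {frag_of (a, y + y') - frag_of (a, y) - frag_of (a, y') | a y y'.
         y \<in> free_carrier V B \<and> y' \<in> free_carrier V B}
    \<union> {frag_of (cf r 0 * a, y) - frag_of (a, scale r y) | r a y.
         r \<in> carrier (poly_ring V) \<and> y \<in> free_carrier V B}"

lemma field_module_simps [simp]:
  "carrier field_module = UNIV" "a \<oplus>\<^bsub>field_module\<^esub> a' = a + a'" "r \<odot>\<^bsub>field_module\<^esub> a = cf r 0 * a"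
  by (simp_all add: field_module_def)

lemma rels_generate: "rels V B = generate (free_Abelian_group (UNIV \<times> free_carrier V B)) (gens V B)"
  by (simp add: tensor_rels_def tensor_free_def gens_def)

lemma frags_closed:
  "0 \<in> frags V B" "x \<in> frags V B \<Longrightarrow> y \<in> frags V B \<Longrightarrow> x + y \<in> frags V B"
  "x \<in> frags V B \<Longrightarrow> - x \<in> frags V B"
  "x \<in> frags V B \<Longrightarrow> y \<in> frags V B \<Longrightarrow> x - y \<in> frags V B"
  using keys_add[of x y] keys_diff[of x y] by (auto simp: frags_def)

lemma frags_frag_of [simp]: "frag_of (a, y) \<in> frags V B \<longleftrightarrow> y \<in> free_carrier V B"
  by (auto simp: frags_def)

lemma frags_induct [consumes 1, case_names zero one diff]:
  assumes "z \<in> frags V B" "P 0" "\<And>a y. y \<in> free_carrier V B \<Longrightarrow> P (frag_of (a, y))"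
    "\<And>x y. P x \<Longrightarrow> P y \<Longrightarrow> P (x - y)"
  shows "P z"
  using assms(1) unfolding frags_def mem_Collect_eq
  by (induction rule: frag_induction) (use assms in auto)

lemma gens_frags: "gens V B \<subseteq> frags V B"
  by (auto simp: gens_def intro!: frags_closed free_closed scale_closed)

lemma carrier_free_frags: "carrier (free_Abelian_group (UNIV \<times> free_carrier V B)) = frags V B"
  by (simp add: frags_def free_Abelian_group_def)

lemma subgroup_rels: "subgroup (rels V B) (free_Abelian_group (UNIV \<times> free_carrier V B))"
  unfolding rels_generate
  by (rule group.generate_is_subgroup[OF group_free_Abelian_group])
    (simp add: carrier_free_frags gens_frags del: carrier_free_Abelian_group_iff)

lemma rels_frags: "x \<in> rels V B \<Longrightarrow> x \<in> frags V B"
  using subgroup.mem_carrier[OF subgroup_rels, of x V B] by (simp add: frags_def)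

lemma rels_closed:
  "0 \<in> rels V B"
  "x \<in> rels V B \<Longrightarrow> y \<in> rels V B \<Longrightarrow> x + y \<in> rels V B"
  "x \<in> rels V B \<Longrightarrow> y \<in> rels V B \<Longrightarrow> x - y \<in> rels V B"
proof -
  show "0 \<in> rels V B" using subgroup.one_closed[OF subgroup_rels, of V B] by simp
  show "x + y \<in> rels V B" if "x \<in> rels V B" "y \<in> rels V B"
    using subgroup.m_closed[OF subgroup_rels that] by simp
  show "x - y \<in> rels V B" if xy: "x \<in> rels V B" "y \<in> rels V B"
  proof -
    have "- y \<in> rels V B"
      using subgroup.m_inv_closed[OF subgroup_rels xy(2)] rels_frags[OF xy(2)] by (simp add: frags_def)
    then show ?thesis using subgroup.m_closed[OF subgroup_rels xy(1), of "- y"] by simp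
  qed
qed

lemma gens_rels: "x \<in> gens V B \<Longrightarrow> x \<in> rels V B"
  unfolding rels_generate by (rule generate.incl)

lemma rels_add_left:
  "y \<in> free_carrier V B \<Longrightarrow> frag_of (a + a', y) - frag_of (a, y) - frag_of (a', y) \<in> rels V B"
  by (rule gens_rels) (unfold gens_def, blast)

lemma rels_add_right:
  "y \<in> free_carrier V B \<Longrightarrow> y' \<in> free_carrier V B \<Longrightarrow>
    frag_of (a, y + y') - frag_of (a, y) - frag_of (a, y') \<in> rels V B"
  by (rule gens_rels) (unfold gens_def, blast)

lemma cls_translate: "cls V B z = (\<lambda>h. h + z) ` rels V B"
  by (auto simp: tensor_class_def r_coset_def tensor_free_def)

lemma cls_eq_iff: "cls V B z = cls V B z' \<longleftrightarrow> z - z' \<in> rels V B"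
proof
  assume *: "cls V B z = cls V B z'"
  have "z \<in> cls V B z" unfolding cls_translate by (rule image_eqI[of _ _ 0]) (simp_all add: rels_closed)
  then have "z \<in> cls V B z'" using * by simp
  then obtain h where "h \<in> rels V B" "z = h + z'" unfolding cls_translate by (rule imageE)
  then show "z - z' \<in> rels V B" by simp
next
  assume *: "z - z' \<in> rels V B"
  have "h + z \<in> cls V B z'" if "h \<in> rels V B" for h
    unfolding cls_translate using rels_closed(2)[OF that *] by (intro image_eqI[of _ _ "h + (z - z')"]) simp_all
  moreover have "h + z' \<in> cls V B z" if "h \<in> rels V B" for h
    unfolding cls_translate using rels_closed(3)[OF that *] by (intro image_eqI[of _ _ "h - (z - z')"]) simp_all
  ultimately show "cls V B z = cls V B z'" by (auto simp: cls_translate[of V B z] cls_translate[of V B z'])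
qed

lemma ten_carrier: "carrier (ten V B) = cls V B ` frags V B"
  by (auto simp: tensor_def FactGroup_def RCOSETS_def tensor_class_def tensor_free_def frags_def Let_def)

lemma ten_zero: "\<zero>\<^bsub>ten V B\<^esub> = cls V B 0"
  by (simp add: tensor_def FactGroup_def cls_translate Let_def)

lemma ten_add: "cls V B z \<oplus>\<^bsub>ten V B\<^esub> cls V B z' = cls V B (z + z')"
proof -
  have "cls V B z \<oplus>\<^bsub>ten V B\<^esub> cls V B z' = {x + y | x y. x \<in> cls V B z \<and> y \<in> cls V B z'}"
    by (auto simp: tensor_def FactGroup_def set_mult_def tensor_free_def Let_def)
  also have "\<dots> = cls V B (z + z')"
  proof (intro equalityI subsetI)
    fix u assume "u \<in> {x + y | x y. x \<in> cls V B z \<and> y \<in> cls V B z'}"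
    then obtain h h' where "h \<in> rels V B" "h' \<in> rels V B" "u = (h + h') + (z + z')"
      by (auto simp: cls_translate algebra_simps)
    then show "u \<in> cls V B (z + z')" unfolding cls_translate using rels_closed(2) by blast
  next
    fix u assume "u \<in> cls V B (z + z')"
    then obtain h where h: "h \<in> rels V B" "u = h + (z + z')" unfolding cls_translate by blast
    have "h + z \<in> cls V B z" "0 + z' \<in> cls V B z'"
      unfolding cls_translate using h(1) rels_closed(1) by blast+
    moreover have "u = (h + z) + (0 + z')" using h(2) by (simp add: add.assoc)
    ultimately show "u \<in> {x + y | x y. x \<in> cls V B z \<and> y \<in> cls V B z'}" by blast
  qed
  finally show ?thesis .
qed

lemma ten_abelian_group: "abelian_group (ten V B)"
proof (rule abelian_groupI)
  fix X assume "X \<in> carrier (ten V B)"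
  then obtain z where z: "z \<in> frags V B" "X = cls V B z" unfolding ten_carrier by blast
  then show "\<exists>Y\<in>carrier (ten V B). Y \<oplus>\<^bsub>ten V B\<^esub> X = \<zero>\<^bsub>ten V B\<^esub>"
    by (intro bexI[of _ "cls V B (- z)"]) (auto simp: ten_carrier ten_add ten_zero frags_closed)
qed (auto simp: ten_carrier ten_add ten_zero frags_closed add_ac)

text \<open>With \<open>f\<close> the identity this represents multiplication by \<open>c\<close>, and with \<open>c = 1\<close> the map induced
  by \<open>f\<close>.\<close>

definition pair_map :: "'k::field \<Rightarrow> ('m \<Rightarrow> 'n) \<Rightarrow> (('k \<times> 'm) \<Rightarrow>\<^sub>0 int) \<Rightarrow> (('k \<times> 'n) \<Rightarrow>\<^sub>0 int)" where
  "pair_map c f = frag_extend (\<lambda>(a, y). frag_of (c * a, f y))"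

lemma pair_map_simps [simp]:
  "pair_map c f (frag_of (a, y)) = frag_of (c * a, f y)" "pair_map c f 0 = 0"
  "pair_map c f (z + z') = pair_map c f z + pair_map c f z'"
  "pair_map c f (z - z') = pair_map c f z - pair_map c f z'"
  "pair_map c f (- z) = - pair_map c f z"
  by (simp_all add: pair_map_def frag_extend_add frag_extend_diff frag_extend_minus)

lemma pair_map_1_id: "pair_map 1 (\<lambda>y. y) z = z"
proof -
  have "pair_map 1 (\<lambda>y. y) z = frag_extend frag_of z"
    unfolding pair_map_def by (rule frag_extend_eq) auto
  then show ?thesis using frag_expansion[of z] by simp
qed

lemma pair_map_pair_map: "pair_map c f (pair_map c' g z) = pair_map (c * c') (\<lambda>y. f (g y)) z"
  using subset_UNIV by (induction z rule: frag_induction) (auto simp: mult.assoc)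

lemma pair_map_supp: "supp z \<subseteq> UNIV \<times> A \<Longrightarrow> f ` A \<subseteq> A' \<Longrightarrow> supp (pair_map c f z) \<subseteq> UNIV \<times> A'"
  unfolding pair_map_def using keys_frag_extend[of "\<lambda>(a, y). frag_of (c * a, f y)" z] by fastforce

lemma pair_map_cong:
  "z \<in> frags V B \<Longrightarrow> (\<And>y. y \<in> free_carrier V B \<Longrightarrow> f y = g y) \<Longrightarrow> pair_map c f z = pair_map c g z"
  by (induction rule: frags_induct) auto

lemma pair_map_frags:
  "graded_map \<rho> V B d W B' d' f \<Longrightarrow> z \<in> frags V B \<Longrightarrow> pair_map c f z \<in> frags W B'"
  unfolding frags_def mem_Collect_eq
  by (rule pair_map_supp) (auto simp: graded_mapD(1))

lemma pair_map_rels: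
  assumes f: "graded_map \<rho> V B d W B' d' f" and \<rho>: "graded_hom V W \<rho>" and z: "z \<in> rels V B"
  shows "pair_map c f z \<in> rels W B'"
proof -
  have gen: "pair_map c f z \<in> rels W B'" if "z \<in> gens V B" for z
  proof (rule gens_rels)
    from that consider
      (1) a a' y where "z = frag_of (a + a', y) - frag_of (a, y) - frag_of (a', y)" "y \<in> free_carrier V B"
    | (2) a y y' where "z = frag_of (a, y + y') - frag_of (a, y) - frag_of (a, y')"
        "y \<in> free_carrier V B" "y' \<in> free_carrier V B"
    | (3) r a y where "z = frag_of (cf r 0 * a, y) - frag_of (a, scale r y)"
        "r \<in> carrier (poly_ring V)" "y \<in> free_carrier V B"
      unfolding gens_def by blast
    then show "pair_map c f z \<in> gens W B'"
    proof cases
      case 1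
      have "pair_map c f z = frag_of (c * a + c * a', f y) - frag_of (c * a, f y) - frag_of (c * a', f y)"
        by (simp add: 1 distrib_left)
      then show ?thesis unfolding gens_def using graded_mapD(1)[OF f 1(2)] by blast
    next
      case 2
      have "pair_map c f z = frag_of (c * a, f y + f y') - frag_of (c * a, f y) - frag_of (c * a, f y')"
        by (simp add: 2 graded_mapD(2)[OF f 2(2,3)])
      then show ?thesis
        unfolding gens_def using graded_mapD(1)[OF f 2(2)] graded_mapD(1)[OF f 2(3)] by blast
    next
      case 3
      have "pair_map c f z = frag_of (cf (\<rho> r) 0 * (c * a), f y) - frag_of (c * a, scale (\<rho> r) (f y))"
        by (simp add: 3 graded_mapD(3)[OF f 3(2,3)] graded_hom_simps(6)[OF \<rho>] mult.left_commute)
      then show ?thesis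
        unfolding gens_def using graded_mapD(1)[OF f 3(3)] graded_hom_simps(7)[OF \<rho> 3(2)] by blast
    qed
  qed
  from z[unfolded rels_generate] show ?thesis
  proof (induction rule: generate.induct)
    case one
    then show ?case by (simp add: rels_closed)
  next
    case (incl h)
    then show ?case by (rule gen)
  next
    case (inv h)
    have "inv\<^bsub>free_Abelian_group (UNIV \<times> free_carrier V B)\<^esub> h = 0 - h"
      using subsetD[OF gens_frags inv] by (simp add: frags_def)
    then show ?case using rels_closed(3)[OF rels_closed(1) gen[OF inv]] by simp
  next
    case (eng h h')
    then show ?case by (simp add: rels_closed)
  qed
qed

lemma pair_map_add_rels:
  assumes z: "z \<in> frags V B"
    and "\<And>y. y \<in> free_carrier V B \<Longrightarrow> f y \<in> free_carrier W B'" "\<And>y. y \<in> free_carrier V B \<Longrightarrow> g y \<in> free_carrier W B'"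
  shows "pair_map c (\<lambda>y. f y + g y) z - pair_map c f z - pair_map c g z \<in> rels W B'"
  using z
proof (induction rule: frags_induct)
  case zero
  then show ?case by (simp add: rels_closed)
next
  case (one a y)
  then show ?case using rels_add_right[OF assms(2,3)] by simp
next
  case (diff x y)
  have eq: "pair_map c (\<lambda>y. f y + g y) (x - y) - pair_map c f (x - y) - pair_map c g (x - y)
    = (pair_map c (\<lambda>y. f y + g y) x - pair_map c f x - pair_map c g x)
      - (pair_map c (\<lambda>y. f y + g y) y - pair_map c f y - pair_map c g y)"
    by (simp add: algebra_simps)
  show ?case unfolding eq by (rule rels_closed(3)[OF diff])
qed

text \<open>An operation that respects the relations gives the same coset for each representative, so the
  union over the representatives is that coset.\<close>

lemma Union_cls:
  assumes "\<And>h. h \<in> rels V B \<Longrightarrow> F h \<in> rels W B'" "\<And>x y. F (x + y) = F x + F y"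
  shows "(\<Union>z'\<in>cls V B z. cls W B' (F z')) = cls W B' (F z)"
proof -
  have "cls W B' (F z') = cls W B' (F z)" if "z' \<in> cls V B z" for z'
    using that assms by (auto simp: cls_translate[of V B] cls_eq_iff)
  moreover have "z \<in> cls V B z" using rels_closed(1) by (auto simp: cls_translate intro!: image_eqI[of _ _ 0])
  ultimately show ?thesis by blast
qed

definition induced :: "'y set \<Rightarrow> nat set \<Rightarrow> ((nat \<Rightarrow>\<^sub>0 ('x, 'k) mpoly) \<Rightarrow> (nat \<Rightarrow>\<^sub>0 ('y, 'k) mpoly)) \<Rightarrow>
    (('k \<times> (nat \<Rightarrow>\<^sub>0 ('x, 'k) mpoly)) \<Rightarrow>\<^sub>0 int) set \<Rightarrow>
    (('k::field \<times> (nat \<Rightarrow>\<^sub>0 ('y, 'k) mpoly)) \<Rightarrow>\<^sub>0 int) set" where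
  "induced W B' f X = (\<Union>z\<in>X. cls W B' (pair_map 1 f z))"

lemma tensor_map_eq: "tensor_map (poly_ring V) field_module (free_module V B) f = induced V B f"
  by (simp add: tensor_map_def induced_def pair_map_def fun_eq_iff)

lemma induced_cls:
  assumes "graded_map \<rho> V B d W B' d' f" "graded_hom V W \<rho>"
  shows "induced W B' f (cls V B z) = cls W B' (pair_map 1 f z)"
  unfolding induced_def by (rule Union_cls) (auto intro: pair_map_rels[OF assms])

lemma ten_smult: "const c \<odot>\<^bsub>ten V B\<^esub> cls V B z = cls V B (pair_map c (\<lambda>y. y) z)"
proof -
  have "const c \<odot>\<^bsub>ten V B\<^esub> cls V B z = (\<Union>z'\<in>cls V B z. cls V B (pair_map c (\<lambda>y. y) z'))"
    by (simp add: tensor_def Let_def pair_map_def const_def)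
  also have "\<dots> = cls V B (pair_map c (\<lambda>y. y) z)"
    by (rule Union_cls) (auto intro: pair_map_rels[OF graded_map_id graded_hom_id])
  finally show ?thesis .
qed

lemma ten_smult_closed: "X \<in> carrier (ten V B) \<Longrightarrow> const c \<odot>\<^bsub>ten V B\<^esub> X \<in> carrier (ten V B)"
  using imageI[OF pair_map_frags[OF graded_map_id]] by (auto simp: ten_carrier ten_smult)

lemma ten_smult_laws:
  assumes "X \<in> carrier (ten V B)"
  shows "const 0 \<odot>\<^bsub>ten V B\<^esub> X = \<zero>\<^bsub>ten V B\<^esub>" "const 1 \<odot>\<^bsub>ten V B\<^esub> X = X"
    "const (-1) \<odot>\<^bsub>ten V B\<^esub> X \<oplus>\<^bsub>ten V B\<^esub> X = \<zero>\<^bsub>ten V B\<^esub>"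
proof -
  obtain z where z: "z \<in> frags V B" "X = cls V B z" using assms unfolding ten_carrier by blast
  have sum: "pair_map (c + c') (\<lambda>y. y) z - pair_map c (\<lambda>y. y) z - pair_map c' (\<lambda>y. y) z \<in> rels V B" for c c'
    using z(1)
  proof (induction rule: frags_induct)
    case zero
    then show ?case by (simp add: rels_closed)
  next
    case (one a y)
    then show ?case using rels_add_left by (simp add: distrib_right)
  next
    case (diff x y)
    have eq: "pair_map (c + c') (\<lambda>y. y) (x - y) - pair_map c (\<lambda>y. y) (x - y) - pair_map c' (\<lambda>y. y) (x - y)
      = (pair_map (c + c') (\<lambda>y. y) x - pair_map c (\<lambda>y. y) x - pair_map c' (\<lambda>y. y) x)
        - (pair_map (c + c') (\<lambda>y. y) y - pair_map c (\<lambda>y. y) y - pair_map c' (\<lambda>y. y) y)"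
      by (simp add: algebra_simps)
    show ?case unfolding eq by (rule rels_closed(3)[OF diff])
  qed
  have zero: "pair_map 0 (\<lambda>y. y) z \<in> rels V B"
    using rels_closed(3)[OF rels_closed(1) sum[of 0 0]] by simp
  show "const 0 \<odot>\<^bsub>ten V B\<^esub> X = \<zero>\<^bsub>ten V B\<^esub>" using zero by (simp add: z ten_smult ten_zero cls_eq_iff)
  show "const 1 \<odot>\<^bsub>ten V B\<^esub> X = X" by (simp add: z ten_smult pair_map_1_id)
  have "pair_map (-1) (\<lambda>y. y) z + z \<in> rels V B"
    using rels_closed(3)[OF zero sum[of "-1" 1, simplified]] by (simp add: pair_map_1_id add.commute)
  then show "const (-1) \<odot>\<^bsub>ten V B\<^esub> X \<oplus>\<^bsub>ten V B\<^esub> X = \<zero>\<^bsub>ten V B\<^esub>"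
    by (simp add: z ten_smult ten_add ten_zero cls_eq_iff)
qed

section \<open>Comparison of Betti numbers\<close>

text \<open>The assumption \<open>inj\<close> says that \<open>\<phi>\<close> induces an injective map \<open>Z/U \<rightarrow> Z'/U'\<close>. Such a map sends a set
  that is independent modulo \<open>U\<close> injectively to a set that is independent modulo \<open>U'\<close>: if two elements
  had the same image, their difference would be a relation.\<close>

lemma quot_dim_le_if_injective:
  fixes M :: "(('x, 'k::field) mpoly, 'm) module" and N :: "(('y, 'k) mpoly, 'n) module"
  assumes M: "abelian_group M" and N: "abelian_group N"
    and Ms: "\<And>c x. x \<in> carrier M \<Longrightarrow> const c \<odot>\<^bsub>M\<^esub> x \<in> carrier M"
    and Ns: "\<And>c x. x \<in> carrier N \<Longrightarrow> const c \<odot>\<^bsub>N\<^esub> x \<in> carrier N"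
    and N0: "\<And>x. x \<in> carrier N \<Longrightarrow> const 0 \<odot>\<^bsub>N\<^esub> x = \<zero>\<^bsub>N\<^esub>"
    and N1: "\<And>x. x \<in> carrier N \<Longrightarrow> const 1 \<odot>\<^bsub>N\<^esub> x = x"
    and Nm: "\<And>x. x \<in> carrier N \<Longrightarrow> const (-1) \<odot>\<^bsub>N\<^esub> x \<oplus>\<^bsub>N\<^esub> x = \<zero>\<^bsub>N\<^esub>"
    and ZM: "Z \<subseteq> carrier M" and Z0: "\<zero>\<^bsub>M\<^esub> \<in> Z"
    and Zadd: "\<And>x y. x \<in> Z \<Longrightarrow> y \<in> Z \<Longrightarrow> x \<oplus>\<^bsub>M\<^esub> y \<in> Z"
    and Zs: "\<And>c x. x \<in> Z \<Longrightarrow> const c \<odot>\<^bsub>M\<^esub> x \<in> Z"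
    and \<phi>: "\<And>x. x \<in> carrier M \<Longrightarrow> \<phi> x \<in> carrier N" "\<phi> \<zero>\<^bsub>M\<^esub> = \<zero>\<^bsub>N\<^esub>"
      "\<And>x y. x \<in> carrier M \<Longrightarrow> y \<in> carrier M \<Longrightarrow> \<phi> (x \<oplus>\<^bsub>M\<^esub> y) = \<phi> x \<oplus>\<^bsub>N\<^esub> \<phi> y"
      "\<And>c x. x \<in> carrier M \<Longrightarrow> \<phi> (const c \<odot>\<^bsub>M\<^esub> x) = const c \<odot>\<^bsub>N\<^esub> \<phi> x"
    and \<phi>Z: "\<phi> ` Z \<subseteq> Z'" and U0: "\<zero>\<^bsub>N\<^esub> \<in> U'"
    and inj: "\<And>z. z \<in> Z \<Longrightarrow> \<phi> z \<in> U' \<Longrightarrow> z \<in> U"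
  shows "quot_dim M Z U \<le> quot_dim N Z' U'"
  unfolding quot_dim_def
proof (rule Sup_least)
  interpret M: abelian_group M by fact
  interpret N: abelian_group N by fact
  fix e assume "e \<in> {enat (card X) | X. finite X \<and> X \<subseteq> Z \<and>
            (\<forall>c. (\<Oplus>\<^bsub>M\<^esub>x\<in>X. const (c x) \<odot>\<^bsub>M\<^esub> x) \<in> U \<longrightarrow> (\<forall>x\<in>X. c x = 0))}"
  then obtain X where e: "e = enat (card X)" and X: "finite X" "X \<subseteq> Z"
    and indep: "\<And>c. (\<Oplus>\<^bsub>M\<^esub>x\<in>X. const (c x) \<odot>\<^bsub>M\<^esub> x) \<in> U \<Longrightarrow> (\<forall>x\<in>X. c x = 0)"
    by auto
  have XM: "x \<in> carrier M" if "x \<in> X" for x using that X ZM by blast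
  have comb: "(\<Oplus>\<^bsub>M\<^esub>x\<in>Y. const (c x) \<odot>\<^bsub>M\<^esub> x) \<in> Z \<and>
      \<phi> (\<Oplus>\<^bsub>M\<^esub>x\<in>Y. const (c x) \<odot>\<^bsub>M\<^esub> x) = (\<Oplus>\<^bsub>N\<^esub>x\<in>Y. const (c x) \<odot>\<^bsub>N\<^esub> \<phi> x)"
    if "finite Y" "Y \<subseteq> X" for Y c
    using that
  proof (induction Y)
    case empty
    then show ?case using Z0 \<phi>(2) by simp
  next
    case (insert x Y)
    have Y: "(\<lambda>x. const (c x) \<odot>\<^bsub>M\<^esub> x) \<in> Y \<rightarrow> carrier M" "(\<lambda>x. const (c x) \<odot>\<^bsub>N\<^esub> \<phi> x) \<in> Y \<rightarrow> carrier N"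
      and x: "x \<in> carrier M" "x \<in> Z"
      using insert.prems XM X Ms Ns \<phi>(1) by auto
    then show ?case
      using insert Zadd Zs ZM \<phi>(3,4) Ms Ns \<phi>(1)
      by (simp add: M.finsum_insert N.finsum_insert subset_iff)
  qed
  have zero: "\<forall>x\<in>X. c x = 0" if "(\<Oplus>\<^bsub>N\<^esub>x\<in>X. const (c x) \<odot>\<^bsub>N\<^esub> \<phi> x) \<in> U'" for c
    using comb[OF X(1) subset_refl, of c] that by (intro indep inj) auto
  have "inj_on \<phi> X"
  proof (rule inj_onI, rule ccontr)
    fix x y assume xy: "x \<in> X" "y \<in> X" "\<phi> x = \<phi> y" "x \<noteq> y"
    define c where "c = (\<lambda>z. if z = x then -1 else if z = y then 1 else (0 :: 'k))"
    define Y where "Y = X - {x, y}"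
    have XY: "X = insert x (insert y Y)" "finite Y" "x \<notin> insert y Y" "y \<notin> Y"
      using xy X by (auto simp: Y_def)
    have cl: "const (c z) \<odot>\<^bsub>N\<^esub> \<phi> z \<in> carrier N" if "z \<in> X" for z using that XM Ns \<phi>(1) by blast
    have "(\<Oplus>\<^bsub>N\<^esub>z\<in>Y. const (c z) \<odot>\<^bsub>N\<^esub> \<phi> z) = (\<Oplus>\<^bsub>N\<^esub>z\<in>Y. \<zero>\<^bsub>N\<^esub>)"
      by (rule N.finsum_cong') (use XM \<phi>(1) N0 in \<open>auto simp: c_def Y_def\<close>)
    then have Y0: "(\<Oplus>\<^bsub>N\<^esub>z\<in>Y. const (c z) \<odot>\<^bsub>N\<^esub> \<phi> z) = \<zero>\<^bsub>N\<^esub>" by simp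
    have "(\<Oplus>\<^bsub>N\<^esub>z\<in>X. const (c z) \<odot>\<^bsub>N\<^esub> \<phi> z)
      = const (c x) \<odot>\<^bsub>N\<^esub> \<phi> x \<oplus>\<^bsub>N\<^esub> (const (c y) \<odot>\<^bsub>N\<^esub> \<phi> y \<oplus>\<^bsub>N\<^esub> \<zero>\<^bsub>N\<^esub>)"
      unfolding XY(1) using XY(2-4) cl unfolding Y0[symmetric]
      by (subst N.finsum_insert; (subst N.finsum_insert)?) (auto simp: XY(1))
    also have "\<dots> = \<zero>\<^bsub>N\<^esub>"
      using xy XM \<phi>(1) N1 Nm by (simp add: c_def)
    finally have "c x = 0" using zero[of c] U0 xy by simp
    then show False by (simp add: c_def)
  qed
  have "(\<forall>y\<in>\<phi> ` X. c y = 0)" if "(\<Oplus>\<^bsub>N\<^esub>y\<in>\<phi> ` X. const (c y) \<odot>\<^bsub>N\<^esub> y) \<in> U'" for c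
  proof -
    have "(\<Oplus>\<^bsub>N\<^esub>y\<in>\<phi> ` X. const (c y) \<odot>\<^bsub>N\<^esub> y) = (\<Oplus>\<^bsub>N\<^esub>x\<in>X. const (c (\<phi> x)) \<odot>\<^bsub>N\<^esub> \<phi> x)"
      using XM \<phi>(1) Ns by (intro N.finsum_reindex \<open>inj_on \<phi> X\<close>) auto
    then show ?thesis using zero[of "\<lambda>x. c (\<phi> x)"] that by simp
  qed
  then show "e \<le> Sup {enat (card X) | X. finite X \<and> X \<subseteq> Z' \<and>
            (\<forall>c. (\<Oplus>\<^bsub>N\<^esub>x\<in>X. const (c x) \<odot>\<^bsub>N\<^esub> x) \<in> U' \<longrightarrow> (\<forall>x\<in>X. c x = 0))}"
    using X \<phi>Z e card_image[OF \<open>inj_on \<phi> X\<close>]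
    by (intro Sup_upper) (auto intro!: exI[of _ "\<phi> ` X"] simp: image_subset_iff)
qed

definition frag_part :: "'x set \<Rightarrow> nat set \<Rightarrow> (nat \<Rightarrow> int) \<Rightarrow> int \<Rightarrow>
    (('k::field \<times> (nat \<Rightarrow>\<^sub>0 ('x, 'k) mpoly)) \<Rightarrow>\<^sub>0 int) set" where
  "frag_part V B d j = {z. supp z \<subseteq> UNIV \<times> free_part V B d j}"

lemma frag_part_frags: "z \<in> frag_part V B d j \<Longrightarrow> z \<in> frags V B"
  using part_subset by (fastforce simp: frag_part_def frags_def)

lemma frag_part_closed:
  "0 \<in> frag_part V B d j"
  "x \<in> frag_part V B d j \<Longrightarrow> y \<in> frag_part V B d j \<Longrightarrow> x + y \<in> frag_part V B d j"
  "x \<in> frag_part V B d j \<Longrightarrow> y \<in> frag_part V B d j \<Longrightarrow> x - y \<in> frag_part V B d j"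
  using keys_add[of x y] keys_diff[of x y] by (auto simp: frag_part_def)

lemma pair_map_frag_part:
  "graded_map \<rho> V B d W B' d' f \<Longrightarrow> z \<in> frag_part V B d j \<Longrightarrow> pair_map c f z \<in> frag_part W B' d' j"
  unfolding frag_part_def mem_Collect_eq
  by (rule pair_map_supp) (auto simp: graded_mapD(4))

lemma tor_part_eq: "tor_part V F i j = cls V (basis F i) ` frag_part V (basis F i) (shift F i) j"
proof -
  have "carrier (free_Abelian_group (UNIV \<times> fc_part V F i j)) = frag_part V (basis F i) (shift F i) j"
    by (simp add: frag_part_def free_Abelian_group_def)
  then show ?thesis unfolding tor_part_def by (rule arg_cong)
qed

lemma filter_image: "{y \<in> f ` A. P y} = f ` {x \<in> A. P (f x)}"
  by auto

text \<open>Let \<open>\<Phi>\<close> and \<open>\<Psi>\<close> be chain maps that lift \<open>\<iota>\<close> and \<open>\<pi>\<close>. As \<open>\<pi> \<circ> \<iota>\<close> is the identity, \<open>\<Psi> \<circ> \<Phi>\<close> is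
  homotopic to the identity, so a cycle whose image under \<open>\<Phi>\<close> is a boundary is a boundary itself:
  apply \<open>\<Psi>\<close> and the homotopy.\<close>

lemma betti_le_if_retract:
  fixes I :: "('x, 'k::field) mpoly set" and J :: "('y, 'k) mpoly set"
  assumes V: "finite V" and W: "finite W"
    and I: "homogeneous_ideal V I" and J: "homogeneous_ideal W J"
    and \<iota>: "graded_hom V W \<iota>" and \<pi>: "graded_hom W V \<pi>"
    and \<pi>\<iota>: "\<And>p. p \<in> carrier (poly_ring V) \<Longrightarrow> \<pi> (\<iota> p) = p"
    and \<iota>I: "\<iota> ` I \<subseteq> J" and \<pi>J: "\<pi> ` J \<subseteq> I"
  shows "betti V I i j \<le> betti W J i j"
proof -
  define F where "F = (SOME F. graded_free_resolution V I F)"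
  define G where "G = (SOME F. graded_free_resolution W J F)"
  have F: "graded_free_resolution V I F"
    unfolding F_def by (rule someI_ex[OF graded_free_resolution_exists[OF V I]])
  have G: "graded_free_resolution W J G"
    unfolding G_def by (rule someI_ex[OF graded_free_resolution_exists[OF W J]])
  obtain B d D where B_def: "B = (\<lambda>n. case n of 0 \<Rightarrow> {0} | Suc m \<Rightarrow> basis F m)"
    and d_def: "d = (\<lambda>n. case n of 0 \<Rightarrow> (\<lambda>_. 0) | Suc m \<Rightarrow> shift F m)"
    and D_def: "D = (\<lambda>n. case n of 0 \<Rightarrow> (\<lambda>x. Poly_Mapping.single 0 (aug F x)) | Suc m \<Rightarrow> bd F m)" by simp
  obtain B' d' D' where B'_def: "B' = (\<lambda>n. case n of 0 \<Rightarrow> {0} | Suc m \<Rightarrow> basis G m)"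
    and d'_def: "d' = (\<lambda>n. case n of 0 \<Rightarrow> (\<lambda>_. 0) | Suc m \<Rightarrow> shift G m)"
    and D'_def: "D' = (\<lambda>n. case n of 0 \<Rightarrow> (\<lambda>x. Poly_Mapping.single 0 (aug G x)) | Suc m \<Rightarrow> bd G m)" by simp
  have R: "augmented_resolution V I B d D"
    unfolding B_def d_def D_def by (rule augmented_resolution_of_graded[OF F I])
  have R': "augmented_resolution W J B' d' D'"
    unfolding B'_def d'_def D'_def by (rule augmented_resolution_of_graded[OF G J])
  note R1 = augmented_resolutionD[OF R] and R2 = augmented_resolutionD[OF R']
  obtain \<Phi> where \<Phi>: "\<And>n. graded_map \<iota> V (B n) (d n) W (B' n) (d' n) (\<Phi> n)"
    "\<And>n x. x \<in> free_carrier V (B (Suc n)) \<Longrightarrow> D' n (\<Phi> (Suc n) x) = \<Phi> n (D n x)"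
    "\<And>p. \<Phi> 0 (Poly_Mapping.single 0 p) = Poly_Mapping.single 0 (\<iota> p)"
    using chain_map_exists[OF \<iota> \<iota>I R R'] by blast
  obtain \<Psi> where \<Psi>: "\<And>n. graded_map \<pi> W (B' n) (d' n) V (B n) (d n) (\<Psi> n)"
    "\<And>n x. x \<in> free_carrier W (B' (Suc n)) \<Longrightarrow> D n (\<Psi> (Suc n) x) = \<Psi> n (D' n x)"
    "\<And>p. \<Psi> 0 (Poly_Mapping.single 0 p) = Poly_Mapping.single 0 (\<pi> p)"
    using chain_map_exists[OF \<pi> \<pi>J R' R] by blast
  have g: "graded_map (\<lambda>p. p) V (B n) (d n) V (B n) (d n) (\<lambda>x. \<Psi> n (\<Phi> n x))" for n
    by (rule graded_map_cong[OF graded_map_compose[OF \<Phi>(1) \<Psi>(1) \<iota>] \<pi>\<iota>])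
  have g_comm: "D n (\<Psi> (Suc n) (\<Phi> (Suc n) x)) = \<Psi> n (\<Phi> n (D n x))"
    if x: "x \<in> free_carrier V (B (Suc n))" for n x
    using \<Psi>(2)[OF graded_mapD(1)[OF \<Phi>(1) x]] \<Phi>(2)[OF x] by simp
  have g0: "\<Psi> 0 (\<Phi> 0 x) = x" if x: "x \<in> free_carrier V (B 0)" for x
  proof -
    obtain p where "p \<in> carrier (poly_ring V)" "x = Poly_Mapping.single 0 p"
      using rank_one_free_carrier x unfolding R1(1) by blast
    then show ?thesis using \<Phi>(3) \<Psi>(3) \<pi>\<iota> by simp
  qed
  obtain h where h: "\<And>n. graded_map (\<lambda>p. p) V (B n) (d n) V (B (Suc n)) (d (Suc n)) (h n)"
    "\<And>n x. x \<in> free_carrier V (B (Suc n)) \<Longrightarrow>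
        \<Psi> (Suc n) (\<Phi> (Suc n) x) - x - h n (D n x) = D (Suc n) (h (Suc n) x)"
    "h 0 = (\<lambda>_. 0)"
    using chain_homotopy_exists[OF R g g_comm g0] by blast
  define C where "C = B (Suc i)"
  define C' where "C' = B' (Suc i)"
  have basis: "basis F n = B (Suc n)" "shift F n = d (Suc n)" "bd F n = D (Suc n)"
    "basis G n = B' (Suc n)" "shift G n = d' (Suc n)" "bd G n = D' (Suc n)" for n
    by (simp_all add: B_def d_def D_def B'_def d'_def D'_def)
  note D = R1(3) and D' = R2(3)
  have cycle_iff: "induced V (B n) (D n) (cls V (B (Suc n)) z) = \<zero>\<^bsub>ten V (B n)\<^esub>
      \<longleftrightarrow> pair_map 1 (D n) z \<in> rels V (B n)" for n z
    unfolding induced_cls[OF D graded_hom_id] ten_zero cls_eq_iff by simp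
  have cycle_iff': "induced W (B' n) (D' n) (cls W (B' (Suc n)) z) = \<zero>\<^bsub>ten W (B' n)\<^esub>
      \<longleftrightarrow> pair_map 1 (D' n) z \<in> rels W (B' n)" for n z
    unfolding induced_cls[OF D' graded_hom_id] ten_zero cls_eq_iff by simp
  \<comment> \<open>Homological degree \<open>i\<close> is level \<open>i + 1\<close>; in degree zero all chains are cycles.\<close>
  have cycles: "tor_cycles V F i j
      = cls V C ` {z \<in> frag_part V C (d (Suc i)) j. i \<noteq> 0 \<longrightarrow> pair_map 1 (D i) z \<in> rels V (B i)}"
    unfolding tor_cycles_def tor_part_eq basis
    unfolding filter_image
    by (cases i) (simp_all add: C_def basis tensor_map_eq cycle_iff)
  have cycles': "tor_cycles W G i j
      = cls W C' ` {z \<in> frag_part W C' (d' (Suc i)) j. i \<noteq> 0 \<longrightarrow> pair_map 1 (D' i) z \<in> rels W (B' i)}"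
    unfolding tor_cycles_def tor_part_eq basis
    unfolding filter_image
    by (cases i) (simp_all add: C'_def basis tensor_map_eq cycle_iff')
  have bounds: "tor_boundaries V F i j
      = (\<lambda>z. cls V C (pair_map 1 (D (Suc i)) z)) ` frag_part V (B (Suc (Suc i))) (d (Suc (Suc i))) j"
    unfolding tor_boundaries_def tor_part_eq basis C_def tensor_map_eq
    by (simp add: image_image induced_cls[OF D graded_hom_id])
  have bounds': "tor_boundaries W G i j
      = (\<lambda>z. cls W C' (pair_map 1 (D' (Suc i)) z)) ` frag_part W (B' (Suc (Suc i))) (d' (Suc (Suc i))) j"
    unfolding tor_boundaries_def tor_part_eq basis C'_def tensor_map_eq
    by (simp add: image_image induced_cls[OF D' graded_hom_id])
  note \<Phi>i = \<Phi>(1)[of "Suc i", folded C_def C'_def] and \<Psi>i = \<Psi>(1)[of "Suc i", folded C_def C'_def]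
  define \<phi> where "\<phi> = induced W C' (\<Phi> (Suc i))"
  have \<phi>_cls: "\<phi> (cls V C z) = cls W C' (pair_map 1 (\<Phi> (Suc i)) z)" for z
    unfolding \<phi>_def by (rule induced_cls[OF \<Phi>i \<iota>])
  have "quot_dim (ten V C) (tor_cycles V F i j) (tor_boundaries V F i j)
      \<le> quot_dim (ten W C') (tor_cycles W G i j) (tor_boundaries W G i j)"
  proof (rule quot_dim_le_if_injective[where \<phi> = \<phi>])
    show "tor_cycles V F i j \<subseteq> carrier (ten V C)"
      unfolding cycles ten_carrier using frag_part_frags by blast
    show "\<zero>\<^bsub>ten V C\<^esub> \<in> tor_cycles V F i j"
      unfolding cycles ten_zero by (rule imageI) (simp add: frag_part_closed rels_closed)
    show "x \<oplus>\<^bsub>ten V C\<^esub> y \<in> tor_cycles V F i j"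
      if "x \<in> tor_cycles V F i j" "y \<in> tor_cycles V F i j" for x y
    proof -
      obtain z z' where z: "z \<in> frag_part V C (d (Suc i)) j" "i \<noteq> 0 \<longrightarrow> pair_map 1 (D i) z \<in> rels V (B i)" "x = cls V C z"
        and z': "z' \<in> frag_part V C (d (Suc i)) j" "i \<noteq> 0 \<longrightarrow> pair_map 1 (D i) z' \<in> rels V (B i)" "y = cls V C z'"
        using \<open>x \<in> _\<close> \<open>y \<in> _\<close> unfolding cycles by blast
      show ?thesis
        unfolding cycles z(3) z'(3) ten_add
        by (rule imageI) (use z z' in \<open>simp add: frag_part_closed rels_closed\<close>)
    qed
    show "const c \<odot>\<^bsub>ten V C\<^esub> x \<in> tor_cycles V F i j" if "x \<in> tor_cycles V F i j" for c x
    proof -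
      obtain z where z: "z \<in> frag_part V C (d (Suc i)) j" "i \<noteq> 0 \<longrightarrow> pair_map 1 (D i) z \<in> rels V (B i)" "x = cls V C z"
        using \<open>x \<in> _\<close> unfolding cycles by blast
      have "pair_map 1 (D i) (pair_map c (\<lambda>y. y) z) = pair_map c (\<lambda>y. y) (pair_map 1 (D i) z)"
        by (simp add: pair_map_pair_map)
      then show ?thesis
        unfolding cycles z(3) ten_smult
        by (intro imageI)
          (use z in \<open>simp add: pair_map_frag_part[OF graded_map_id] pair_map_rels[OF graded_map_id graded_hom_id]\<close>)
    qed
    show "\<phi> x \<in> carrier (ten W C')" if "x \<in> carrier (ten V C)" for x
      using that by (auto simp: ten_carrier \<phi>_cls intro!: imageI pair_map_frags[OF \<Phi>i])
    show "\<phi> \<zero>\<^bsub>ten V C\<^esub> = \<zero>\<^bsub>ten W C'\<^esub>" by (simp add: ten_zero \<phi>_cls)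
    show "\<phi> (x \<oplus>\<^bsub>ten V C\<^esub> y) = \<phi> x \<oplus>\<^bsub>ten W C'\<^esub> \<phi> y"
      if "x \<in> carrier (ten V C)" "y \<in> carrier (ten V C)" for x y
      using that by (auto simp: ten_carrier ten_add \<phi>_cls)
    show "\<phi> (const c \<odot>\<^bsub>ten V C\<^esub> x) = const c \<odot>\<^bsub>ten W C'\<^esub> \<phi> x" if "x \<in> carrier (ten V C)" for c x
      using that by (auto simp: ten_carrier ten_smult \<phi>_cls pair_map_pair_map)
    show "\<phi> ` tor_cycles V F i j \<subseteq> tor_cycles W G i j"
    proof
      fix y assume "y \<in> \<phi> ` tor_cycles V F i j"
      then obtain z where z: "z \<in> frag_part V C (d (Suc i)) j" "i \<noteq> 0 \<longrightarrow> pair_map 1 (D i) z \<in> rels V (B i)"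
        and y: "y = cls W C' (pair_map 1 (\<Phi> (Suc i)) z)"
        unfolding cycles by (auto simp: \<phi>_cls)
      have "pair_map 1 (D' i) (pair_map 1 (\<Phi> (Suc i)) z) = pair_map 1 (\<Phi> i) (pair_map 1 (D i) z)"
        unfolding pair_map_pair_map
        by (rule pair_map_cong[OF frag_part_frags[OF z(1)]]) (simp add: C_def \<Phi>(2))
      then show "y \<in> tor_cycles W G i j"
        unfolding cycles' y using z pair_map_frag_part[OF \<Phi>i z(1)] pair_map_rels[OF \<Phi>(1) \<iota>]
        by (intro imageI) simp
    qed
    show "\<zero>\<^bsub>ten W C'\<^esub> \<in> tor_boundaries W G i j"
      unfolding bounds' ten_zero by (rule image_eqI[of _ _ 0]) (simp_all add: frag_part_closed)
  next
    fix x assume x: "x \<in> tor_cycles V F i j" and \<phi>x: "\<phi> x \<in> tor_boundaries W G i j"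
    obtain z where z: "z \<in> frag_part V C (d (Suc i)) j" "i \<noteq> 0 \<longrightarrow> pair_map 1 (D i) z \<in> rels V (B i)"
      and xz: "x = cls V C z"
      using x unfolding cycles by blast
    obtain w where w: "w \<in> frag_part W (B' (Suc (Suc i))) (d' (Suc (Suc i))) j"
      "cls W C' (pair_map 1 (\<Phi> (Suc i)) z) = cls W C' (pair_map 1 (D' (Suc i)) w)"
      using \<phi>x unfolding bounds' xz \<phi>_cls by blast
    let ?h = "\<lambda>y. h i (D i y)" and ?dh = "\<lambda>y. D (Suc i) (h (Suc i) y)"
    have zf: "z \<in> frags V C" by (rule frag_part_frags[OF z(1)])
    have hD: "?h y \<in> free_carrier V C" "?dh y \<in> free_carrier V C" if "y \<in> free_carrier V C" for y
      using that graded_mapD(1)[OF h(1)] graded_mapD(1)[OF D] by (simp_all add: C_def)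
    have homotopy: "pair_map 1 (\<lambda>y. \<Psi> (Suc i) (\<Phi> (Suc i) y)) z = pair_map 1 (\<lambda>y. (y + ?dh y) + ?h y) z"
    proof (rule pair_map_cong[OF zf])
      show "\<Psi> (Suc i) (\<Phi> (Suc i) y) = y + ?dh y + ?h y" if "y \<in> free_carrier V C" for y
        using h(2)[of y i] that by (simp add: C_def algebra_simps)
    qed
    have sum1: "pair_map 1 (\<lambda>y. (y + ?dh y) + ?h y) z - pair_map 1 (\<lambda>y. y + ?dh y) z - pair_map 1 ?h z \<in> rels V C"
      by (rule pair_map_add_rels[OF zf]) (simp_all add: hD free_closed)
    have sum2: "pair_map 1 (\<lambda>y. y + ?dh y) z - z - pair_map 1 ?dh z \<in> rels V C"
      using pair_map_add_rels[OF zf, of "\<lambda>y. y" V C ?dh 1] hD by (simp add: pair_map_1_id)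
    have hD_zero: "pair_map 1 ?h z \<in> rels V C"
    proof (cases i)
      case 0
      have "pair_map 1 (\<lambda>_. 0) z \<in> rels V C"
        using rels_closed(3)[OF rels_closed(1) pair_map_add_rels[OF zf, of "\<lambda>_. 0" V C "\<lambda>_. 0" 1]]
        by (simp add: free_closed)
      then show ?thesis using 0 h(3) by simp
    next
      case (Suc _)
      have "pair_map 1 (h i) (pair_map 1 (D i) z) \<in> rels V C"
        unfolding C_def using z(2) Suc by (intro pair_map_rels[OF h(1) graded_hom_id]) simp
      then show ?thesis by (simp add: pair_map_pair_map)
    qed
    have image: "pair_map 1 (\<lambda>y. \<Psi> (Suc i) (\<Phi> (Suc i) y)) z - pair_map 1 (\<lambda>y. \<Psi> (Suc i) (D' (Suc i) y)) w \<in> rels V C"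
      using pair_map_rels[OF \<Psi>i \<pi> w(2)[unfolded cls_eq_iff], of 1] by (simp add: pair_map_pair_map)
    have comm: "pair_map 1 (\<lambda>y. \<Psi> (Suc i) (D' (Suc i) y)) w = pair_map 1 (\<lambda>y. D (Suc i) (\<Psi> (Suc (Suc i)) y)) w"
      by (rule pair_map_cong[OF frag_part_frags[OF w(1)]]) (simp add: \<Psi>(2))
    define v where "v = pair_map 1 (\<Psi> (Suc (Suc i))) w - pair_map 1 (h (Suc i)) z"
    have Dv: "pair_map 1 (D (Suc i)) v
        = pair_map 1 (\<lambda>y. D (Suc i) (\<Psi> (Suc (Suc i)) y)) w - pair_map 1 ?dh z"
      by (simp add: v_def pair_map_pair_map)
    have "z - pair_map 1 (D (Suc i)) v
      = (pair_map 1 (\<lambda>y. \<Psi> (Suc i) (\<Phi> (Suc i) y)) z - pair_map 1 (\<lambda>y. \<Psi> (Suc i) (D' (Suc i) y)) w)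
        - (pair_map 1 (\<lambda>y. (y + ?dh y) + ?h y) z - pair_map 1 (\<lambda>y. y + ?dh y) z - pair_map 1 ?h z)
        - (pair_map 1 (\<lambda>y. y + ?dh y) z - z - pair_map 1 ?dh z) - pair_map 1 ?h z"
      unfolding homotopy comm Dv by (simp add: algebra_simps)
    also have "\<dots> \<in> rels V C"
      by (rule rels_closed(3)[OF rels_closed(3)[OF rels_closed(3)[OF image sum1] sum2] hD_zero])
    finally have "z - pair_map 1 (D (Suc i)) v \<in> rels V C" .
    moreover have "v \<in> frag_part V (B (Suc (Suc i))) (d (Suc (Suc i))) j"
      unfolding v_def
      by (intro frag_part_closed pair_map_frag_part[OF \<Psi>(1) w(1)] pair_map_frag_part[OF h(1) z(1)[unfolded C_def]])
    ultimately show "x \<in> tor_boundaries V F i j"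
      unfolding bounds xz by (intro image_eqI[of _ _ v]) (simp_all add: cls_eq_iff)
  qed (auto intro: ten_abelian_group ten_smult_closed simp: ten_smult_laws)
  then show ?thesis
    by (simp add: betti_def F_def[symmetric] G_def[symmetric] basis C_def C'_def)
qed

section \<open>Symbolic powers of parallelizations\<close>

lemma homogeneous_ideal_monomial:
  assumes up: "\<And>s t. Q s \<Longrightarrow> Q (s + t)"
  shows "homogeneous_ideal V (monomial_ideal V Q :: ('x, 'k::field) mpoly set)"
  unfolding homogeneous_ideal_def homogeneous_submodule_def
proof (intro conjI ballI allI)
  let ?M = "monomial_ideal V Q :: ('x, 'k) mpoly set"
  let ?S = "Poly_Mapping.single (0 :: nat) ` ?M"
  show "?S \<subseteq> free_carrier V {0}"
    by (auto simp: monomial_ideal_def poly_ring_carrier free_carrier_iff lookup_single when_def in_keys_iff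
        split: if_splits)
  show "0 \<in> ?S"
    by (rule image_eqI[of _ _ 0]) (auto simp: monomial_ideal_def poly_ring_closed)
  show "x + y \<in> ?S" if "x \<in> ?S" "y \<in> ?S" for x y
    using that by (auto simp flip: single_add intro: imageI monomial_ideal_add)
  show "scale p x \<in> ?S" if p: "p \<in> carrier (poly_ring V)" and x: "x \<in> ?S" for p x
  proof -
    obtain q where q: "q \<in> ?M" "x = Poly_Mapping.single 0 q" using x by blast
    have "p * q \<in> ?M" using monomial_ideal_mult[OF up q(1) p] by (simp add: mult.commute)
    then show ?thesis unfolding q(2) mult_single by simp
  qed
  show "homog_component (\<lambda>_. 0) j x \<in> ?S" if x: "x \<in> ?S" for j x
  proof -
    obtain q where q: "q \<in> ?M" "x = Poly_Mapping.single 0 q" using x by blast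
    let ?y = "homog_component (\<lambda>_. 0) j x"
    have "cf (cf ?y 0) t \<noteq> 0 \<Longrightarrow> t \<in> supp q" for t
      by (auto simp: cf_homog_component q in_keys_iff split: if_splits)
    then have "supp (cf ?y 0) \<subseteq> supp q" by (auto simp: in_keys_iff)
    then have "cf ?y 0 \<in> ?M" using q(1) by (auto simp: monomial_ideal_def poly_ring_carrier)
    moreover have "?y = Poly_Mapping.single 0 (cf ?y 0)"
    proof (rule free_eqI)
      fix b t
      show "cf (cf ?y b) t = cf (cf (Poly_Mapping.single 0 (cf ?y 0)) b) t"
        by (cases "b = 0") (simp_all add: cf_homog_component q lookup_single when_def)
    qed
    ultimately show ?thesis using imageI by metis
  qed
qed

lemma simple_graph_par:
  assumes "simple_graph V E"
  shows "simple_graph (par_verts V \<alpha>) (par_edges V E \<alpha>)"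
proof -
  have "finite V" using assms by (simp add: simple_graph_def)
  then have "finite (Sigma V (\<lambda>x. {1..\<alpha> x}))" by simp
  moreover have "par_verts V \<alpha> = Sigma V (\<lambda>x. {1..\<alpha> x})" by (auto simp: par_verts_def)
  moreover have "card e = 2" "e \<subseteq> par_verts V \<alpha>" if e_in: "e \<in> par_edges V E \<alpha>" for e
  proof -
    obtain x t y l where e: "e = {(x, t), (y, l)}" "(x, t) \<in> par_verts V \<alpha>" "(y, l) \<in> par_verts V \<alpha>" "{x, y} \<in> E"
      using e_in unfolding par_edges_def by blast
    have "card {x, y} = 2" using assms e(4) by (auto simp: simple_graph_def)
    then have "x \<noteq> y" by auto
    then show "card e = 2" "e \<subseteq> par_verts V \<alpha>" using e by auto
  qed
  ultimately show ?thesis by (simp add: simple_graph_def)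
qed

definition first_copy :: "'a \<Rightarrow> ('a \<times> nat) option" where
  "first_copy x = Some (x, 1)"

definition from_first_copy :: "'a \<times> nat \<Rightarrow> 'a option" where
  "from_first_copy v = (if snd v = 1 then Some (fst v) else None)"

lemma weight_push:
  assumes "finite C" "finite C'" "\<And>x. x \<in> supp t \<Longrightarrow> f x \<in> C' \<longleftrightarrow> x \<in> C"
  shows "weight C' (push f t) = weight C t"
  using assms(3)
proof (induction t rule: singles_induct)
  case 1
  then show ?case by (simp add: weight_def)
next
  case (2 x)
  then show ?case using assms(1,2)
    by (cases "cf t x = 0") (auto simp: weight_def lookup_single when_def)
next
  case (3 s t)
  then show ?case by (simp add: push_add weight_add supp_add_nat)
qed

lemma rename_monomial_ideal:
  assumes p: "p \<in> monomial_ideal V Q" and V: "\<And>x y. x \<in> V \<Longrightarrow> \<sigma> x = Some y \<Longrightarrow> y \<in> W"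
    and Q: "\<And>t. supp t \<subseteq> V \<Longrightarrow> supp t \<subseteq> dom \<sigma> \<Longrightarrow> Q t \<Longrightarrow> Q' (push (the \<circ> \<sigma>) t)"
  shows "rename \<sigma> p \<in> monomial_ideal W Q'"
  unfolding monomial_ideal_def
proof (intro CollectI conjI ballI)
  show "rename \<sigma> p \<in> carrier (poly_ring W)"
    using p V by (intro rename_in_poly_ring[of p V]) (auto simp: monomial_ideal_def)
  fix t assume "t \<in> supp (rename \<sigma> p)"
  then obtain u where "u \<in> supp p" "supp u \<subseteq> dom \<sigma>" "t = push (the \<circ> \<sigma>) u"
    by (rule supp_rename)
  then show "Q' t" using p Q by (auto simp: monomial_ideal_def poly_ring_carrier)
qed

theorem proposition4p4:
  fixes V :: "'a set" and E :: "'a set set" and \<alpha> :: "'a \<Rightarrow> nat" and m s i j :: nat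
  assumes "simple_graph V E" and "card V = m"
    and "s \<ge> 2"
    and "\<forall>x\<in>V. \<alpha> x \<ge> 1"
    and "i \<ge> 1" and "j \<ge> 1"
  shows
    "betti (par_verts V \<alpha>)
       (symbolic_power (poly_ring (par_verts V \<alpha>))
          (edge_ideal (par_verts V \<alpha>) (par_edges V E \<alpha>) :: ('a \<times> nat, 'k::field) mpoly set) s)
       i (int j)
     \<ge> betti V
         (symbolic_power (poly_ring V) (edge_ideal V E :: ('a, 'k) mpoly set) s)
         i (int j)"
proof -
  let ?W = "par_verts V \<alpha>" and ?E = "par_edges V E \<alpha>"
  note G = assms(1) and G' = simple_graph_par[OF assms(1), of \<alpha>]
  have V: "finite V" "finite ?W" using G G' by (simp_all add: simple_graph_def)
  have copy: "(x, 1) \<in> ?W" if "x \<in> V" for x using that assms(4) by (auto simp: par_verts_def)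
  have copy': "x \<in> V" if "(x, n) \<in> ?W" for x n using that by (auto simp: par_verts_def)
  have fin: "finite C" if "vertex_cover V E C" for C
    using that V finite_subset by (auto simp: vertex_cover_def)
  have fin': "finite C" if "vertex_cover ?W ?E C" for C
    using that V finite_subset by (auto simp: vertex_cover_def)
  show ?thesis
    unfolding symbolic_power_edge_ideal[OF G] symbolic_power_edge_ideal[OF G']
  proof (rule betti_le_if_retract[OF V, where \<iota> = "rename first_copy" and \<pi> = "rename from_first_copy"])
    let ?I = "monomial_ideal V (\<lambda>t. \<forall>C. vertex_cover V E C \<longrightarrow> s \<le> weight C t) :: ('a, 'k) mpoly set"
    let ?J = "monomial_ideal ?W (\<lambda>t. \<forall>C. vertex_cover ?W ?E C \<longrightarrow> s \<le> weight C t) :: ('a \<times> nat, 'k) mpoly set"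
    show "homogeneous_ideal V ?I" "homogeneous_ideal ?W ?J"
      by (rule homogeneous_ideal_monomial, fastforce simp: weight_add)+
    show "graded_hom V ?W (rename first_copy)" "graded_hom ?W V (rename from_first_copy)"
      using copy copy'
      by (auto intro!: graded_hom_rename simp: first_copy_def from_first_copy_def split: if_splits)
    show "rename from_first_copy (rename first_copy p) = p" if "p \<in> carrier (poly_ring V)"
      for p :: "('a, 'k) mpoly"
      using that by (rule rename_inverse) (simp add: first_copy_def from_first_copy_def)
    show "rename first_copy ` ?I \<subseteq> ?J"
    proof (intro image_subsetI rename_monomial_ideal allI impI)
      fix t C assume t: "supp t \<subseteq> V" "\<forall>C. vertex_cover V E C \<longrightarrow> s \<le> weight C t"
        and C: "vertex_cover ?W ?E C"
      let ?C = "{x \<in> V. (x, 1) \<in> C}"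
      have "e \<inter> ?C \<noteq> {}" if e: "e \<in> E" for e
      proof -
        have "card e = 2" "e \<subseteq> V" using G e by (auto simp: simple_graph_def)
        then obtain x y where xy: "e = {x, y}" "x \<in> V" "y \<in> V" by (auto simp: card_2_iff)
        then have edge: "{(x, 1), (y, 1)} \<in> ?E"
          using copy e unfolding par_edges_def by blast
        have "\<forall>e\<in>?E. e \<inter> C \<noteq> {}" using C unfolding vertex_cover_def by (rule conjunct2)
        from bspec[OF this edge] show ?thesis using xy by auto
      qed
      then have c: "vertex_cover V E ?C" by (auto simp: vertex_cover_def)
      then have "s \<le> weight ?C t" using t by blast
      also have "weight ?C t = weight C (push (the \<circ> first_copy) t)"
        using t by (intro weight_push[symmetric] fin[OF c] fin'[OF C]) (auto simp: first_copy_def)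
      finally show "s \<le> weight C (push (the \<circ> first_copy) t)" .
    qed (use copy in \<open>auto simp: first_copy_def\<close>)
    show "rename from_first_copy ` ?J \<subseteq> ?I"
    proof (intro image_subsetI rename_monomial_ideal allI impI)
      fix t C assume t: "supp t \<subseteq> ?W" "supp t \<subseteq> dom from_first_copy"
          "\<forall>C. vertex_cover ?W ?E C \<longrightarrow> s \<le> weight C t"
        and C: "vertex_cover V E C"
      let ?C = "{v \<in> ?W. fst v \<in> C}"
      have "e \<inter> ?C \<noteq> {}" if e: "e \<in> ?E" for e
      proof -
        obtain x n y l where e: "e = {(x, n), (y, l)}" "(x, n) \<in> ?W" "(y, l) \<in> ?W" "{x, y} \<in> E"
          using e unfolding par_edges_def by blast
        then have "x \<in> C \<or> y \<in> C" using C by (auto simp: vertex_cover_def)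
        then show ?thesis using e by auto
      qed
      then have c: "vertex_cover ?W ?E ?C" by (auto simp: vertex_cover_def)
      then have "s \<le> weight ?C t" using t by blast
      also have "weight ?C t = weight C (push (the \<circ> from_first_copy) t)"
        using t by (intro weight_push[symmetric] fin[OF C] fin'[OF c])
          (auto simp: from_first_copy_def dom_def split: if_splits)
      finally show "s \<le> weight C (push (the \<circ> from_first_copy) t)" .
    qed (use copy' in \<open>auto simp: from_first_copy_def split: if_splits\<close>)
  qed
qed

end
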